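(* Let $(M,\omega)$ be a symplectic manifold of dimension $2n$, let $r>0$, and let $\iota\colon Q_{5r}\to M$ be a symplectic embedding. For each positive integer $l$ let $W_l=\iota(\partial_lQ_r\cap Q_{5r})$, an open subset of $M$, and let $\|\cdot\|_l$ denote the norm $\|\cdot\|_{W_l}$. Then there exists a positive constant $C$ such that $\|[\phi_F,\phi_G]\|_l<C$ for any Hamiltonian functions $F,G\colon M\times[0,1]\to\mathbb{R}$ whose supports are contained in $\iota(Q_r)$ and any positive integer $l$. In particular, $\{W_l\}_{l=1,2,\dots}$ has uniformly bounded fragmented Hofer's geometry (UBFH).
   Context: For $r>0$, $Q_r=\{(x,y)\in\mathbb{R}^{2n}: |x_1|^2+\cdots+|x_n|^2+|y_1|^2+\cdots+|y_n|^2<r^2\}$, with the standard symplectic form $\omega_0=dx_1\wedge dy_1+\cdots+dx_n\wedge dy_n$. For a positive integer $l$ and a subset $X\subset\mathbb{R}^{2n}$, $\partial_lX$ denotes the $1/l$-neighborhood of the boundary $\partial X$ of $X$ in $\mathbb{R}^{2n}$. $[f,g]=fgf^{-1}g^{-1}$ is the commutator. A Hamiltonian function is a smooth compactly supported function $F\colon M\times[0,1]\to\mathbb{R}$; write $F_t(x)=F(x,t)$ and $\mathrm{Supp}(F)=\bigcup_{t\in[0,1]}\mathrm{Supp}(F_t)$. The Hamiltonian vector field $X_F^t$ is defined by $\omega(X_F^t,V)=-dF_t(V)$ for all vector fields $V$; $\{\phi_F^t\}_{t\in[0,1]}$ is the isotopy generated by $X_F^t$ with $\phi_F^0=\mathrm{id}$,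 and $\phi_F=\phi_F^1$ is the Hamiltonian diffeomorphism generated by $F$. $\mathrm{Ham}(M,\omega)$ is the group of all such Hamiltonian diffeomorphisms. Hofer's length: $\|F\|=\int_0^1(\max_M F_t-\min_M F_t)\,dt$. For a non-empty open $U\subset M$, Hofer's norm of $\phi$ fragmented by $U$ is $\|\phi\|_U=\inf\{\|F^1\|+\cdots+\|F^k\|\}$, the infimum being over all (finite) families of Hamiltonian functions $F^1,\dots,F^k\colon M\times[0,1]\to\mathbb{R}$ and Hamiltonian diffeomorphisms $h_1,\dots,h_k$ with $\mathrm{Supp}(F^i)\subset U$ for all $i$ and $\phi=h_1\phi_{F^1}h_1^{-1}\cdots h_k\phi_{F^k}h_k^{-1}$ (with $\inf\emptyset=+\infty$). A sequence $\{U_i\}_{i=1,2,\dots}$ of open subsets of $M$ has uniformly bounded fragmented Hofer's geometry (UBFH) if there are a non-trivial (i.e. not the identity) Hamiltonian diffeomorphism $\phi$ and a positive number $C$ such that $\|\phi\|_{U_i}<C$ for any $i$. *)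

theory Defs
  imports "HOL-Analysis.Analysis"
begin

text \<open>Meant for open \<open>S\<close>. In finite dimension, all directional derivatives being
  \<open>C\<^sup>k\<close> is the same as the derivative being \<open>C\<^sup>k\<close>.\<close>

fun Ck_on :: "nat \<Rightarrow> 'a::real_normed_vector set \<Rightarrow> ('a \<Rightarrow> 'b::real_normed_vector) \<Rightarrow> bool" where
  "Ck_on 0 S f \<longleftrightarrow> continuous_on S f"
| "Ck_on (Suc k) S f \<longleftrightarrow>
     (\<forall>x\<in>S. f differentiable (at x)) \<and> (\<forall>v. Ck_on k S (\<lambda>x. frechet_derivative f (at x) v))"

text \<open>Smoothness on an arbitrary set is the local existence of smooth extensions; this is needed
  for sets such as \<open>V \<times> {0..1}\<close> with \<open>V\<close> open.\<close>

definition smooth_on :: "'a::real_normed_vector set \<Rightarrow> ('a \<Rightarrow> 'b::real_normed_vector) \<Rightarrow> bool" where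
  "smooth_on S f \<longleftrightarrow>
     (\<forall>x\<in>S. \<exists>T g. open T \<and> x \<in> T \<and> (\<forall>k. Ck_on k T g) \<and> (\<forall>y\<in>S \<inter> T. g y = f y))"

type_synonym 'n phase = "(real^'n) \<times> (real^'n)"

definition omega0 :: "'n::finite phase \<Rightarrow> 'n phase \<Rightarrow> real" where
  "omega0 v w = (\<Sum>i\<in>UNIV. fst v $ i * snd w $ i - snd v $ i * fst w $ i)"

definition Q :: "real \<Rightarrow> 'n::finite phase set" where
  "Q r = {(x, y). (\<Sum>i\<in>UNIV. \<bar>x $ i\<bar>\<^sup>2) + (\<Sum>i\<in>UNIV. \<bar>y $ i\<bar>\<^sup>2) < r\<^sup>2}"

definition boundary_nbhd :: "nat \<Rightarrow> 'a::metric_space set \<Rightarrow> 'a set" where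
  "boundary_nbhd l X = {z. \<exists>p\<in>frontier X. dist p z < 1 / real l}"

text \<open>The manifold is the whole type \<open>'m\<close>; its dimension is \<open>2 * CARD('n)\<close>. A chart is a
  domain together with a coordinate map whose values outside the domain are irrelevant.\<close>

type_synonym ('m, 'n) chart = "'m set \<times> ('m \<Rightarrow> 'n phase)"

definition chart_image :: "('m, 'n::finite) chart \<Rightarrow> 'n phase set" where
  "chart_image c = snd c ` fst c"

definition chart_inv :: "('m, 'n::finite) chart \<Rightarrow> 'n phase \<Rightarrow> 'm" where
  "chart_inv c = inv_into (fst c) (snd c)"

definition transition :: "('m, 'n::finite) chart \<Rightarrow> ('m, 'n) chart \<Rightarrow> 'n phase \<Rightarrow> 'n phase" where
  "transition c d = snd d \<circ> chart_inv c"

definition smooth_atlas ::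
  "('m::{t2_space, second_countable_topology}, 'n::finite) chart set \<Rightarrow> bool" where
  "smooth_atlas A \<longleftrightarrow>
     (\<Union>c\<in>A. fst c) = UNIV \<and>
     (\<forall>c\<in>A. open (fst c) \<and> open (chart_image c) \<and>
        homeomorphism (fst c) (chart_image c) (snd c) (chart_inv c)) \<and>
     (\<forall>c\<in>A. \<forall>d\<in>A. smooth_on (snd c ` (fst c \<inter> fst d)) (transition c d))"

text \<open>A differential 2-form on the manifold is given by its coordinate expressions: \<open>\<omega> c z v w\<close>
  is the value, at the point with coordinates \<open>z\<close> in the chart \<open>c\<close>, on the tangent vectors with
  components \<open>v\<close> and \<open>w\<close>. Expressions in different charts are related by pullback along the
  transition maps.\<close>

type_synonym ('m, 'n) two_form = "('m, 'n) chart \<Rightarrow> 'n phase \<Rightarrow> 'n phase \<Rightarrow> 'n phase \<Rightarrow> real"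

definition differential_two_form ::
  "('m::{t2_space, second_countable_topology}, 'n::finite) chart set \<Rightarrow> ('m, 'n) two_form \<Rightarrow> bool" where
  "differential_two_form A \<omega> \<longleftrightarrow>
     (\<forall>c\<in>A. \<forall>z\<in>chart_image c. bilinear (\<omega> c z) \<and> (\<forall>v. \<omega> c z v v = 0)) \<and>
     (\<forall>c\<in>A. \<forall>v w. smooth_on (chart_image c) (\<lambda>z. \<omega> c z v w)) \<and>
     (\<forall>c\<in>A. \<forall>d\<in>A. \<forall>p\<in>fst c \<inter> fst d. \<forall>v w.
        \<omega> c (snd c p) v w =
        \<omega> d (snd d p) (frechet_derivative (transition c d) (at (snd c p)) v)
                       (frechet_derivative (transition c d) (at (snd c p)) w))"

text \<open>The exterior derivative in coordinates, evaluated on vectors \<open>u\<close>, \<open>v\<close>, \<open>w\<close> that are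
  extended to constant (hence commuting) vector fields.\<close>

definition ext_deriv ::
  "('n::finite phase \<Rightarrow> 'n phase \<Rightarrow> 'n phase \<Rightarrow> real) \<Rightarrow> 'n phase \<Rightarrow> 'n phase \<Rightarrow> 'n phase \<Rightarrow> 'n phase \<Rightarrow> real" where
  "ext_deriv \<eta> z u v w =
     frechet_derivative (\<lambda>y. \<eta> y v w) (at z) u -
     frechet_derivative (\<lambda>y. \<eta> y u w) (at z) v +
     frechet_derivative (\<lambda>y. \<eta> y u v) (at z) w"

definition symplectic_manifold ::
  "('m::{t2_space, second_countable_topology}, 'n::finite) chart set \<Rightarrow> ('m, 'n) two_form \<Rightarrow> bool" where
  "symplectic_manifold A \<omega> \<longleftrightarrow>
     smooth_atlas A \<and> differential_two_form A \<omega> \<and>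
     (\<forall>c\<in>A. \<forall>z\<in>chart_image c. \<forall>u v w. ext_deriv (\<omega> c) z u v w = 0) \<and>
     (\<forall>c\<in>A. \<forall>z\<in>chart_image c. \<forall>v. (\<forall>w. \<omega> c z v w = 0) \<longrightarrow> v = 0)"

text \<open>A homeomorphism onto its image that is smooth in charts and pulls \<open>\<omega>\<close> back to the standard
  form. The immersion property need not be listed: it follows from nondegeneracy of the standard
  form.\<close>

definition symplectic_embedding ::
  "('m::{t2_space, second_countable_topology}, 'n::finite) chart set \<Rightarrow> ('m, 'n) two_form \<Rightarrow>
   'n phase set \<Rightarrow> ('n phase \<Rightarrow> 'm) \<Rightarrow> bool" where
  "symplectic_embedding A \<omega> S \<iota> \<longleftrightarrow>
     homeomorphism S (\<iota> ` S) \<iota> (inv_into S \<iota>) \<and>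
     (\<forall>c\<in>A. smooth_on {z\<in>S. \<iota> z \<in> fst c} (snd c \<circ> \<iota>)) \<and>
     (\<forall>c\<in>A. \<forall>z\<in>S. \<iota> z \<in> fst c \<longrightarrow> (\<forall>v w.
        \<omega> c (snd c (\<iota> z)) (frechet_derivative (snd c \<circ> \<iota>) (at z) v)
                            (frechet_derivative (snd c \<circ> \<iota>) (at z) w) = omega0 v w))"

text \<open>Functions on \<open>M \<times> [0,1]\<close> are total functions whose values at times outside \<open>{0..1}\<close> are
  irrelevant.\<close>

definition hamiltonian_function ::
  "('m::{t2_space, second_countable_topology}, 'n::finite) chart set \<Rightarrow> ('m \<times> real \<Rightarrow> real) \<Rightarrow> bool" where
  "hamiltonian_function A F \<longleftrightarrow>
     (\<forall>c\<in>A. smooth_on (chart_image c \<times> {0..1}) (\<lambda>(z, t). F (chart_inv c z, t))) \<and>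
     compact (closure {(x, t). t \<in> {0..1} \<and> F (x, t) \<noteq> 0})"

definition Supp :: "('m::topological_space \<times> real \<Rightarrow> real) \<Rightarrow> 'm set" where
  "Supp F = (\<Union>t\<in>{0..1}. closure {x. F (x, t) \<noteq> 0})"

text \<open>The components in the chart \<open>c\<close> of the Hamiltonian vector field \<open>X\<^sub>F\<^sup>t\<close> at the point with
  coordinates \<open>z\<close>.\<close>

definition ham_vector_field ::
  "('m, 'n::finite) two_form \<Rightarrow> ('m \<times> real \<Rightarrow> real) \<Rightarrow> real \<Rightarrow> ('m, 'n) chart \<Rightarrow> 'n phase \<Rightarrow> 'n phase" where
  "ham_vector_field \<omega> F t c z =
     (THE X. \<forall>v. \<omega> c z X v = - frechet_derivative (\<lambda>y. F (chart_inv c y, t)) (at z) v)"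

definition ham_trajectory ::
  "('m::{t2_space, second_countable_topology}, 'n::finite) chart set \<Rightarrow> ('m, 'n) two_form \<Rightarrow>
   ('m \<times> real \<Rightarrow> real) \<Rightarrow> (real \<Rightarrow> 'm) \<Rightarrow> bool" where
  "ham_trajectory A \<omega> F \<gamma> \<longleftrightarrow>
     continuous_on {0..1} \<gamma> \<and>
     (\<forall>t\<in>{0..1}. \<forall>c\<in>A. \<gamma> t \<in> fst c \<longrightarrow>
        ((\<lambda>s. snd c (\<gamma> s)) has_vector_derivative ham_vector_field \<omega> F t c (snd c (\<gamma> t)))
          (at t within {0..1}))"

text \<open>The isotopy starting at the identity: for \<open>t \<in> {0..1}\<close> a point \<open>x\<close> is sent to the position
  at time \<open>t\<close> of the trajectory that is at \<open>x\<close> at time \<open>0\<close>.\<close>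

definition ham_isotopy ::
  "('m::{t2_space, second_countable_topology}, 'n::finite) chart set \<Rightarrow> ('m, 'n) two_form \<Rightarrow>
   ('m \<times> real \<Rightarrow> real) \<Rightarrow> real \<Rightarrow> 'm \<Rightarrow> 'm" where
  "ham_isotopy A \<omega> F t x = (THE y. \<exists>\<gamma>. ham_trajectory A \<omega> F \<gamma> \<and> \<gamma> 0 = x \<and> \<gamma> t = y)"

definition ham_diffeo ::
  "('m::{t2_space, second_countable_topology}, 'n::finite) chart set \<Rightarrow> ('m, 'n) two_form \<Rightarrow>
   ('m \<times> real \<Rightarrow> real) \<Rightarrow> 'm \<Rightarrow> 'm" where
  "ham_diffeo A \<omega> F = ham_isotopy A \<omega> F 1"

definition Ham ::
  "('m::{t2_space, second_countable_topology}, 'n::finite) chart set \<Rightarrow> ('m, 'n) two_form \<Rightarrow> ('m \<Rightarrow> 'm) set" where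
  "Ham A \<omega> = {ham_diffeo A \<omega> F | F. hamiltonian_function A F}"

definition commutator :: "('m \<Rightarrow> 'm) \<Rightarrow> ('m \<Rightarrow> 'm) \<Rightarrow> 'm \<Rightarrow> 'm" where
  "commutator f g = f \<circ> g \<circ> inv f \<circ> inv g"

text \<open>For a Hamiltonian function the supremum and the infimum are attained, because every \<open>F\<^sub>t\<close>
  is continuous with compact support.\<close>

definition hofer_length :: "('m \<times> real \<Rightarrow> real) \<Rightarrow> real" where
  "hofer_length F = integral {0..1} (\<lambda>t. (SUP x. F (x, t)) - (INF x. F (x, t)))"

text \<open>A list \<open>[(h\<^sub>1, F\<^sub>1), \<dots>, (h\<^sub>k, F\<^sub>k)]\<close> stands for the product of the
  \<open>h\<^sub>i \<circ> \<phi>\<^sub>F\<^sub>i \<circ> h\<^sub>i\<^sup>-\<^sup>1\<close> in this order. The infimum is taken in the extended reals, so that it is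
  infinite if there is no such factorisation.\<close>

definition fragmented_hofer_norm ::
  "('m::{t2_space, second_countable_topology}, 'n::finite) chart set \<Rightarrow> ('m, 'n) two_form \<Rightarrow>
   'm set \<Rightarrow> ('m \<Rightarrow> 'm) \<Rightarrow> ereal" where
  "fragmented_hofer_norm A \<omega> U \<phi> =
     Inf {ereal (\<Sum>(h, F)\<leftarrow>ps. hofer_length F) | ps.
        (\<forall>(h, F)\<in>set ps. h \<in> Ham A \<omega> \<and> hamiltonian_function A F \<and> Supp F \<subseteq> U) \<and>
        \<phi> = foldr (\<circ>) (map (\<lambda>(h, F). h \<circ> ham_diffeo A \<omega> F \<circ> inv h) ps) id}"

text \<open>Sequences are indexed by the positive integers; the value at \<open>0\<close> is irrelevant. The norm is
  only considered for non-empty open sets.\<close>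

definition UBFH ::
  "('m::{t2_space, second_countable_topology}, 'n::finite) chart set \<Rightarrow> ('m, 'n) two_form \<Rightarrow>
   (nat \<Rightarrow> 'm set) \<Rightarrow> bool" where
  "UBFH A \<omega> U \<longleftrightarrow>
     (\<forall>i\<ge>1. open (U i) \<and> U i \<noteq> {}) \<and>
     (\<exists>\<phi>\<in>Ham A \<omega>. \<phi> \<noteq> id \<and>
        (\<exists>C>0. \<forall>i\<ge>1. fragmented_hofer_norm A \<omega> (U i) \<phi> < ereal C))"

definition W ::
  "('n::finite phase \<Rightarrow> 'm) \<Rightarrow> real \<Rightarrow> nat \<Rightarrow> 'm set" where
  "W \<iota> r l = \<iota> ` (boundary_nbhd l (Q r) \<inter> Q (5 * r))"

end

theory Submission
  imports Defs
begin

text \<open>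
The commutator bound rests on the displacement trick. If \<open>f\<close> and \<open>g\<close> are supported in \<open>S\<close> and
\<open>k\<close> maps \<open>S\<close> off itself, then \<open>k \<circ> f\<^sup>-\<^sup>1 \<circ> k\<^sup>-\<^sup>1\<close> commutes with \<open>g\<close>, so \<open>[f, g] = [[f, k], g]\<close>, and
the right-hand side is a product of four conjugates of \<open>k\<close> and \<open>k\<^sup>-\<^sup>1\<close> (\<open>commutator_of_displaced\<close>).
The fragmented norm of \<open>[f, g]\<close> is therefore bounded independently of \<open>f\<close> and \<open>g\<close>, and what remains is to
displace the ball of radius \<open>r\<close> at a cost that does not depend on how thin the shell \<open>W \<iota> r l\<close> is.

A translation by \<open>3 * r\<close> in a coordinate direction displaces the ball, and it is generated by a linear function.
To move a ball it suffices to move its boundary sphere: if the linear function is cut off to a thin shell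
around the sphere, its flow still translates the sphere as long as the cut-off is inactive along the way, and by
uniqueness of solutions a point inside the moving sphere cannot escape from it (\<open>shell_flow_in_ball\<close>).
Hence the translation by \<open>3 * r\<close> is divided into \<open>N\<close> steps of length \<open>3 * r / N\<close>, with \<open>N\<close> large
compared with the inverse thickness of the shell. The step number \<open>j\<close> is the conjugate of one fixed
diffeomorphism, supported in the shell around the original sphere, by a Hamiltonian diffeomorphism \<open>h j\<close> that
carries the original ball to its current position (\<open>conjugates_drift\<close>). The cut-off linear
function has oscillation at most \<open>12 * r\<^sup>2 / N\<close>, so the \<open>N\<close> steps cost at most \<open>12 * r\<^sup>2\<close> whatever \<open>N\<close> is,
and the commutator costs at most \<open>48 * r\<^sup>2\<close>. One nontrivial commutator then witnesses UBFH.

All diffeomorphisms that occur are supported in the image of the ball of radius \<open>5 * r\<close>, so the analysis takes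
place in phase space and is carried over by the embedding. The inverse of the embedding is
smooth in charts because a symplectic derivative is inverted by the two-form itself (\<open>Ck_coord_inv\<close>), and a
vector field in phase space is pushed to the Hamiltonian vector field on the manifold
(\<open>ham_vector_field_inside\<close>). Flows exist and are unique because smooth functions of compact support have
Lipschitz vector fields. The conjugators have to be Hamiltonian, but this does not require smooth
dependence of flows on initial values: two Hamiltonian isotopies are composed by running one after the other,
with time reparametrised so that the speed vanishes where they meet (\<open>phase_flow_concat\<close>).
\<close>

section \<open>Functions of class $C^k$ and smooth functions\<close>

lemma Ck_on_mono: "Ck_on (Suc k) S f \<Longrightarrow> Ck_on k S f"
proof (induction k arbitrary: f)
  case 0
  then show ?case
    by (auto intro!: continuous_at_imp_continuous_on differentiable_imp_continuous_within)
next
  case (Suc k)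
  have "Ck_on (Suc k) S (\<lambda>x. frechet_derivative f (at x) v)" for v
    using Suc.prems unfolding Ck_on.simps(2)[of "Suc k"] by blast
  then have "Ck_on k S (\<lambda>x. frechet_derivative f (at x) v)" for v
    using Suc.IH by blast
  then show ?case
    using Suc.prems unfolding Ck_on.simps(2)[of k] Ck_on.simps(2)[of "Suc k"] by blast
qed

lemma Ck_on_subset: "Ck_on k S f \<Longrightarrow> T \<subseteq> S \<Longrightarrow> Ck_on k T f"
  by (induction k arbitrary: f) (auto intro: continuous_on_subset)

lemma frechet_derivative_cong_open:
  assumes "open S" "x \<in> S" "\<And>y. y \<in> S \<Longrightarrow> f y = g y"
  shows "frechet_derivative f (at x) = frechet_derivative g (at x)"
    and "f differentiable (at x) \<longleftrightarrow> g differentiable (at x)"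
proof -
  have "(f has_derivative D) (at x) \<longleftrightarrow> (g has_derivative D) (at x)" for D
    using assms by (metis has_derivative_transform_within_open)
  then show "frechet_derivative f (at x) = frechet_derivative g (at x)"
    "f differentiable (at x) \<longleftrightarrow> g differentiable (at x)"
    by (auto simp: frechet_derivative_def differentiable_def)
qed

lemma Ck_on_cong:
  assumes "open S" "\<And>y. y \<in> S \<Longrightarrow> f y = g y"
  shows "Ck_on k S f \<longleftrightarrow> Ck_on k S g"
  using assms(2)
proof (induction k arbitrary: f g)
  case 0
  then show ?case by (auto cong: continuous_on_cong)
next
  case (Suc k)
  have "Ck_on k S (\<lambda>x. frechet_derivative f (at x) v) \<longleftrightarrow> Ck_on k S (\<lambda>x. frechet_derivative g (at x) v)" for v
    by (rule Suc.IH) (simp add: frechet_derivative_cong_open(1)[OF assms(1) _ Suc.prems])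
  moreover have "f differentiable (at x) \<longleftrightarrow> g differentiable (at x)" if "x \<in> S" for x
    using frechet_derivative_cong_open(2)[OF assms(1) that Suc.prems] .
  ultimately show ?case by auto
qed

text \<open>For computing with explicit derivatives: \<open>Ck_on\<close> refers to the choice \<open>frechet_derivative\<close>, which agrees
  with any derivative found by the usual rules.\<close>

lemma Ck_on_SucI:
  assumes "open S" "\<And>x. x \<in> S \<Longrightarrow> (f has_derivative D x) (at x)"
    "\<And>v. Ck_on k S (\<lambda>x. D x v)"
  shows "Ck_on (Suc k) S f"
proof -
  have "frechet_derivative f (at x) = D x" if "x \<in> S" for x
    using frechet_derivative_at[OF assms(2)[OF that]] by simp
  then have "Ck_on k S (\<lambda>x. frechet_derivative f (at x) v)" for v
    using Ck_on_cong[OF assms(1), of "\<lambda>x. frechet_derivative f (at x) v" "\<lambda>x. D x v"] assms(3) by simp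
  then show ?thesis
    using assms(2) by (auto simp: differentiable_def)
qed

lemma Ck_on_SucD:
  assumes "Ck_on (Suc k) S f" "x \<in> S"
  shows "(f has_derivative frechet_derivative f (at x)) (at x)"
  using assms by (auto simp: frechet_derivative_works)

lemma Ck_on_const: "Ck_on k S (\<lambda>x. c)"
proof (induction k arbitrary: c)
  case (Suc k)
  then show ?case by (simp add: frechet_derivative_const[abs_def])
qed auto

lemma Ck_on_bounded_linear:
  assumes "bounded_linear h" "open S"
  shows "Ck_on k S h"
proof (cases k)
  case 0
  then show ?thesis using assms by (simp add: linear_continuous_on)
next
  case (Suc j)
  show ?thesis unfolding Suc
    by (rule Ck_on_SucI[OF assms(2) bounded_linear_imp_has_derivative[OF assms(1)] Ck_on_const])
qed

lemma Ck_on_bounded_linear_comp: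
  assumes "bounded_linear h" "open S" "Ck_on k S f"
  shows "Ck_on k S (\<lambda>x. h (f x))"
  using assms(3)
proof (induction k arbitrary: f)
  case 0
  then show ?case using assms(1) by (simp add: bounded_linear.continuous_on)
next
  case (Suc k)
  show ?case
    by (rule Ck_on_SucI[OF assms(2) bounded_linear.has_derivative[OF assms(1) Ck_on_SucD[OF Suc.prems]]])
       (use Suc in auto)
qed

lemma Ck_on_add:
  assumes "open S" "Ck_on k S f" "Ck_on k S g"
  shows "Ck_on k S (\<lambda>x. f x + g x)"
  using assms(2,3)
proof (induction k arbitrary: f g)
  case 0
  then show ?case by (auto intro: continuous_intros)
next
  case (Suc k)
  show ?case
    by (rule Ck_on_SucI[OF assms(1) has_derivative_add[OF Ck_on_SucD[OF Suc.prems(1)] Ck_on_SucD[OF Suc.prems(2)]]])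
       (use Suc in auto)
qed

lemma Ck_on_sum:
  assumes "open S" "finite I" "\<And>i. i \<in> I \<Longrightarrow> Ck_on k S (f i)"
  shows "Ck_on k S (\<lambda>x. \<Sum>i\<in>I. f i x)"
  using assms(2,3) by (induction I) (auto intro: Ck_on_const Ck_on_add[OF assms(1)])

lemma Ck_on_bilinear:
  assumes "bounded_bilinear h" "open S" "Ck_on k S f" "Ck_on k S g"
  shows "Ck_on k S (\<lambda>x. h (f x) (g x))"
  using assms(3,4)
proof (induction k arbitrary: f g)
  case 0
  then show ?case using bounded_bilinear.continuous_on[OF assms(1)] by auto
next
  case (Suc k)
  show ?case
    by (rule Ck_on_SucI[OF assms(2) bounded_bilinear.FDERIV[OF assms(1) Ck_on_SucD[OF Suc.prems(1)] Ck_on_SucD[OF Suc.prems(2)]]])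
       (use Suc Ck_on_mono[OF Suc.prems(1)] Ck_on_mono[OF Suc.prems(2)] in \<open>auto intro!: Ck_on_add[OF assms(2)]\<close>)
qed

text \<open>The chain rule expresses a directional derivative of \<open>g \<circ> f\<close> as a sum of products of
  directional derivatives along a basis, which is why the intermediate space has to be
  finite-dimensional.\<close>

lemma Ck_on_compose:
  fixes f :: "'a::real_normed_vector \<Rightarrow> 'b::euclidean_space" and g :: "'b \<Rightarrow> 'c::real_normed_vector"
  assumes "open S" "open T" "Ck_on k S f" "Ck_on k T g" "f ` S \<subseteq> T"
  shows "Ck_on k S (\<lambda>x. g (f x))"
  using assms(3,4)
proof (induction k arbitrary: g)
  case 0
  then show ?case using continuous_on_compose2[of T g S f] assms(5) by auto
next
  case (Suc k)
  let ?f' = "\<lambda>x. frechet_derivative f (at x)" and ?g' = "\<lambda>y. frechet_derivative g (at y)"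
  have fd: "(f has_derivative ?f' x) (at x)" and gd: "(g has_derivative ?g' (f x)) (at (f x))" if "x \<in> S" for x
    using Ck_on_SucD[OF Suc.prems(1) that] Ck_on_SucD[OF Suc.prems(2), of "f x"] that assms(5) by auto
  have eq: "(\<Sum>b\<in>Basis. (?f' x v \<bullet> b) *\<^sub>R ?g' (f x) b) = ?g' (f x) (?f' x v)" if "x \<in> S" for x v
  proof -
    have lin: "linear (?g' (f x))" using gd[OF that] has_derivative_linear by blast
    have "?g' (f x) (?f' x v) = ?g' (f x) (\<Sum>b\<in>Basis. (?f' x v \<bullet> b) *\<^sub>R b)"
      by (simp add: euclidean_representation)
    then show ?thesis by (simp add: linear_sum[OF lin] linear_cmul[OF lin])
  qed
  have D: "((\<lambda>x. g (f x)) has_derivative (\<lambda>v. \<Sum>b\<in>Basis. (?f' x v \<bullet> b) *\<^sub>R ?g' (f x) b)) (at x)"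
    if "x \<in> S" for x
    using has_derivative_compose[OF fd[OF that] gd[OF that]] by (simp add: eq[OF that])
  show ?case
  proof (rule Ck_on_SucI[OF assms(1) D])
    fix v
    have "Ck_on k S (\<lambda>x. ?g' (f x) b)" for b
      using Suc.IH[of "\<lambda>y. ?g' y b"] Ck_on_mono[OF Suc.prems(1)] Suc.prems(2) by simp
    moreover have "Ck_on k S (\<lambda>x. ?f' x v \<bullet> b)" for b
      by (rule Ck_on_bounded_linear_comp[OF bounded_linear_inner_left assms(1)]) (use Suc.prems(1) in auto)
    ultimately show "Ck_on k S (\<lambda>x. \<Sum>b\<in>Basis. (?f' x v \<bullet> b) *\<^sub>R ?g' (f x) b)"
      by (intro Ck_on_sum assms(1) finite_Basis Ck_on_bilinear[OF bounded_bilinear_scaleR])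
  qed
qed

lemma Ck_on_local:
  assumes "\<And>x. x \<in> S \<Longrightarrow> \<exists>T. open T \<and> x \<in> T \<and> Ck_on k T f"
  shows "Ck_on k S f"
  using assms
proof (induction k arbitrary: f)
  case 0
  then show ?case
    using continuous_at_imp_continuous_at_within
    by (fastforce simp: continuous_on_eq_continuous_within[of S] continuous_on_eq_continuous_at)
next
  case (Suc k)
  have "Ck_on k S (\<lambda>x. frechet_derivative f (at x) v)" for v
    by (rule Suc.IH) (use Suc.prems in fastforce)
  moreover have "f differentiable (at x)" if "x \<in> S" for x
    using Suc.prems[OF that] by auto
  ultimately show ?case by auto
qed

lemma smooth_onI:
  assumes "\<And>x. x \<in> S \<Longrightarrow> \<exists>T g. open T \<and> x \<in> T \<and> (\<forall>k. Ck_on k T g) \<and> (\<forall>y\<in>S \<inter> T. g y = f y)"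
  shows "smooth_on S f"
  unfolding smooth_on_def by (intro ballI assms)

lemma smooth_on_open_iff:
  assumes "open S"
  shows "smooth_on S f \<longleftrightarrow> (\<forall>k. Ck_on k S f)"
proof
  assume f: "smooth_on S f"
  show "\<forall>k. Ck_on k S f"
  proof
    fix k
    show "Ck_on k S f"
    proof (rule Ck_on_local)
      fix x assume "x \<in> S"
      then obtain T g where T: "open T" "x \<in> T" "Ck_on k T g" "\<forall>y\<in>S \<inter> T. g y = f y"
        using f unfolding smooth_on_def by blast
      then have "Ck_on k (S \<inter> T) f"
        using Ck_on_cong[of "S \<inter> T" g f k] Ck_on_subset[of k T g "S \<inter> T"] assms by auto
      then show "\<exists>T. open T \<and> x \<in> T \<and> Ck_on k T f"
        using T \<open>x \<in> S\<close> assms by (intro exI[of _ "S \<inter> T"]) auto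
    qed
  qed
next
  assume "\<forall>k. Ck_on k S f"
  then show "smooth_on S f" using assms
    by (intro smooth_onI exI[of _ S] exI[of _ f]) (simp del: Ck_on.simps)
qed

lemma smooth_onE:
  assumes "smooth_on S f" "x \<in> S"
  obtains T g where "open T" "x \<in> T" "\<And>k. Ck_on k T g" "\<And>y. y \<in> S \<Longrightarrow> y \<in> T \<Longrightarrow> g y = f y"
proof -
  obtain T g where *: "open T \<and> x \<in> T \<and> (\<forall>k. Ck_on k T g) \<and> (\<forall>y\<in>S \<inter> T. g y = f y)"
    using bspec[OF assms(1)[unfolded smooth_on_def] assms(2)] by (elim exE)
  show thesis by (rule that[of T g]) (use * in \<open>simp_all del: Ck_on.simps\<close>)
qed

lemma smooth_on_subset:
  assumes "smooth_on S f" "T \<subseteq> S"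
  shows "smooth_on T f"
proof (rule smooth_onI)
  fix x assume "x \<in> T"
  then obtain U g where "open U" "x \<in> U" "\<And>k. Ck_on k U g" "\<And>y. y \<in> S \<Longrightarrow> y \<in> U \<Longrightarrow> g y = f y"
    using smooth_onE[OF assms(1)] assms(2) by blast
  then show "\<exists>U g. open U \<and> x \<in> U \<and> (\<forall>k. Ck_on k U g) \<and> (\<forall>y\<in>T \<inter> U. g y = f y)"
    using assms(2) by blast
qed

lemma smooth_on_cong:
  assumes "\<And>x. x \<in> S \<Longrightarrow> f x = g x"
  shows "smooth_on S f \<longleftrightarrow> smooth_on S g"
proof -
  have "(\<forall>y\<in>S \<inter> T. h y = f y) \<longleftrightarrow> (\<forall>y\<in>S \<inter> T. h y = g y)" for T h
    using assms by auto
  then show ?thesis unfolding smooth_on_def by presburger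
qed

text \<open>Smoothness is a local property also on sets that are not open. This is how functions on
  \<open>chart_image c \<times> {0..1}\<close> are handled, which look different near the support and away from it.\<close>

lemma smooth_on_local:
  assumes "\<And>x. x \<in> S \<Longrightarrow> \<exists>T. open T \<and> x \<in> T \<and> smooth_on (S \<inter> T) f"
  shows "smooth_on S f"
proof (rule smooth_onI)
  fix x assume x: "x \<in> S"
  then obtain T where T: "open T" "x \<in> T" "smooth_on (S \<inter> T) f" using assms by blast
  then have xT: "x \<in> S \<inter> T" using x by simp
  obtain U g where U: "open U" "x \<in> U" "\<And>k. Ck_on k U g" "\<And>y. y \<in> S \<inter> T \<Longrightarrow> y \<in> U \<Longrightarrow> g y = f y"
    using smooth_onE[OF T(3) xT] by metis
  have "Ck_on k (T \<inter> U) g" for k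
    by (rule Ck_on_subset[OF U(3)]) simp
  then show "\<exists>T g. open T \<and> x \<in> T \<and> (\<forall>k. Ck_on k T g) \<and> (\<forall>y\<in>S \<inter> T. g y = f y)"
    using T U by (intro exI[of _ "T \<inter> U"] exI[of _ g]) (simp add: open_Int del: Ck_on.simps)
qed

lemma smooth_on_continuous_on:
  assumes "smooth_on S f" shows "continuous_on S f"
  unfolding continuous_on_eq_continuous_within
proof
  fix x assume x: "x \<in> S"
  obtain T g where T: "open T" "x \<in> T" "\<And>k. Ck_on k T g" "\<And>y. y \<in> S \<Longrightarrow> y \<in> T \<Longrightarrow> g y = f y"
    using smooth_onE[OF assms x] by metis
  have "continuous_on T g" using T(3)[of 0] by simp
  then have "continuous_on (S \<inter> T) f"
    using T(4) continuous_on_subset[of T g "S \<inter> T"] by (metis IntD1 IntD2 continuous_on_cong inf_le2)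
  then have "continuous (at x within S \<inter> T) f"
    using T x by (simp add: continuous_on_eq_continuous_within)
  then show "continuous (at x within S) f"
    using at_within_nhd[of x T "S \<inter> T" S] T(1,2) by (auto simp: continuous_within)
qed

lemma smooth_on_const: "smooth_on S (\<lambda>x. c)"
  by (rule smooth_onI, intro exI[of _ UNIV] exI[of _ "\<lambda>x. c"])
     (simp add: Ck_on_const del: Ck_on.simps)

lemma smooth_on_bounded_linear: "bounded_linear h \<Longrightarrow> smooth_on S h"
  by (rule smooth_onI, intro exI[of _ UNIV] exI[of _ h])
     (simp add: Ck_on_bounded_linear del: Ck_on.simps)

lemma smooth_on_bilinear:
  assumes h: "bounded_bilinear h" and "smooth_on S f" "smooth_on S g"
  shows "smooth_on S (\<lambda>x. h (f x) (g x))"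
  unfolding smooth_on_def
proof
  fix x assume x: "x \<in> S"
  obtain T f' where T: "open T" "x \<in> T" "\<And>k. Ck_on k T f'" "\<And>y. y \<in> S \<Longrightarrow> y \<in> T \<Longrightarrow> f' y = f y"
    using smooth_onE[OF assms(2) x] by metis
  obtain U g' where U: "open U" "x \<in> U" "\<And>k. Ck_on k U g'" "\<And>y. y \<in> S \<Longrightarrow> y \<in> U \<Longrightarrow> g' y = g y"
    using smooth_onE[OF assms(3) x] by metis
  have "Ck_on k (T \<inter> U) (\<lambda>x. h (f' x) (g' x))" for k
    by (intro Ck_on_bilinear[OF h] open_Int T(1) U(1) Ck_on_subset[OF T(3)] Ck_on_subset[OF U(3)]) auto
  then show "\<exists>T k. open T \<and> x \<in> T \<and> (\<forall>j. Ck_on j T k) \<and> (\<forall>y\<in>S \<inter> T. k y = h (f y) (g y))"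
    using T U by (intro exI[of _ "T \<inter> U"] exI[of _ "\<lambda>x. h (f' x) (g' x)"]) auto
qed

lemmas smooth_on_mult = smooth_on_bilinear[OF bounded_bilinear_mult]

lemma smooth_on_compose:
  fixes f :: "'a::real_normed_vector \<Rightarrow> 'b::euclidean_space" and g :: "'b \<Rightarrow> 'c::real_normed_vector"
  assumes "smooth_on S f" "smooth_on T g" "f ` S \<subseteq> T"
  shows "smooth_on S (\<lambda>x. g (f x))"
  unfolding smooth_on_def
proof
  fix x assume x: "x \<in> S"
  obtain U f' where U: "open U" "x \<in> U" "\<And>k. Ck_on k U f'" "\<And>y. y \<in> S \<Longrightarrow> y \<in> U \<Longrightarrow> f' y = f y"
    using smooth_onE[OF assms(1) x] by metis
  obtain V g' where V: "open V" "f x \<in> V" "\<And>k. Ck_on k V g'" "\<And>y. y \<in> T \<Longrightarrow> y \<in> V \<Longrightarrow> g' y = g y"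
    using smooth_onE[OF assms(2), of "f x"] x assms(3) by (metis image_subset_iff)
  define W where "W = U \<inter> f' -` V"
  have "continuous_on U f'" using U(3)[of 0] by simp
  then have W: "open W" unfolding W_def using U(1) V(1) by (rule continuous_open_preimage)
  have "Ck_on k W (\<lambda>x. g' (f' x))" for k
    by (rule Ck_on_compose[OF W V(1) Ck_on_subset[OF U(3)] V(3)]) (auto simp: W_def)
  moreover have "x \<in> W" using U(2,4) V(2) x by (auto simp: W_def)
  moreover have "g' (f' y) = g (f y)" if "y \<in> S \<inter> W" for y
  proof -
    have "f' y = f y" "f' y \<in> V" using that U(4) by (auto simp: W_def)
    then show ?thesis using V(4)[of "f y"] that assms(3) by auto
  qed
  ultimately show "\<exists>T k. open T \<and> x \<in> T \<and> (\<forall>j. Ck_on j T k) \<and> (\<forall>y\<in>S \<inter> T. k y = g (f y))"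
    using W by blast
qed

lemma smooth_on_add:
  assumes "smooth_on S f" "smooth_on S g"
  shows "smooth_on S (\<lambda>x. f x + g x)"
  unfolding smooth_on_def
proof
  fix x assume x: "x \<in> S"
  obtain T f' where T: "open T" "x \<in> T" "\<And>k. Ck_on k T f'" "\<And>y. y \<in> S \<Longrightarrow> y \<in> T \<Longrightarrow> f' y = f y"
    using smooth_onE[OF assms(1) x] by metis
  obtain U g' where U: "open U" "x \<in> U" "\<And>k. Ck_on k U g'" "\<And>y. y \<in> S \<Longrightarrow> y \<in> U \<Longrightarrow> g' y = g y"
    using smooth_onE[OF assms(2) x] by metis
  have "Ck_on k (T \<inter> U) (\<lambda>x. f' x + g' x)" for k
    by (intro Ck_on_add open_Int T(1) U(1) Ck_on_subset[OF T(3)] Ck_on_subset[OF U(3)]) auto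
  then show "\<exists>T k. open T \<and> x \<in> T \<and> (\<forall>j. Ck_on j T k) \<and> (\<forall>y\<in>S \<inter> T. k y = f y + g y)"
    using T U by (intro exI[of _ "T \<inter> U"] exI[of _ "\<lambda>x. f' x + g' x"]) auto
qed

lemma smooth_on_bounded_linear_comp:
  assumes "bounded_linear h" "smooth_on S f"
  shows "smooth_on S (\<lambda>x. h (f x))"
  unfolding smooth_on_def
proof
  fix x assume x: "x \<in> S"
  obtain T f' where T: "open T" "x \<in> T" "\<And>k. Ck_on k T f'" "\<And>y. y \<in> S \<Longrightarrow> y \<in> T \<Longrightarrow> f' y = f y"
    using smooth_onE[OF assms(2) x] by metis
  then show "\<exists>T k. open T \<and> x \<in> T \<and> (\<forall>j. Ck_on j T k) \<and> (\<forall>y\<in>S \<inter> T. k y = h (f y))"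
    using Ck_on_bounded_linear_comp[OF assms(1) T(1) T(3)]
    by (intro exI[of _ T] exI[of _ "\<lambda>x. h (f' x)"]) simp
qed

lemma smooth_on_minus: "smooth_on S f \<Longrightarrow> smooth_on S (\<lambda>x. - f x)"
  by (rule smooth_on_bounded_linear_comp[OF bounded_linear_minus[OF bounded_linear_ident]])

lemma smooth_on_diff: "smooth_on S f \<Longrightarrow> smooth_on S g \<Longrightarrow> smooth_on S (\<lambda>x. f x - g x)"
  using smooth_on_add[OF _ smooth_on_minus] by fastforce

lemma smooth_on_Pair:
  assumes "smooth_on S f" "smooth_on S g"
  shows "smooth_on S (\<lambda>x. (f x, g x))"
proof -
  have "bounded_linear (\<lambda>x::'b. (x, 0::'c))" "bounded_linear (\<lambda>x::'c. (0::'b, x))"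
    by (auto intro!: bounded_linear_Pair bounded_linear_zero bounded_linear_ident)
  then have "smooth_on S (\<lambda>x. (f x, 0) + (0, g x))"
    using assms by (intro smooth_on_add) (auto intro: smooth_on_bounded_linear_comp)
  then show ?thesis by simp
qed

lemma smooth_on_fst: "smooth_on S f \<Longrightarrow> smooth_on S (\<lambda>x. fst (f x))"
  by (rule smooth_on_bounded_linear_comp[OF bounded_linear_fst])

lemma smooth_on_snd: "smooth_on S f \<Longrightarrow> smooth_on S (\<lambda>x. snd (f x))"
  by (rule smooth_on_bounded_linear_comp[OF bounded_linear_snd])

lemma smooth_on_id: "smooth_on S (\<lambda>x. x)"
  by (rule smooth_on_bounded_linear[OF bounded_linear_ident])

text \<open>The chain rule is not in this collection: its conclusion contains \<open>g (f x)\<close> with both functions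
  unknown and would match everything.\<close>

lemmas smooth_intros =
  smooth_on_const smooth_on_id smooth_on_add smooth_on_diff smooth_on_minus
  smooth_on_mult smooth_on_Pair smooth_on_fst smooth_on_snd
  smooth_on_bilinear[OF bounded_bilinear_inner] smooth_on_bilinear[OF bounded_bilinear_scaleR]

lemma smooth_on_map_fst:
  fixes g :: "'a::euclidean_space \<Rightarrow> 'b::real_normed_vector"
  assumes "smooth_on T g" "\<And>p. p \<in> S \<Longrightarrow> fst p \<in> T"
  shows "smooth_on S (\<lambda>p::'a \<times> real. (g (fst p), snd p))"
proof -
  have "smooth_on S (\<lambda>p::'a \<times> real. g (fst p))"
    using smooth_on_compose[OF smooth_on_fst[OF smooth_on_id] assms(1), of S] assms(2) by blast
  then show ?thesis by (rule smooth_on_Pair[OF _ smooth_on_snd[OF smooth_on_id]])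
qed

lemma smooth_on_inverse: "smooth_on {x::real. x \<noteq> 0} inverse"
proof -
  have o: "open {x::real. x \<noteq> 0}" by (simp add: open_Collect_neq)
  have "Ck_on k {x::real. x \<noteq> 0} inverse" for k
  proof (induction k)
    case 0
    then show ?case by (auto intro!: continuous_intros)
  next
    case (Suc k)
    show ?case
    proof (rule Ck_on_SucI[OF o])
      show "(inverse has_derivative (\<lambda>h. - (inverse x * h * inverse x))) (at x)"
        if "x \<in> {x::real. x \<noteq> 0}" for x
        using has_derivative_inverse'[of x UNIV] that by simp
      have "Ck_on k {x::real. x \<noteq> 0} (\<lambda>x. (- v) * (inverse x * inverse x))" for v
        by (intro Ck_on_bilinear[OF bounded_bilinear_mult o] Ck_on_const Suc)
      then show "Ck_on k {x::real. x \<noteq> 0} (\<lambda>x. - (inverse x * v * inverse x))" for v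
        by (simp add: mult_ac)
    qed
  qed
  then show ?thesis using smooth_on_open_iff[OF o] by blast
qed

section \<open>A smooth step function\<close>

text \<open>These functions are closed under differentiation, which gives smoothness at the origin for all of them at
  once. With the constant polynomial \<open>1\<close> it is the usual function \<open>exp (- 1 / x)\<close> extended by zero.\<close>

definition flat :: "real poly \<Rightarrow> real \<Rightarrow> real" where
  "flat p x = (if x \<le> 0 then 0 else poly p (1 / x) * exp (- (1 / x)))"

lemma tendsto_poly_times_exp_minus:
  fixes p :: "real poly"
  shows "((\<lambda>y. poly p y * exp (- y)) \<longlongrightarrow> 0) at_top"
proof -
  have "((\<lambda>y. \<Sum>i\<le>degree p. coeff p i * (y ^ i / exp y)) \<longlongrightarrow> (\<Sum>i\<le>degree p. coeff p i * 0)) at_top"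
    by (intro tendsto_intros tendsto_power_div_exp_0)
  then show ?thesis
    by (simp add: poly_altdef sum_distrib_right exp_minus divide_inverse mult.assoc)
qed

lemma tendsto_flat_div: "((\<lambda>h. flat p h / h) \<longlongrightarrow> 0) (at 0)"
proof (rule filterlim_split_at)
  show "((\<lambda>h. flat p h / h) \<longlongrightarrow> 0) (at_left 0)"
    by (rule tendsto_eventually) (auto simp: flat_def eventually_at_left_field intro!: exI[of _ "-1"])
  have "((\<lambda>h. poly (pCons 0 p) (inverse h) * exp (- inverse h)) \<longlongrightarrow> 0) (at_right 0)"
    by (rule filterlim_compose[OF tendsto_poly_times_exp_minus filterlim_inverse_at_top_right])
  then show "((\<lambda>h. flat p h / h) \<longlongrightarrow> 0) (at_right 0)"
  proof (rule Lim_transform_eventually)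
    show "\<forall>\<^sub>F h in at_right 0. poly (pCons 0 p) (inverse h) * exp (- inverse h) = flat p h / h"
      by (auto simp: flat_def eventually_at_right_field inverse_eq_divide intro!: exI[of _ 1])
  qed
qed

lemma flat_has_derivative:
  "(flat p has_field_derivative flat (monom 1 2 * (p - pderiv p)) x) (at x)"
proof -
  let ?q = "monom 1 2 * (p - pderiv p)"
  consider "x < 0" | "x = 0" | "x > 0" by linarith
  then show ?thesis
  proof cases
    case 1
    have "(flat p has_field_derivative 0) (at x)"
      by (rule has_field_derivative_transform_within_open[where S="{..<0}" and f="\<lambda>x. 0"])
         (use 1 in \<open>auto simp: flat_def\<close>)
    then show ?thesis using 1 by (simp add: flat_def)
  next
    case 2
    then show ?thesis
      using tendsto_flat_div[of p] by (simp add: DERIV_def) (simp add: flat_def)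
  next
    case 3
    have "((\<lambda>x. poly p (1 / x) * exp (- (1 / x))) has_field_derivative flat ?q x) (at x)"
      using 3 by (auto intro!: derivative_eq_intros
          simp: flat_def poly_monom field_simps power2_eq_square)
    then show ?thesis
      by (rule has_field_derivative_transform_within_open[where S="{0<..}"])
         (use 3 in \<open>auto simp: flat_def\<close>)
  qed
qed

lemma smooth_flat: "smooth_on S (flat p)"
proof -
  have "Ck_on k UNIV (flat p)" for k
  proof (induction k arbitrary: p)
    case 0
    show ?case
      using flat_has_derivative DERIV_continuous by (force simp: continuous_on_eq_continuous_at)
  next
    case (Suc k)
    show ?case
    proof (rule Ck_on_SucI[OF open_UNIV flat_has_derivative[unfolded has_field_derivative_def]])
      show "Ck_on k UNIV (\<lambda>x. flat (monom 1 2 * (p - pderiv p)) x * v)" for v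
        by (rule Ck_on_bilinear[OF bounded_bilinear_mult open_UNIV Suc Ck_on_const])
    qed
  qed
  then have "smooth_on UNIV (flat p)" using smooth_on_open_iff[OF open_UNIV] by blast
  then show ?thesis by (rule smooth_on_subset) simp
qed

definition smooth_step :: "real \<Rightarrow> real" where
  "smooth_step x = flat 1 x * inverse (flat 1 x + flat 1 (1 - x))"

lemma flat_one_sum_pos: "flat 1 x + flat 1 (1 - x) > 0"
  by (cases "x \<le> 0"; cases "x \<ge> 1") (auto simp: flat_def add_pos_pos)

lemma smooth_smooth_step: "smooth_on S smooth_step"
proof -
  have "smooth_on S (\<lambda>x. flat 1 (1 - x))"
    by (rule smooth_on_compose[OF _ smooth_flat[of UNIV]]) (auto intro!: smooth_intros)
  then have "smooth_on S (\<lambda>x. flat 1 x + flat 1 (1 - x))"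
    by (intro smooth_intros smooth_flat)
  then have "smooth_on S (\<lambda>x. inverse (flat 1 x + flat 1 (1 - x)))"
    by (rule smooth_on_compose[OF _ smooth_on_inverse])
       (use flat_one_sum_pos in \<open>auto simp: less_imp_neq[symmetric]\<close>)
  then show ?thesis
    unfolding smooth_step_def[abs_def] by (intro smooth_intros smooth_flat)
qed

lemma smooth_step_0: "x \<le> 0 \<Longrightarrow> smooth_step x = 0"
  by (simp add: smooth_step_def flat_def)

lemma smooth_step_1: "x \<ge> 1 \<Longrightarrow> smooth_step x = 1"
  by (simp add: smooth_step_def flat_def)

lemma smooth_step_bounds: "0 \<le> smooth_step x" "smooth_step x \<le> 1"
proof -
  have "flat 1 x \<ge> 0" "flat 1 (1 - x) \<ge> 0" by (auto simp: flat_def)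
  then show "0 \<le> smooth_step x" "smooth_step x \<le> 1"
    using flat_one_sum_pos[of x]
    by (auto simp: smooth_step_def divide_inverse[symmetric] divide_le_eq)
qed

lemma smooth_step_deriv: "(smooth_step has_field_derivative deriv smooth_step x) (at x)"
proof -
  have "Ck_on (Suc 0) UNIV smooth_step"
    using smooth_smooth_step[of UNIV] smooth_on_open_iff[OF open_UNIV] by blast
  then have "smooth_step differentiable (at x)" by simp
  then show ?thesis
    using DERIV_deriv_iff_real_differentiable by blast
qed

lemma smooth_deriv_smooth_step: "smooth_on S (deriv smooth_step)"
proof -
  have "frechet_derivative smooth_step (at x) 1 = deriv smooth_step x" for x
    using frechet_derivative_at[OF smooth_step_deriv[of x, unfolded has_field_derivative_def]]
    by (metis mult_cancel_left2)
  moreover have "Ck_on k UNIV (\<lambda>x. frechet_derivative smooth_step (at x) 1)" for k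
  proof -
    have "Ck_on (Suc k) UNIV smooth_step"
      using smooth_smooth_step[of UNIV] smooth_on_open_iff[OF open_UNIV] by blast
    then show ?thesis by simp
  qed
  ultimately have "smooth_on UNIV (deriv smooth_step)"
    using smooth_on_open_iff[OF open_UNIV, of "deriv smooth_step"] by simp
  then show ?thesis by (rule smooth_on_subset) simp
qed

text \<open>Outside the unit interval the function attains its minimum or its maximum.\<close>

lemma deriv_smooth_step_0:
  assumes "x \<le> 0 \<or> x \<ge> 1"
  shows "deriv smooth_step x = 0"
  using assms
proof
  assume "x \<le> 0"
  then show ?thesis
    using DERIV_local_min[OF smooth_step_deriv[of x], of 1] smooth_step_bounds by (simp add: smooth_step_0)
next
  assume "x \<ge> 1"
  then show ?thesis
    using DERIV_local_max[OF smooth_step_deriv[of x], of 1] smooth_step_bounds by (simp add: smooth_step_1)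
qed

section \<open>Differential equations with Lipschitz right-hand side\<close>

definition solves_ode_on :: "(real \<Rightarrow> 'a::real_normed_vector \<Rightarrow> 'a) \<Rightarrow> real set \<Rightarrow> (real \<Rightarrow> 'a) \<Rightarrow> bool" where
  "solves_ode_on X I \<delta> \<longleftrightarrow> (\<forall>t\<in>I. (\<delta> has_vector_derivative X t (\<delta> t)) (at t within I))"

text \<open>Gronwall's argument in both time directions: \<open>exp (- 2 * L * t) * norm (w t)\<^sup>2\<close> does not increase and
  \<open>exp (2 * L * t) * norm (w t)\<^sup>2\<close> does not decrease.\<close>

lemma gronwall_zero:
  fixes w :: "real \<Rightarrow> 'a::euclidean_space"
  assumes der: "\<And>t. t \<in> {a..b} \<Longrightarrow> (w has_vector_derivative w' t) (at t within {a..b})"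
    and bound: "\<And>t. t \<in> {a..b} \<Longrightarrow> norm (w' t) \<le> L * norm (w t)"
    and t0: "t0 \<in> {a..b}" "w t0 = 0" and t: "t \<in> {a..b}"
  shows "w t = 0"
proof -
  have cont: "continuous_on {a..b} w"
    using der by (meson continuous_on_vector_derivative)
  have ip: "\<bar>w s \<bullet> w' s\<bar> \<le> L * (w s \<bullet> w s)" if "s \<in> {a..b}" for s
  proof -
    have "\<bar>w s \<bullet> w' s\<bar> \<le> norm (w s) * norm (w' s)" by (rule Cauchy_Schwarz_ineq2)
    also have "\<dots> \<le> norm (w s) * (L * norm (w s))"
      using bound[OF that] by (intro mult_left_mono) auto
    finally show ?thesis by (simp add: dot_square_norm power2_eq_square mult_ac)
  qed
  have D: "((\<lambda>s. exp (c * s) * (w s \<bullet> w s)) has_real_derivative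
      exp (c * s) * (c * (w s \<bullet> w s) + 2 * (w s \<bullet> w' s))) (at s)" if "a < s" "s < b" for s c
  proof -
    have "(w has_derivative (\<lambda>h. h *\<^sub>R w' s)) (at s)"
      using der[of s] that by (simp add: at_within_Icc_at has_vector_derivative_def)
    then show ?thesis
      unfolding has_field_derivative_def
      by (auto intro!: derivative_eq_intros simp: algebra_simps inner_commute)
  qed
  have C: "continuous_on {c..d} (\<lambda>s. exp (k * s) * (w s \<bullet> w s))" if "{c..d} \<subseteq> {a..b}" for k c d
    by (intro continuous_intros continuous_on_subset[OF cont that])
  show ?thesis
  proof (cases "t0 \<le> t")
    case True
    have "exp (- 2 * L * t) * (w t \<bullet> w t) \<le> exp (- 2 * L * t0) * (w t0 \<bullet> w t0)"
    proof (rule DERIV_nonpos_imp_decreasing_open[OF True])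
      show "\<exists>y. ((\<lambda>s. exp (- 2 * L * s) * (w s \<bullet> w s)) has_real_derivative y) (at s) \<and> y \<le> 0"
        if "t0 < s" "s < t" for s
      proof -
        have s: "a < s" "s < b" using that t0 t by auto
        then have "exp (- 2 * L * s) * (- 2 * L * (w s \<bullet> w s) + 2 * (w s \<bullet> w' s)) \<le> 0"
          using ip[of s] by (intro mult_nonneg_nonpos) auto
        then show ?thesis using D[OF s, of "- 2 * L"] by blast
      qed
    qed (use C[of t0 t "- 2 * L"] t0 t in auto)
    then show ?thesis using t0(2) by (simp add: mult_le_0_iff dot_square_norm)
  next
    case False
    then have le: "t \<le> t0" by simp
    have "exp (2 * L * t) * (w t \<bullet> w t) \<le> exp (2 * L * t0) * (w t0 \<bullet> w t0)"
    proof (rule DERIV_nonneg_imp_increasing_open[OF le])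
      show "\<exists>y. ((\<lambda>s. exp (2 * L * s) * (w s \<bullet> w s)) has_real_derivative y) (at s) \<and> 0 \<le> y"
        if "t < s" "s < t0" for s
      proof -
        have s: "a < s" "s < b" using that t0 t by auto
        then have "0 \<le> exp (2 * L * s) * (2 * L * (w s \<bullet> w s) + 2 * (w s \<bullet> w' s))"
          using ip[of s] by (intro mult_nonneg_nonneg) auto
        then show ?thesis using D[OF s, of "2 * L"] by blast
      qed
    qed (use C[of t t0 "2 * L"] t0 t in auto)
    then show ?thesis using t0(2) by (simp add: mult_le_0_iff dot_square_norm)
  qed
qed

lemma ode_unique:
  fixes X :: "real \<Rightarrow> 'a::euclidean_space \<Rightarrow> 'a"
  assumes "solves_ode_on X {a..b} \<gamma>" "solves_ode_on X {a..b} \<delta>"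
    and lip: "\<And>t z w. t \<in> {a..b} \<Longrightarrow> norm (X t z - X t w) \<le> L * norm (z - w)"
    and "t0 \<in> {a..b}" "\<gamma> t0 = \<delta> t0" "t \<in> {a..b}"
  shows "\<gamma> t = \<delta> t"
proof -
  have "\<gamma> t - \<delta> t = 0"
    by (rule gronwall_zero[where w="\<lambda>t. \<gamma> t - \<delta> t" and w'="\<lambda>t. X t (\<gamma> t) - X t (\<delta> t)" and L=L and a=a and b=b and ?t0.0=t0])
       (use assms in \<open>auto intro!: has_vector_derivative_diff simp: solves_ode_on_def\<close>)
  then show ?thesis by simp
qed

lemma ode_exists:
  fixes X :: "real \<Rightarrow> 'a::euclidean_space \<Rightarrow> 'a"
  assumes cont: "continuous_on ({0..1} \<times> UNIV) (\<lambda>(t, z). X t z)"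
    and lip: "\<And>t z w. t \<in> {0..1} \<Longrightarrow> norm (X t z - X t w) \<le> L * norm (z - w)"
    and L: "L > 0"
  shows "\<exists>\<delta>. solves_ode_on X {0..1} \<delta> \<and> \<delta> 0 = z0"
proof -
  have contX: "continuous_on {0..1} (\<lambda>s. X s (f s))" if "continuous_on {0..1} f" for f
    using continuous_on_compose2[OF cont continuous_on_Pair[OF continuous_on_id that]] by auto
  define c :: "real \<Rightarrow> real" where "c t = max 0 (min 1 t)" for t
  have c: "c t \<in> {0..1}" "t \<in> {0..1} \<Longrightarrow> c t = t" for t by (auto simp: c_def)
  define V where "V g s = X s (exp (2 * L * s) *\<^sub>R apply_bcontfun g s)" for g :: "real \<Rightarrow>\<^sub>C 'a" and s
  define P where "P g t = exp (- 2 * L * t) *\<^sub>R (z0 + integral {0..t} (V g))" for g t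
  define S where "S g = Bcontfun (\<lambda>t. P g (c t))" for g
  have contV: "continuous_on {0..1} (V g)" for g
    unfolding V_def by (intro contX continuous_intros) auto
  have contP: "continuous_on {0..1} (P g)" for g
    unfolding P_def by (intro continuous_intros indefinite_integral_continuous_1
        integrable_continuous_real contV)
  have "(\<lambda>t. P g (c t)) \<in> bcontfun" for g
  proof -
    have "continuous_on UNIV (\<lambda>t. P g (c t))"
      by (rule continuous_on_compose2[OF contP[of g]])
         (use c in \<open>auto simp: c_def intro!: continuous_intros\<close>)
    moreover have "bounded (range (\<lambda>t. P g (c t)))"
      using compact_continuous_image[OF contP[of g] compact_Icc]
      by (rule bounded_subset[OF compact_imp_bounded]) (use c in auto)
    ultimately show ?thesis by (simp add: bcontfun_def)
  qed
  then have S: "apply_bcontfun (S g) t = P g (c t)" for g t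
    by (simp add: S_def Bcontfun_inverse)
  \<comment> \<open>The weight \<open>exp (- 2 * L * t)\<close> makes the Picard operator a contraction with factor
    \<open>1 / 2\<close> on the whole time interval, whatever the Lipschitz constant is.\<close>
  have "dist (S f) (S g) \<le> 1 / 2 * dist f g" for f g
  proof (rule dist_bound)
    fix t
    define u where "u = c t"
    have u: "0 \<le> u" "u \<le> 1" using c(1)[of t] by (auto simp: u_def)
    have int: "V h integrable_on {0..u}" for h
      by (rule integrable_continuous_real[OF continuous_on_subset[OF contV]]) (use u in auto)
    have H: "((\<lambda>s. L * (exp (2 * L * s) * dist f g)) has_integral
        (exp (2 * L * u) * dist f g / 2 - exp (2 * L * 0) * dist f g / 2)) {0..u}"
      by (rule fundamental_theorem_of_calculus[OF u(1)])
         (auto intro!: derivative_eq_intros simp: has_real_derivative_iff_has_vector_derivative[symmetric])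
    have "norm (integral {0..u} (\<lambda>s. V f s - V g s)) \<le> integral {0..u} (\<lambda>s. L * (exp (2 * L * s) * dist f g))"
    proof (rule integral_norm_bound_integral)
      fix s assume s: "s \<in> {0..u}"
      have "norm (V f s - V g s) \<le> L * norm (exp (2 * L * s) *\<^sub>R apply_bcontfun f s - exp (2 * L * s) *\<^sub>R apply_bcontfun g s)"
        unfolding V_def using s u by (intro lip) auto
      also have "\<dots> = L * (exp (2 * L * s) * dist (apply_bcontfun f s) (apply_bcontfun g s))"
        by (simp add: scaleR_diff_right[symmetric] dist_norm)
      also have "\<dots> \<le> L * (exp (2 * L * s) * dist f g)"
        using L by (intro mult_left_mono dist_bounded) auto
      finally show "norm (V f s - V g s) \<le> L * (exp (2 * L * s) * dist f g)" .
    qed (use int H in \<open>auto intro: integrable_diff\<close>)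
    also have "\<dots> = exp (2 * L * u) * dist f g / 2 - dist f g / 2"
      using integral_unique[OF H] by simp
    also have "\<dots> \<le> exp (2 * L * u) * dist f g / 2" by simp
    finally have "norm (integral {0..u} (\<lambda>s. V f s - V g s)) \<le> exp (2 * L * u) * dist f g / 2" .
    then have "exp (- 2 * L * u) * norm (integral {0..u} (V f) - integral {0..u} (V g))
        \<le> exp (- 2 * L * u) * (exp (2 * L * u) * dist f g / 2)"
      by (intro mult_left_mono) (auto simp: integral_diff[OF int int])
    also have "\<dots> = 1 / 2 * dist f g" by (simp add: mult.assoc[symmetric] exp_add[symmetric])
    finally show "dist (apply_bcontfun (S f) t) (apply_bcontfun (S g) t) \<le> 1 / 2 * dist f g"
      by (simp add: S P_def u_def[symmetric] dist_norm scaleR_diff_right[symmetric])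
  qed
  then have "\<exists>!g. S g = g"
    by (intro banach_fix_type[where c="1/2"]) auto
  then obtain g where g: "S g = g" by auto
  define \<delta> where "\<delta> t = exp (2 * L * t) *\<^sub>R apply_bcontfun g t" for t
  have V\<delta>: "V g = (\<lambda>s. X s (\<delta> s))" by (simp add: V_def \<delta>_def fun_eq_iff)
  have eq: "\<delta> t = z0 + integral {0..t} (V g)" if "t \<in> {0..1}" for t
  proof -
    have "\<delta> t = exp (2 * L * t) *\<^sub>R P g t"
      using S[of g t] c(2)[OF that] by (simp add: \<delta>_def g)
    then show ?thesis by (simp add: P_def exp_add[symmetric])
  qed
  have "(\<delta> has_vector_derivative X t (\<delta> t)) (at t within {0..1})" if t: "t \<in> {0..1}" for t
  proof (rule has_vector_derivative_transform[OF t])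
    have "((\<lambda>t. z0 + integral {0..t} (V g)) has_vector_derivative V g t) (at t within {0..1})"
      using has_vector_derivative_add[OF has_vector_derivative_const
          integral_has_vector_derivative[OF contV t], of z0 g] by simp
    then show "((\<lambda>t. z0 + integral {0..t} (V g)) has_vector_derivative X t (\<delta> t)) (at t within {0..1})"
      by (simp add: V\<delta>)
  qed (simp add: eq)
  moreover have "\<delta> 0 = z0" using eq[of 0] by simp
  ultimately show ?thesis unfolding solves_ode_on_def by blast
qed

section \<open>Hamiltonian vector fields on phase space\<close>

text \<open>A function on space-time, so that its smoothness in all variables together can be stated.\<close>

definition slice_deriv :: "('a::real_normed_vector \<times> real \<Rightarrow> 'b::real_normed_vector) \<Rightarrow> 'a \<Rightarrow> 'a \<times> real \<Rightarrow> 'b" where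
  "slice_deriv f v p = frechet_derivative (\<lambda>y. f (y, snd p)) (at (fst p)) v"

text \<open>At times in \<open>{0..1}\<close> the slices of \<open>f\<close> are slices of the local extensions of \<open>f\<close>, so the derivative in the
  space variable is the total derivative of an extension in the direction \<open>(v, 0)\<close>. This also covers the end
  points of the time interval.\<close>

lemma slice_smooth:
  fixes f :: "'a::real_normed_vector \<times> real \<Rightarrow> 'b::real_normed_vector"
  assumes f: "smooth_on (UNIV \<times> {0..1}) f"
  shows slice_has_derivative: "t \<in> {0..1} \<Longrightarrow> ((\<lambda>y. f (y, t)) has_derivative (\<lambda>v. slice_deriv f v (z, t))) (at z)"
    and smooth_slice_deriv: "smooth_on (UNIV \<times> {0..1}) (slice_deriv f v)"
proof -
  have *: "\<exists>T g. open T \<and> (z, t) \<in> T \<and> (\<forall>k. Ck_on k T g) \<and>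
      (\<forall>y s. (y, s) \<in> T \<longrightarrow> s \<in> {0..1} \<longrightarrow> ((\<lambda>y. f (y, s)) has_derivative
            (\<lambda>v. frechet_derivative g (at (y, s)) (v, 0))) (at y))"
    if t: "t \<in> {0..1}" for z t
  proof -
    have zt: "(z, t) \<in> UNIV \<times> {0..1}" using t by simp
    obtain T g where T: "open T" "(z, t) \<in> T" "\<And>k. Ck_on k T g"
      "\<And>y. y \<in> UNIV \<times> {0..1} \<Longrightarrow> y \<in> T \<Longrightarrow> g y = f y"
      using smooth_onE[OF f zt] by metis
    have "((\<lambda>y. f (y, s)) has_derivative (\<lambda>v. frechet_derivative g (at (y, s)) (v, 0))) (at y)"
      if ys: "(y, s) \<in> T" "s \<in> {0..1}" for y s
    proof -
      have "((\<lambda>y. (y, s)) has_derivative (\<lambda>v. (v, 0))) (at y)"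
        by (auto intro!: derivative_eq_intros)
      then have D: "((\<lambda>y. g (y, s)) has_derivative (\<lambda>v. frechet_derivative g (at (y, s)) (v, 0))) (at y)"
        by (rule has_derivative_compose) (rule Ck_on_SucD[OF T(3) ys(1)])
      have "open ((\<lambda>y. (y, s)) -` T)"
        by (rule open_vimage[OF T(1)]) (intro continuous_intros)
      then show ?thesis
        by (rule has_derivative_transform_within_open[OF D]) (use T(4) ys in auto)
    qed
    then show ?thesis using T by (intro exI[of _ T] exI[of _ g]) (auto simp del: Ck_on.simps)
  qed
  show D: "((\<lambda>y. f (y, t)) has_derivative (\<lambda>v. slice_deriv f v (z, t))) (at z)" if "t \<in> {0..1}" for z t
    using *[OF that, of z] that by (auto simp: slice_deriv_def differentiable_def
        simp flip: frechet_derivative_works simp del: Ck_on.simps)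
  show "smooth_on (UNIV \<times> {0..1}) (slice_deriv f v)"
  proof (rule smooth_onI)
    fix p :: "'a \<times> real" assume p: "p \<in> UNIV \<times> {0..1}"
    then have "snd p \<in> {0..1}" by auto
    from *[OF this, of "fst p", unfolded prod.collapse]
    obtain T g where T: "open T" "p \<in> T" "\<forall>k. Ck_on k T g"
      "\<forall>y s. (y, s) \<in> T \<longrightarrow> s \<in> {0..1} \<longrightarrow> ((\<lambda>y. f (y, s)) has_derivative
            (\<lambda>v. frechet_derivative g (at (y, s)) (v, 0))) (at y)"
      by (elim exE conjE) (rule that)
    have "Ck_on k T (\<lambda>p. frechet_derivative g (at p) (v, 0))" for k
      using T(3)[THEN spec, of "Suc k"] by simp
    moreover have "frechet_derivative g (at p) (v, 0) = slice_deriv f v p"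
      if "p \<in> (UNIV \<times> {0..1}) \<inter> T" for p
      using frechet_derivative_at[OF T(4)[rule_format, of "fst p" "snd p"]] that
      by (auto simp: slice_deriv_def dest: fun_cong[of _ _ v])
    ultimately show "\<exists>T g. open T \<and> p \<in> T \<and> (\<forall>k. Ck_on k T g) \<and>
        (\<forall>y\<in>(UNIV \<times> {0..1}) \<inter> T. g y = slice_deriv f v y)"
      using T(1,2) by (intro exI[of _ T] exI[of _ "\<lambda>p. frechet_derivative g (at p) (v, 0)"])
        (simp del: Ck_on.simps)
  qed
qed

lemma slice_deriv_zero:
  assumes "open U" "z \<in> U" "\<And>y. y \<in> U \<Longrightarrow> f (y, t) = 0"
  shows "slice_deriv f v (z, t) = 0"
  using frechet_derivative_cong_open(1)[OF assms(1,2), of "\<lambda>y. f (y, t)" "\<lambda>y. 0"] assms(3)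
  by (simp add: slice_deriv_def)

lemma open_norm_gt: "open {z::'a::real_normed_vector. norm z > \<rho>}"
  by (intro open_Collect_less continuous_intros)

text \<open>Outside the support the derivative vanishes, and on the support it is bounded by compactness; the mean
  value inequality on the whole (convex) space turns this into a Lipschitz constant.\<close>

lemma slice_lipschitz:
  fixes h :: "'a::euclidean_space \<times> real \<Rightarrow> real"
  assumes h: "smooth_on (UNIV \<times> {0..1}) h"
    and zero: "\<And>t z. t \<in> {0..1} \<Longrightarrow> norm z > \<rho> \<Longrightarrow> h (z, t) = 0"
  shows "\<exists>L\<ge>0. \<forall>t\<in>{0..1}. \<forall>z w. \<bar>h (z, t) - h (w, t)\<bar> \<le> L * norm (z - w)"
proof -
  have "\<exists>M\<ge>0. \<forall>t\<in>{0..1}. \<forall>z. \<bar>slice_deriv h b (z, t)\<bar> \<le> M" for b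
  proof -
    have "continuous_on (cball 0 \<rho> \<times> {0..1}) (slice_deriv h b)"
      by (rule continuous_on_subset[OF smooth_on_continuous_on[OF smooth_slice_deriv[OF h]]]) auto
    then have "bounded (slice_deriv h b ` (cball 0 \<rho> \<times> {0..1}))"
      by (intro compact_imp_bounded compact_continuous_image compact_Times) auto
    then obtain M where M: "M > 0" "\<And>p. p \<in> cball 0 \<rho> \<times> {0..1} \<Longrightarrow> \<bar>slice_deriv h b p\<bar> \<le> M"
      unfolding bounded_pos by auto
    have "\<bar>slice_deriv h b (z, t)\<bar> \<le> M" if t: "t \<in> {0..1}" for z t
    proof (cases "norm z > \<rho>")
      case True
      then show ?thesis
        using slice_deriv_zero[OF open_norm_gt[of \<rho>], of z h t b] zero t M(1) by auto
    next
      case False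
      then show ?thesis using M(2)[of "(z, t)"] t by simp
    qed
    then show ?thesis using M(1) by (intro exI[of _ M]) auto
  qed
  then obtain M where M: "\<And>b. M b \<ge> 0" "\<And>b t z. t \<in> {0..1} \<Longrightarrow> \<bar>slice_deriv h b (z, t)\<bar> \<le> M b"
    by metis
  define L where "L = (\<Sum>b\<in>Basis. M b)"
  have on: "onorm (\<lambda>v. slice_deriv h v (z, t)) \<le> L" if t: "t \<in> {0..1}" for z t
  proof (rule onorm_bound)
    show "0 \<le> L" using M(1) by (auto simp: L_def intro: sum_nonneg)
    fix v :: 'a
    have lin: "linear (\<lambda>v. slice_deriv h v (z, t))"
      using slice_has_derivative[OF h t] has_derivative_linear by blast
    have "slice_deriv h v (z, t) = (\<Sum>b\<in>Basis. (v \<bullet> b) * slice_deriv h b (z, t))"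
      using linear_sum[OF lin, of "\<lambda>b. (v \<bullet> b) *\<^sub>R b" Basis] linear_cmul[OF lin]
      by (simp add: euclidean_representation)
    then have "norm (slice_deriv h v (z, t)) \<le> (\<Sum>b\<in>Basis. \<bar>v \<bullet> b\<bar> * \<bar>slice_deriv h b (z, t)\<bar>)"
      by (metis (no_types, lifting) abs_mult real_norm_def sum.cong sum_abs)
    also have "\<dots> \<le> (\<Sum>b\<in>Basis. norm v * M b)"
      by (intro sum_mono mult_mono M(2) t) (auto simp: Basis_le_norm)
    finally show "norm (slice_deriv h v (z, t)) \<le> L * norm v"
      by (simp add: L_def sum_distrib_left mult.commute)
  qed
  have "\<bar>h (z, t) - h (w, t)\<bar> \<le> L * norm (z - w)" if t: "t \<in> {0..1}" for z w t
    using differentiable_bound[OF convex_UNIV slice_has_derivative[OF h t] on[OF t], of w z]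
    by (simp add: norm_minus_commute)
  moreover have "L \<ge> 0" using M(1) by (auto simp: L_def intro: sum_nonneg)
  ultimately show ?thesis by blast
qed

text \<open>The vector dual to \<open>- a\<close> with respect to \<open>omega0\<close>. Only the values of \<open>a\<close> on the standard basis enter,
  so smooth dependence on parameters is inherited from these values.\<close>

definition sharp :: "('n::finite phase \<Rightarrow> real) \<Rightarrow> 'n phase" where
  "sharp a = (\<Sum>i\<in>UNIV. a (axis i 1, 0) *\<^sub>R (0, axis i 1) - a (0, axis i 1) *\<^sub>R (axis i 1, 0))"

lemma sharp_component:
  "fst (sharp a) $ i = - a (0, axis i 1)" "snd (sharp a) $ i = a (axis i 1, 0)"
  by (simp_all add: sharp_def fst_sum snd_sum sum_component axis_def if_distrib[of "\<lambda>x. _ * x"]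
      sum_negf cong: if_cong)

lemma sharp_combination:
  "sharp (\<lambda>v. c * a v + d * b v) = c *\<^sub>R sharp a + d *\<^sub>R sharp b"
  by (rule prod_eqI; rule vec_eq_iff[THEN iffD2]) (simp_all add: sharp_component)

lemma sharp_zero: "sharp (\<lambda>v. 0) = 0"
  by (simp add: sharp_def)

lemma phase_decomp:
  "(v :: 'n::finite phase) = (\<Sum>i\<in>UNIV. (fst v $ i) *\<^sub>R (axis i 1, 0) + (snd v $ i) *\<^sub>R (0, axis i 1))"
  by (rule prod_eqI; rule vec_eq_iff[THEN iffD2])
    (simp_all add: fst_sum snd_sum sum_component axis_def if_distrib[of "\<lambda>x. _ * x"] cong: if_cong)

lemma omega0_sharp:
  assumes "linear a"
  shows "omega0 (sharp a) v = - a v"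
proof -
  have "a v = a (\<Sum>i\<in>UNIV. (fst v $ i) *\<^sub>R (axis i 1, 0) + (snd v $ i) *\<^sub>R (0, axis i 1))"
    using phase_decomp[of v] by simp
  also have "\<dots> = (\<Sum>i\<in>UNIV. fst v $ i * a (axis i 1, 0) + snd v $ i * a (0, axis i 1))"
    by (simp only: linear_sum[OF assms] linear_add[OF assms] linear_cmul[OF assms] real_scaleR_def)
  finally show ?thesis
    unfolding omega0_def sharp_component sum_negf[symmetric]
    by (simp only: sum_negf[symmetric]) (auto intro!: sum.cong simp: algebra_simps)
qed

lemma omega0_axis:
  "omega0 v (0, axis i 1) = fst v $ i" "omega0 v (axis i 1, 0) = - (snd v $ i)"
  by (simp_all add: omega0_def axis_def if_distrib[of "\<lambda>x. _ * x"] sum_negf cong: if_cong)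

lemma omega0_nondegenerate:
  assumes "\<And>w. omega0 v w = omega0 v' w"
  shows "v = v'"
  using assms omega0_axis by (metis neg_equal_iff_equal prod_eqI vec_eq_iff)

text \<open>A negative radius is allowed and means that the function vanishes at all times in \<open>{0..1}\<close>.\<close>

definition supported_upto :: "real \<Rightarrow> ('n::finite phase \<times> real \<Rightarrow> real) \<Rightarrow> bool" where
  "supported_upto \<rho> f \<longleftrightarrow> (\<forall>t\<in>{0..1}. \<forall>z. norm z > \<rho> \<longrightarrow> f (z, t) = 0)"

lemma slice_deriv_supported:
  assumes "supported_upto \<rho> f" "t \<in> {0..1}" "norm z > \<rho>"
  shows "slice_deriv f v (z, t) = 0"
  by (rule slice_deriv_zero[OF open_norm_gt[of \<rho>]]) (use assms supported_upto_def in blast)+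

text \<open>The Hamiltonian vector field with respect to the standard form, by \<open>omega0_sharp\<close>.\<close>

definition phase_field :: "('n::finite phase \<times> real \<Rightarrow> real) \<Rightarrow> real \<Rightarrow> 'n phase \<Rightarrow> 'n phase" where
  "phase_field f t z = sharp (\<lambda>v. slice_deriv f v (z, t))"

text \<open>The functions on phase space that a symplectic embedding of the ball of radius \<open>R\<close> turns into Hamiltonian
  functions on the manifold.\<close>

definition phase_ham :: "real \<Rightarrow> ('n::finite phase \<times> real \<Rightarrow> real) \<Rightarrow> bool" where
  "phase_ham R f \<longleftrightarrow> smooth_on (UNIV \<times> {0..1}) f \<and> (\<exists>\<rho><R. supported_upto \<rho> f)"

lemma phase_hamD: "phase_ham R f \<Longrightarrow> smooth_on (UNIV \<times> {0..1}) f"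
  by (simp add: phase_ham_def)

lemma phase_field_zero:
  assumes "supported_upto \<rho> f" "t \<in> {0..1}" "norm z > \<rho>"
  shows "phase_field f t z = 0"
  using slice_deriv_supported[OF assms] by (simp add: phase_field_def sharp_zero)

lemma phase_field_continuous:
  assumes "smooth_on (UNIV \<times> {0..1}) f"
  shows "continuous_on (UNIV \<times> {0..1}) (\<lambda>(z, t). phase_field f t z)"
  unfolding phase_field_def sharp_def case_prod_beta prod.collapse
  by (intro continuous_intros smooth_on_continuous_on smooth_slice_deriv assms)

lemma norm_sharp_le:
  fixes a :: "'n::finite phase \<Rightarrow> real"
  shows "norm (sharp a) \<le> (\<Sum>i\<in>UNIV. \<bar>a (axis i 1, 0)\<bar> + \<bar>a (0, axis i 1)\<bar>)"
  unfolding sharp_def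
proof (rule sum_norm_le)
  fix i :: 'n
  show "norm (a (axis i 1, 0) *\<^sub>R (0, axis i 1) - a (0, axis i 1) *\<^sub>R (axis i 1, 0) :: 'n phase)
      \<le> \<bar>a (axis i 1, 0)\<bar> + \<bar>a (0, axis i 1)\<bar>"
    by (intro order_trans[OF norm_triangle_ineq4]) (simp add: norm_Pair)
qed

lemma phase_field_lipschitz:
  assumes "phase_ham R f"
  obtains L where "L > 0"
    "\<And>t z w. t \<in> {0..1} \<Longrightarrow> norm (phase_field f t z - phase_field f t w) \<le> L * norm (z - w)"
proof -
  from assms obtain \<rho> where f: "smooth_on (UNIV \<times> {0..1}) f" and \<rho>: "supported_upto \<rho> f"
    by (auto simp: phase_ham_def)
  have "slice_deriv f v (z, t) = 0" if "t \<in> {0..1}" "norm z > \<rho>" for v z t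
    by (rule slice_deriv_supported[OF \<rho> that])
  then have "\<exists>L\<ge>0. \<forall>t\<in>{0..1}. \<forall>z w. \<bar>slice_deriv f v (z, t) - slice_deriv f v (w, t)\<bar> \<le> L * norm (z - w)" for v
    by (rule slice_lipschitz[OF smooth_slice_deriv[OF f]])
  then obtain L where L: "\<And>v. L v \<ge> 0"
    "\<And>v t z w. t \<in> {0..1} \<Longrightarrow> \<bar>slice_deriv f v (z, t) - slice_deriv f v (w, t)\<bar> \<le> L v * norm (z - w)"
    by metis
  define K where "K = (\<Sum>i\<in>UNIV. L (axis i 1, 0) + L (0, axis i 1))"
  have "norm (phase_field f t z - phase_field f t w) \<le> (K + 1) * norm (z - w)" if t: "t \<in> {0..1}" for t z w
  proof -
    have "phase_field f t z - phase_field f t w = sharp (\<lambda>v. slice_deriv f v (z, t) - slice_deriv f v (w, t))"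
      using sharp_combination[of 1 "\<lambda>v. slice_deriv f v (z, t)" "-1" "\<lambda>v. slice_deriv f v (w, t)"]
      by (simp add: phase_field_def)
    then have "norm (phase_field f t z - phase_field f t w)
        \<le> (\<Sum>i\<in>UNIV. L (axis i 1, 0) * norm (z - w) + L (0, axis i 1) * norm (z - w))"
      by (auto intro!: order_trans[OF norm_sharp_le] sum_mono add_mono L(2)[OF t])
    also have "\<dots> = K * norm (z - w)"
      by (simp add: K_def sum_distrib_right distrib_right)
    finally show ?thesis by (simp add: distrib_right add_increasing2)
  qed
  moreover have "K + 1 > 0"
    using L(1) by (auto simp: K_def intro!: add_nonneg_pos sum_nonneg)
  ultimately show ?thesis by (rule that[rotated])
qed

section \<open>Time-one maps on phase space\<close>

abbreviation phase_solution :: "('n::finite phase \<times> real \<Rightarrow> real) \<Rightarrow> (real \<Rightarrow> 'n phase) \<Rightarrow> bool" where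
  "phase_solution f \<equiv> solves_ode_on (phase_field f) {0..1}"

lemma phase_solution_exists:
  assumes "phase_ham R f"
  obtains \<delta> where "phase_solution f \<delta>" "\<delta> 0 = z"
proof -
  obtain L where L: "L > 0"
    "\<And>t z w. t \<in> {0..1} \<Longrightarrow> norm (phase_field f t z - phase_field f t w) \<le> L * norm (z - w)"
    using phase_field_lipschitz[OF assms] by metis
  have "continuous_on ({0..1} \<times> UNIV) (\<lambda>p. case (snd p, fst p) of (z, t) \<Rightarrow> phase_field f t z)"
    by (rule continuous_on_compose2[OF phase_field_continuous[OF phase_hamD[OF assms]]])
       (auto intro!: continuous_intros)
  then have "continuous_on ({0..1} \<times> UNIV) (\<lambda>(t, z). phase_field f t z)"
    by (simp add: case_prod_beta)
  from ode_exists[OF this L(2,1)] show thesis using that by blast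
qed

lemma phase_solution_unique:
  assumes "phase_ham R f" "phase_solution f \<gamma>" "phase_solution f \<delta>"
    "s \<in> {0..1}" "\<gamma> s = \<delta> s" "t \<in> {0..1}"
  shows "\<gamma> t = \<delta> t"
proof -
  obtain L where L: "L > 0"
    "\<And>t z w. t \<in> {0..1} \<Longrightarrow> norm (phase_field f t z - phase_field f t w) \<le> L * norm (z - w)"
    using phase_field_lipschitz[OF assms(1)] by metis
  show ?thesis by (rule ode_unique[OF assms(2,3) L(2) assms(4-6)])
qed

definition phase_flow :: "('n::finite phase \<times> real \<Rightarrow> real) \<Rightarrow> 'n phase \<Rightarrow> 'n phase" where
  "phase_flow f z = (THE y. \<exists>\<delta>. phase_solution f \<delta> \<and> \<delta> 0 = z \<and> \<delta> 1 = y)"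

lemma phase_flow_eqI:
  assumes "phase_ham R f" "phase_solution f \<delta>" "\<delta> 0 = z"
  shows "phase_flow f z = \<delta> 1"
  unfolding phase_flow_def
proof (rule the_equality)
  show "\<exists>\<delta>'. phase_solution f \<delta>' \<and> \<delta>' 0 = z \<and> \<delta>' 1 = \<delta> 1" using assms by blast
  show "y = \<delta> 1" if "\<exists>\<delta>. phase_solution f \<delta> \<and> \<delta> 0 = z \<and> \<delta> 1 = y" for y
  proof -
    from that obtain \<gamma> where "phase_solution f \<gamma>" "\<gamma> 0 = z" "\<gamma> 1 = y" by blast
    then show ?thesis using phase_solution_unique[OF assms(1) _ assms(2), of \<gamma> 0 1] assms(3) by simp
  qed
qed

lemma phase_solution_stationary:
  assumes "supported_upto \<rho> f" "norm z > \<rho>"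
  shows "phase_solution f (\<lambda>_. z)"
  using phase_field_zero[OF assms(1) _ assms(2)] by (auto simp: solves_ode_on_def)

lemma phase_flow_outside:
  assumes "phase_ham R f" "supported_upto \<rho> f" "norm z > \<rho>"
  shows "phase_flow f z = z"
  using phase_flow_eqI[OF assms(1) phase_solution_stationary[OF assms(2,3)]] by simp

text \<open>Points near the boundary are stationary, and a solution that is at a stationary point at some time has
  always been there.\<close>

lemma phase_solution_in_ball:
  assumes f: "phase_ham R f" and \<delta>: "phase_solution f \<delta>" and "norm (\<delta> 0) < R" and t: "t \<in> {0..1}"
  shows "norm (\<delta> t) < R"
proof (rule ccontr)
  assume *: "\<not> norm (\<delta> t) < R"
  obtain \<rho> where \<rho>: "\<rho> < R" "supported_upto \<rho> f" using f by (auto simp: phase_ham_def)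
  have "\<delta> 0 = \<delta> t"
    using phase_solution_unique[OF f \<delta> phase_solution_stationary[OF \<rho>(2), of "\<delta> t"] t] \<rho> * by simp
  then show False using * assms(3) by simp
qed

lemma phase_flow_in_ball:
  assumes "phase_ham R f" "norm z < R"
  shows "norm (phase_flow f z) < R"
proof -
  obtain \<delta> where "phase_solution f \<delta>" "\<delta> 0 = z" using phase_solution_exists[OF assms(1)] .
  then show ?thesis using phase_flow_eqI[OF assms(1)] phase_solution_in_ball[OF assms(1)] assms(2) by simp
qed

definition reversed :: "('a \<times> real \<Rightarrow> real) \<Rightarrow> 'a \<times> real \<Rightarrow> real" where
  "reversed f p = - f (fst p, 1 - snd p)"

lemma reversed_reversed [simp]: "reversed (reversed f) = f"
  by (simp add: reversed_def fun_eq_iff)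

lemma phase_ham_reversed:
  assumes "phase_ham R f"
  shows "phase_ham R (reversed f)"
proof -
  have "smooth_on (UNIV \<times> {0..1}) (\<lambda>p. f (fst p, 1 - snd p))"
    by (rule smooth_on_compose[OF _ phase_hamD[OF assms]]) (auto intro!: smooth_intros)
  then show ?thesis
    using assms unfolding phase_ham_def reversed_def[abs_def] supported_upto_def
    by (auto intro!: smooth_on_minus)
qed

lemma phase_solution_reversed:
  assumes "phase_ham R f" "phase_solution f \<delta>"
  shows "phase_solution (reversed f) (\<lambda>t. \<delta> (1 - t))"
  unfolding solves_ode_on_def
proof
  fix t :: real assume t: "t \<in> {0..1}"
  then have t': "1 - t \<in> {0..1}" by auto
  have im: "(\<lambda>t. 1 - t) ` {0..1::real} = {0..1}" by auto
  have "(\<lambda>v. slice_deriv (reversed f) v (z, t)) = (\<lambda>v. - slice_deriv f v (z, 1 - t))" for z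
    using frechet_derivative_at[OF has_derivative_minus[OF slice_has_derivative[OF phase_hamD[OF assms(1)] t', of z]]]
    by (simp add: slice_deriv_def reversed_def)
  then have field: "phase_field (reversed f) t z = - phase_field f (1 - t) z" for z
    using sharp_combination[of "-1" "\<lambda>v. slice_deriv f v (z, 1 - t)" 0 "\<lambda>v. 0"] by (simp add: phase_field_def)
  have "(\<delta> has_vector_derivative phase_field f (1 - t) (\<delta> (1 - t))) (at (1 - t) within (\<lambda>t. 1 - t) ` {0..1})"
    using assms(2) t' unfolding solves_ode_on_def im by blast
  then have "((\<delta> \<circ> (\<lambda>t. 1 - t)) has_vector_derivative (-1) *\<^sub>R phase_field f (1 - t) (\<delta> (1 - t))) (at t within {0..1})"
    by (intro vector_diff_chain_within) (auto intro!: derivative_eq_intros)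
  then show "((\<lambda>t. \<delta> (1 - t)) has_vector_derivative phase_field (reversed f) t (\<delta> (1 - t))) (at t within {0..1})"
    by (simp add: field o_def)
qed

lemma phase_flow_reversed:
  assumes "phase_ham R f"
  shows "phase_flow (reversed f) (phase_flow f z) = z" "phase_flow f (phase_flow (reversed f) z) = z"
proof -
  have *: "phase_flow (reversed f) (phase_flow f z) = z" if f: "phase_ham R f" for f z
  proof -
    obtain \<delta> where \<delta>: "phase_solution f \<delta>" "\<delta> 0 = z" using phase_solution_exists[OF f] .
    then show ?thesis
      using phase_flow_eqI[OF f \<delta>] phase_flow_eqI[OF phase_ham_reversed[OF f] phase_solution_reversed[OF f \<delta>(1)]]
      by simp
  qed
  show "phase_flow (reversed f) (phase_flow f z) = z" by (rule *[OF assms])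
  show "phase_flow f (phase_flow (reversed f) z) = z"
    using *[OF phase_ham_reversed[OF assms]] by simp
qed

text \<open>The Hamiltonian of the path that follows the flow of \<open>f\<close> during the first half of the time interval and that
  of \<open>g\<close> during the second half. The factors \<open>deriv smooth_step\<close> make it smooth at time \<open>1 / 2\<close> and allow one formula
  for both halves.\<close>

definition concat_ham :: "('a \<times> real \<Rightarrow> real) \<Rightarrow> ('a \<times> real \<Rightarrow> real) \<Rightarrow> 'a \<times> real \<Rightarrow> real" where
  "concat_ham f g p =
     2 * deriv smooth_step (2 * snd p) * f (fst p, smooth_step (2 * snd p)) +
     2 * deriv smooth_step (2 * snd p - 1) * g (fst p, smooth_step (2 * snd p - 1))"

lemma smooth_concat_term:
  fixes f :: "'a::euclidean_space \<times> real \<Rightarrow> real"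
  assumes "smooth_on (UNIV \<times> {0..1}) f"
  shows "smooth_on S (\<lambda>p. 2 * deriv smooth_step (2 * snd p - c) * f (fst p, smooth_step (2 * snd p - c)))"
proof -
  have time: "smooth_on S (\<lambda>p::'a \<times> real. 2 * snd p - c)" by (intro smooth_intros)
  have "smooth_on S (\<lambda>p. f (fst p, smooth_step (2 * snd p - c)))"
    by (rule smooth_on_compose[OF _ assms])
       (auto simp: smooth_step_bounds intro!: smooth_intros smooth_on_compose[OF time smooth_smooth_step[of UNIV]])
  then show ?thesis
    by (intro smooth_intros smooth_on_compose[OF time smooth_deriv_smooth_step[of UNIV]]) auto
qed

lemma phase_ham_concat:
  assumes f: "phase_ham R f" and g: "phase_ham R g"
  shows "phase_ham R (concat_ham f g)"
proof -
  obtain \<rho> \<sigma> where "\<rho> < R" "supported_upto \<rho> f" "\<sigma> < R" "supported_upto \<sigma> g"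
    using f g by (auto simp: phase_ham_def)
  then have "max \<rho> \<sigma> < R" "supported_upto (max \<rho> \<sigma>) (concat_ham f g)"
    by (simp_all add: supported_upto_def concat_ham_def smooth_step_bounds)
  moreover have "smooth_on (UNIV \<times> {0..1}) (concat_ham f g)"
    unfolding concat_ham_def[abs_def]
    using smooth_on_add[OF smooth_concat_term[OF phase_hamD[OF f], of _ 0] smooth_concat_term[OF phase_hamD[OF g], of _ 1]]
    by simp
  ultimately show ?thesis unfolding phase_ham_def by blast
qed

lemma phase_field_concat:
  assumes f: "phase_ham R f" and g: "phase_ham R g"
  shows "phase_field (concat_ham f g) t z =
     (2 * deriv smooth_step (2 * t)) *\<^sub>R phase_field f (smooth_step (2 * t)) z +
     (2 * deriv smooth_step (2 * t - 1)) *\<^sub>R phase_field g (smooth_step (2 * t - 1)) z"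
proof -
  let ?a = "2 * deriv smooth_step (2 * t)" and ?b = "2 * deriv smooth_step (2 * t - 1)"
  let ?s = "smooth_step (2 * t)" and ?u = "smooth_step (2 * t - 1)"
  have s: "?s \<in> {0..1}" "?u \<in> {0..1}" by (auto simp: smooth_step_bounds)
  have "((\<lambda>y. concat_ham f g (y, t)) has_derivative
      (\<lambda>v. ?a * slice_deriv f v (z, ?s) + ?b * slice_deriv g v (z, ?u))) (at z)"
    unfolding concat_ham_def fst_conv snd_conv
    by (intro has_derivative_add has_derivative_mult_right
        slice_has_derivative[OF phase_hamD[OF f] s(1)] slice_has_derivative[OF phase_hamD[OF g] s(2)])
  from frechet_derivative_at[OF this]
  have "(\<lambda>v. slice_deriv (concat_ham f g) v (z, t)) =
      (\<lambda>v. ?a * slice_deriv f v (z, ?s) + ?b * slice_deriv g v (z, ?u))"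
    by (simp add: slice_deriv_def)
  then show ?thesis by (simp add: phase_field_def sharp_combination)
qed

lemma solution_reparam:
  fixes \<delta> :: "real \<Rightarrow> 'a::real_normed_vector"
  assumes "solves_ode_on X {0..1} \<delta>"
  shows "((\<lambda>t. \<delta> (smooth_step (2 * t - c))) has_vector_derivative
     (2 * deriv smooth_step (2 * t - c)) *\<^sub>R X (smooth_step (2 * t - c)) (\<delta> (smooth_step (2 * t - c)))) (at t within S)"
proof -
  let ?h = "\<lambda>t. smooth_step (2 * t - c)"
  have h: "?h t \<in> {0..1}" for t by (auto simp: smooth_step_bounds)
  have "((\<lambda>t. smooth_step (2 * t - c)) has_field_derivative deriv smooth_step (2 * t - c) * 2) (at t within S)"
    by (rule DERIV_chain2[OF smooth_step_deriv]) (auto intro!: derivative_eq_intros)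
  then have "(?h has_vector_derivative 2 * deriv smooth_step (2 * t - c)) (at t within S)"
    by (simp add: has_real_derivative_iff_has_vector_derivative mult.commute)
  moreover have "(\<delta> has_vector_derivative X (?h t) (\<delta> (?h t))) (at (?h t) within ?h ` S)"
    by (rule has_vector_derivative_within_subset[where S="{0..1}"])
       (use assms h in \<open>auto simp: solves_ode_on_def simp del: atLeastAtMost_iff\<close>)
  ultimately show ?thesis
    using vector_diff_chain_within[of ?h _ t S \<delta>] by (simp add: o_def)
qed

text \<open>Since \<open>smooth_step\<close> is constant outside the unit interval, the sum of the two reparametrised
  solutions runs along the first one and then along the second one.\<close>

lemma phase_flow_concat:
  assumes f: "phase_ham R f" and g: "phase_ham R g"
  shows "phase_flow (concat_ham f g) z = phase_flow g (phase_flow f z)"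
proof -
  obtain \<gamma> where \<gamma>: "phase_solution f \<gamma>" "\<gamma> 0 = z" using phase_solution_exists[OF f] .
  obtain \<delta> where \<delta>: "phase_solution g \<delta>" "\<delta> 0 = \<gamma> 1" using phase_solution_exists[OF g] .
  define \<epsilon> where "\<epsilon> t = \<gamma> (smooth_step (2 * t)) + \<delta> (smooth_step (2 * t - 1)) - \<gamma> 1" for t
  have "phase_solution (concat_ham f g) \<epsilon>"
    unfolding solves_ode_on_def
  proof
    fix t :: real assume "t \<in> {0..1}"
    have D: "(\<epsilon> has_vector_derivative
        (2 * deriv smooth_step (2 * t)) *\<^sub>R phase_field f (smooth_step (2 * t)) (\<gamma> (smooth_step (2 * t))) +
        (2 * deriv smooth_step (2 * t - 1)) *\<^sub>R phase_field g (smooth_step (2 * t - 1)) (\<delta> (smooth_step (2 * t - 1))))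
        (at t within {0..1})"
      unfolding \<epsilon>_def
      using has_vector_derivative_diff[OF has_vector_derivative_add[OF
            solution_reparam[OF \<gamma>(1), of 0] solution_reparam[OF \<delta>(1), of 1]] has_vector_derivative_const[of "\<gamma> 1"]]
      by simp
    have "t \<le> 1 / 2 \<or> t \<ge> 1 / 2" by linarith
    then have "phase_field (concat_ham f g) t (\<epsilon> t) =
        (2 * deriv smooth_step (2 * t)) *\<^sub>R phase_field f (smooth_step (2 * t)) (\<gamma> (smooth_step (2 * t))) +
        (2 * deriv smooth_step (2 * t - 1)) *\<^sub>R phase_field g (smooth_step (2 * t - 1)) (\<delta> (smooth_step (2 * t - 1)))"
    proof
      assume "t \<le> 1 / 2"
      then show ?thesis by (simp add: phase_field_concat[OF f g] \<epsilon>_def deriv_smooth_step_0 smooth_step_0 \<delta>(2))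
    next
      assume "t \<ge> 1 / 2"
      then show ?thesis by (simp add: phase_field_concat[OF f g] \<epsilon>_def deriv_smooth_step_0 smooth_step_1)
    qed
    then show "(\<epsilon> has_vector_derivative phase_field (concat_ham f g) t (\<epsilon> t)) (at t within {0..1})"
      using D by simp
  qed
  moreover have "\<epsilon> 0 = z" "\<epsilon> 1 = \<delta> 1"
    by (simp_all add: \<epsilon>_def smooth_step_0 smooth_step_1 \<gamma> \<delta>)
  ultimately show ?thesis
    using phase_flow_eqI[OF phase_ham_concat[OF f g], of \<epsilon> z] phase_flow_eqI[OF f \<gamma>] phase_flow_eqI[OF g \<delta>]
    by simp
qed

section \<open>Cut-off translations\<close>

text \<open>The linear function generating the translation by \<open>(axis i c, 0)\<close>, cut off to the set where \<open>q\<close> is positive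
  and unchanged where \<open>q\<close> is at least one.\<close>

definition push_ham :: "('n::finite phase \<Rightarrow> real) \<Rightarrow> real \<Rightarrow> 'n \<Rightarrow> 'n phase \<times> real \<Rightarrow> real" where
  "push_ham q c i p = smooth_step (q (fst p)) * (- c * (snd (fst p) $ i))"

lemma smooth_push_ham:
  assumes "smooth_on UNIV q"
  shows "smooth_on S (push_ham q c i)"
proof -
  have "smooth_on S (\<lambda>p::'a phase \<times> real. q (fst p))"
    by (rule smooth_on_compose[OF _ assms]) (auto intro!: smooth_intros)
  then have "smooth_on S (\<lambda>p::'a phase \<times> real. smooth_step (q (fst p)))"
    by (rule smooth_on_compose[OF _ smooth_smooth_step[of UNIV]]) auto
  moreover have "smooth_on S (\<lambda>p::'a phase \<times> real. snd (fst p) $ i)"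
    by (rule smooth_on_bounded_linear_comp[OF bounded_linear_vec_nth]) (intro smooth_intros)
  ultimately show ?thesis
    unfolding push_ham_def[abs_def] by (intro smooth_intros)
qed

lemma phase_ham_push:
  assumes "smooth_on UNIV q" "\<And>z. norm z > \<rho> \<Longrightarrow> q z \<le> 0" "\<rho> < R"
  shows "supported_upto \<rho> (push_ham q c i)" "phase_ham R (push_ham q c i)"
proof -
  show "supported_upto \<rho> (push_ham q c i)"
    using assms(2) by (simp add: supported_upto_def push_ham_def smooth_step_0)
  then show "phase_ham R (push_ham q c i)"
    using assms smooth_push_ham by (auto simp: phase_ham_def)
qed

lemma sharp_coordinate: "sharp (\<lambda>v. - c * (snd v $ i)) = (axis i c, 0)"
  by (rule prod_eqI; rule vec_eq_iff[THEN iffD2]) (simp_all add: sharp_component axis_def)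

lemma phase_solution_push:
  assumes q: "smooth_on UNIV q" and one: "\<And>\<tau>. \<tau> \<in> {0..1} \<Longrightarrow> q (z + \<tau> *\<^sub>R (axis i c, 0)) > 1"
  shows "phase_solution (push_ham q c i) (\<lambda>\<tau>. z + \<tau> *\<^sub>R (axis i c, 0))"
  unfolding solves_ode_on_def
proof
  fix \<tau> :: real assume \<tau>: "\<tau> \<in> {0..1}"
  let ?u = "(axis i c, 0) :: 'a phase" and ?l = "\<lambda>y::'a phase. - c * (snd y $ i)"
  have "open {y. q y > 1}"
    by (intro open_Collect_less continuous_intros smooth_on_continuous_on[OF q])
  moreover have "?l y = push_ham q c i (y, \<tau>)" if "y \<in> {y. q y > 1}" for y
    using that by (simp add: push_ham_def smooth_step_1)
  moreover have "(?l has_derivative ?l) (at (z + \<tau> *\<^sub>R ?u))"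
    by (intro bounded_linear_imp_has_derivative bounded_linear_const_mult
        bounded_linear_compose[OF bounded_linear_vec_nth bounded_linear_snd])
  ultimately have "((\<lambda>y. push_ham q c i (y, \<tau>)) has_derivative ?l) (at (z + \<tau> *\<^sub>R ?u))"
    using has_derivative_transform_within_open[of ?l ?l _ UNIV "{y. q y > 1}" "\<lambda>y. push_ham q c i (y, \<tau>)"] one[OF \<tau>]
    by simp
  then have "phase_field (push_ham q c i) \<tau> (z + \<tau> *\<^sub>R ?u) = ?u"
    using frechet_derivative_at[of _ ?l] sharp_coordinate[of c i] by (simp add: phase_field_def slice_deriv_def)
  moreover have "((\<lambda>\<tau>. z + \<tau> *\<^sub>R ?u) has_vector_derivative ?u) (at \<tau> within {0..1})"
    by (auto intro!: derivative_eq_intros)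
  ultimately show "((\<lambda>\<tau>. z + \<tau> *\<^sub>R ?u) has_vector_derivative
      phase_field (push_ham q c i) \<tau> (z + \<tau> *\<^sub>R ?u)) (at \<tau> within {0..1})" by simp
qed

lemma phase_flow_push:
  assumes "phase_ham R (push_ham q c i)" "smooth_on UNIV q"
    "\<And>\<tau>. \<tau> \<in> {0..1} \<Longrightarrow> q (z + \<tau> *\<^sub>R (axis i c, 0)) > 1"
  shows "phase_flow (push_ham q c i) z = z + (axis i c, 0)"
  using phase_flow_eqI[OF assms(1) phase_solution_push[OF assms(2,3)], of z] by (simp add: zero_prod_def)

section \<open>The embedded ball\<close>

locale symplectic_ball =
  fixes A :: "('m::{t2_space, second_countable_topology}, 'n::finite) chart set"
    and \<omega> :: "('m, 'n) two_form" and R :: real and \<iota> :: "'n phase \<Rightarrow> 'm"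
  assumes manifold: "symplectic_manifold A \<omega>"
    and embedding: "symplectic_embedding A \<omega> (ball 0 R) \<iota>"
begin

abbreviation \<kappa> :: "'m \<Rightarrow> 'n phase" where "\<kappa> \<equiv> inv_into (ball 0 R) \<iota>"

definition coord :: "('m, 'n) chart \<Rightarrow> 'n phase \<Rightarrow> 'n phase" where "coord c = snd c \<circ> \<iota>"

text \<open>The part of the ball on which \<open>coord c\<close> is meaningful.\<close>

definition coord_dom :: "('m, 'n) chart \<Rightarrow> 'n phase set" where
  "coord_dom c = {z \<in> ball 0 R. \<iota> z \<in> fst c}"

definition coord_deriv :: "('m, 'n) chart \<Rightarrow> 'n phase \<Rightarrow> 'n phase \<Rightarrow> 'n phase" where
  "coord_deriv c z = frechet_derivative (coord c) (at z)"

lemma hom: "homeomorphism (ball 0 R) (\<iota> ` ball 0 R) \<iota> \<kappa>"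
  using embedding by (simp add: symplectic_embedding_def)

lemma inj_\<iota>: "inj_on \<iota> (ball 0 R)"
  using hom by (metis homeomorphism_def inj_on_inverseI)

lemma \<kappa>_\<iota> [simp]: "norm z < R \<Longrightarrow> \<kappa> (\<iota> z) = z"
  using inj_\<iota> by (simp add: inv_into_f_f)

lemma \<iota>_\<kappa> [simp]: "p \<in> \<iota> ` ball 0 R \<Longrightarrow> \<iota> (\<kappa> p) = p"
  by (rule f_inv_into_f)

lemma \<kappa>_in: "p \<in> \<iota> ` ball 0 R \<Longrightarrow> norm (\<kappa> p) < R"
  using inv_into_into[of p \<iota> "ball 0 R"] by simp

lemma cont_\<iota>: "continuous_on (ball 0 R) \<iota>" and cont_\<kappa>: "continuous_on (\<iota> ` ball 0 R) \<kappa>"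
  using hom by (auto simp: homeomorphism_def)

lemma chart_cover: obtains c where "c \<in> A" "p \<in> fst c"
proof -
  have "p \<in> (\<Union>c\<in>A. fst c)"
    using manifold by (simp add: symplectic_manifold_def smooth_atlas_def)
  then show thesis using that by blast
qed

context
  fixes c assumes c: "c \<in> A"
begin

lemma chart: "open (fst c)" "open (chart_image c)" "homeomorphism (fst c) (chart_image c) (snd c) (chart_inv c)"
  using manifold c by (auto simp: symplectic_manifold_def smooth_atlas_def)

lemma chart_inv_chart [simp]: "p \<in> fst c \<Longrightarrow> chart_inv c (snd c p) = p"
  using chart(3) by (simp add: homeomorphism_def)

lemma chart_chart_inv [simp]: "y \<in> chart_image c \<Longrightarrow> snd c (chart_inv c y) = y"
  using chart(3) by (simp add: homeomorphism_def)

lemma chart_inv_in: "y \<in> chart_image c \<Longrightarrow> chart_inv c y \<in> fst c"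
  using chart(3) by (auto simp: homeomorphism_def)

lemma chart_in: "p \<in> fst c \<Longrightarrow> snd c p \<in> chart_image c"
  by (simp add: chart_image_def)

lemma cont_chart: "continuous_on (fst c) (snd c)" and cont_chart_inv: "continuous_on (chart_image c) (chart_inv c)"
  using chart(3) by (auto simp: homeomorphism_def)

lemma open_coord_dom: "open (coord_dom c)"
proof -
  have "coord_dom c = ball 0 R \<inter> \<iota> -` fst c" by (auto simp: coord_dom_def)
  then show ?thesis using continuous_open_preimage[OF cont_\<iota> open_ball chart(1)] by simp
qed

lemma coord_domD: "z \<in> coord_dom c \<Longrightarrow> norm z < R" "z \<in> coord_dom c \<Longrightarrow> \<iota> z \<in> fst c"
  by (auto simp: coord_dom_def)

lemma Ck_coord: "Ck_on k (coord_dom c) (coord c)"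
proof -
  have "smooth_on (coord_dom c) (coord c)"
    using embedding c by (simp add: symplectic_embedding_def coord_dom_def coord_def)
  then show ?thesis using smooth_on_open_iff[OF open_coord_dom] by blast
qed

lemma coord_has_derivative: "z \<in> coord_dom c \<Longrightarrow> (coord c has_derivative coord_deriv c z) (at z)"
  unfolding coord_deriv_def by (rule Ck_on_SucD[OF Ck_coord[of "Suc 0"]])

lemma coord_image_chart: "coord c ` coord_dom c \<subseteq> chart_image c"
  by (auto simp: coord_dom_def coord_def chart_in)

lemma \<omega>_coord_deriv:
  "z \<in> coord_dom c \<Longrightarrow> \<omega> c (coord c z) (coord_deriv c z v) (coord_deriv c z w) = omega0 v w"
  using embedding c
  by (simp add: symplectic_embedding_def coord_dom_def coord_def coord_deriv_def del: split_paired_All)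

lemma \<omega>_bilinear: "y \<in> chart_image c \<Longrightarrow> bilinear (\<omega> c y)"
  using manifold c by (auto simp: symplectic_manifold_def differential_two_form_def)

lemma \<omega>_nondegenerate:
  assumes y: "y \<in> chart_image c" and eq: "\<And>w. \<omega> c y v w = \<omega> c y v' w"
  shows "v = v'"
proof -
  have "\<omega> c y (v - v') w = 0" for w
    using eq by (simp add: bilinear_lsub[OF \<omega>_bilinear[OF y]])
  then have "v - v' = 0"
    using manifold c y unfolding symplectic_manifold_def by blast
  then show ?thesis by simp
qed

lemma inj_coord: "inj_on (coord c) (coord_dom c)"
proof (rule inj_onI)
  fix z w assume *: "z \<in> coord_dom c" "w \<in> coord_dom c" "coord c z = coord c w"
  then have "\<iota> z = \<iota> w"
    by (metis chart_inv_chart comp_apply coord_def coord_domD(2))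
  then show "z = w" using * by (metis coord_domD(1) \<kappa>_\<iota>)
qed

lemma continuous_coord: "continuous_on (coord_dom c) (coord c)"
  using Ck_coord[of 0] by simp

text \<open>Openness of the embedding comes from invariance of domain in a chart.\<close>

lemma open_coord_image:
  assumes "open U" "U \<subseteq> coord_dom c"
  shows "open (coord c ` U)"
  using assms inj_coord continuous_coord
  by (meson continuous_on_subset inj_on_subset invariance_of_domain)

definition coord_inv :: "'n phase \<Rightarrow> 'n phase" where "coord_inv y = \<kappa> (chart_inv c y)"

lemma coord_inv_coord: "z \<in> coord_dom c \<Longrightarrow> coord_inv (coord c z) = z"
  by (simp add: coord_inv_def coord_def coord_domD)

lemma coord_inv_in: "y \<in> coord c ` coord_dom c \<Longrightarrow> coord_inv y \<in> coord_dom c"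
  and coord_coord_inv: "y \<in> coord c ` coord_dom c \<Longrightarrow> coord c (coord_inv y) = y"
  using coord_inv_coord by auto

text \<open>The inverse of the derivative of \<open>coord\<close>: because \<open>coord\<close> is symplectic, it can be written
  with the two-form instead of with a matrix inverse.\<close>

definition coord_inv_deriv :: "'n phase \<Rightarrow> 'n phase \<Rightarrow> 'n phase" where
  "coord_inv_deriv y w = sharp (\<lambda>v. - \<omega> c y w (coord_deriv c (coord_inv y) v))"

lemma coord_inv_deriv_left:
  assumes z: "z \<in> coord_dom c"
  shows "coord_inv_deriv (coord c z) (coord_deriv c z v) = v"
proof (rule omega0_nondegenerate)
  fix w
  have "linear (\<lambda>w. - omega0 v w)"
    by (rule linearI) (simp_all add: omega0_def sum_distrib_left sum_negf[symmetric] sum.distrib[symmetric] algebra_simps)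
  then show "omega0 (coord_inv_deriv (coord c z) (coord_deriv c z v)) w = omega0 v w"
    using omega0_sharp[of "\<lambda>w. - omega0 v w" w]
    by (simp add: coord_inv_deriv_def coord_inv_coord[OF z] \<omega>_coord_deriv[OF z])
qed

lemma linear_coord_inv_deriv:
  assumes "y \<in> chart_image c"
  shows "linear (coord_inv_deriv y)"
proof -
  note b = bilinear_ladd[OF \<omega>_bilinear[OF assms]] bilinear_lmul[OF \<omega>_bilinear[OF assms]]
  show ?thesis
  proof (rule linearI)
    fix v w
    show "coord_inv_deriv y (v + w) = coord_inv_deriv y v + coord_inv_deriv y w"
      using sharp_combination[of 1 "\<lambda>u. - \<omega> c y v (coord_deriv c (coord_inv y) u)" 1
          "\<lambda>u. - \<omega> c y w (coord_deriv c (coord_inv y) u)"]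
      by (simp add: coord_inv_deriv_def b)
    show "coord_inv_deriv y (k *\<^sub>R v) = k *\<^sub>R coord_inv_deriv y v" for k
      using sharp_combination[of k "\<lambda>u. - \<omega> c y v (coord_deriv c (coord_inv y) u)" 0 "\<lambda>_. 0"]
      by (simp add: coord_inv_deriv_def b)
  qed
qed

lemma coord_inv_deriv_right:
  assumes z: "z \<in> coord_dom c"
  shows "coord_deriv c z (coord_inv_deriv (coord c z) w) = w"
proof -
  have "linear (coord_deriv c z)" "linear (coord_inv_deriv (coord c z))"
    using has_derivative_linear[OF coord_has_derivative[OF z]]
      linear_coord_inv_deriv[of "coord c z"] coord_image_chart z by blast+
  moreover have "coord_inv_deriv (coord c z) \<circ> coord_deriv c z = id"
    using coord_inv_deriv_left[OF z] by auto
  ultimately have "coord_deriv c z \<circ> coord_inv_deriv (coord c z) = id"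
    using linear_inverse_left by blast
  from fun_cong[OF this, of w] show ?thesis by simp
qed

lemma continuous_coord_inv: "continuous_on (coord c ` coord_dom c) coord_inv"
  unfolding coord_inv_def
proof (rule continuous_on_compose2[OF cont_\<kappa>])
  show "continuous_on (coord c ` coord_dom c) (chart_inv c)"
    using cont_chart_inv continuous_on_subset coord_image_chart by blast
  show "chart_inv c ` coord c ` coord_dom c \<subseteq> \<iota> ` ball 0 R"
    by (auto simp: coord_def coord_dom_def)
qed

lemma coord_inv_has_derivative:
  assumes y: "y \<in> coord c ` coord_dom c"
  shows "(coord_inv has_derivative coord_inv_deriv y) (at y)"
proof (rule has_derivative_inverse_basic[where f="coord c" and f'="coord_deriv c (coord_inv y)" and T="coord c ` coord_dom c"])
  have z: "coord_inv y \<in> coord_dom c" and yz: "coord c (coord_inv y) = y"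
    using coord_inv_in[OF y] coord_coord_inv[OF y] .
  show "(coord c has_derivative coord_deriv c (coord_inv y)) (at (coord_inv y))"
    by (rule coord_has_derivative[OF z])
  show "bounded_linear (coord_inv_deriv y)"
    using linear_coord_inv_deriv y coord_image_chart linear_conv_bounded_linear by blast
  show "coord_inv_deriv y \<circ> coord_deriv c (coord_inv y) = id"
    using coord_inv_deriv_left[OF z] by (auto simp: yz)
  show "open (coord c ` coord_dom c)"
    by (rule open_coord_image[OF open_coord_dom order_refl])
  then show "continuous (at y) coord_inv"
    using continuous_coord_inv y by (metis continuous_on_eq_continuous_at)
qed (use y coord_coord_inv in auto)

lemma Ck_coord_inv: "Ck_on k (coord c ` coord_dom c) coord_inv"
proof (induction k)
  case 0
  then show ?case using continuous_coord_inv by simp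
next
  case (Suc k)
  let ?T = "coord c ` coord_dom c"
  have op: "open ?T" by (rule open_coord_image[OF open_coord_dom order_refl])
  show ?case
  proof (rule Ck_on_SucI[OF op coord_inv_has_derivative])
    fix w
    have D: "Ck_on k ?T (\<lambda>y. \<omega> c y w (coord_deriv c (coord_inv y) v))" for v
    proof -
      have "Ck_on k ?T (\<lambda>y. coord_deriv c (coord_inv y) v)"
        unfolding coord_deriv_def
      proof (rule Ck_on_compose[OF op open_coord_dom Suc])
        show "Ck_on k (coord_dom c) (\<lambda>z. frechet_derivative (coord c) (at z) v)"
          using Ck_coord[of "Suc k"] unfolding Ck_on.simps by blast
        show "coord_inv ` ?T \<subseteq> coord_dom c" using coord_inv_in by blast
      qed
      then have 1: "Ck_on k ?T (\<lambda>y. coord_deriv c (coord_inv y) v \<bullet> b)" for b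
        by (rule Ck_on_bounded_linear_comp[OF bounded_linear_inner_left op])
      have "smooth_on (chart_image c) (\<lambda>y. \<omega> c y w b)" for b
        using manifold c
        by (simp add: symplectic_manifold_def differential_two_form_def del: split_paired_All)
      then have 2: "Ck_on k ?T (\<lambda>y. \<omega> c y w b)" for b
        using smooth_on_open_iff[OF chart(2)] Ck_on_subset[OF _ coord_image_chart] by blast
      have "Ck_on k ?T (\<lambda>y. \<Sum>b\<in>Basis. (coord_deriv c (coord_inv y) v \<bullet> b) * \<omega> c y w b)"
        by (intro Ck_on_sum[OF op finite_Basis] Ck_on_bilinear[OF bounded_bilinear_mult op] 1 2)
      moreover have "(\<Sum>b\<in>Basis. (coord_deriv c (coord_inv y) v \<bullet> b) * \<omega> c y w b) =
          \<omega> c y w (coord_deriv c (coord_inv y) v)" if "y \<in> ?T" for y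
      proof -
        have lin: "linear (\<omega> c y w)"
          using \<omega>_bilinear coord_image_chart that unfolding bilinear_def by blast
        show ?thesis
          using linear_sum[OF lin, of "\<lambda>b. (coord_deriv c (coord_inv y) v \<bullet> b) *\<^sub>R b" Basis] linear_cmul[OF lin]
          by (simp add: euclidean_representation)
      qed
      ultimately show ?thesis
        using Ck_on_cong[OF op, of "\<lambda>y. \<Sum>b\<in>Basis. (coord_deriv c (coord_inv y) v \<bullet> b) * \<omega> c y w b"] by simp
    qed
    have "Ck_on k ?T (\<lambda>y. (- 1) *\<^sub>R \<omega> c y w (coord_deriv c (coord_inv y) v))" for v
      by (rule Ck_on_bilinear[OF bounded_bilinear_scaleR op Ck_on_const D])
    then have N: "Ck_on k ?T (\<lambda>y. - \<omega> c y w (coord_deriv c (coord_inv y) v))" for v by simp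
    have "Ck_on k ?T (\<lambda>y. \<Sum>i\<in>UNIV. (- \<omega> c y w (coord_deriv c (coord_inv y) (axis i 1, 0))) *\<^sub>R (0, axis i 1) +
        \<omega> c y w (coord_deriv c (coord_inv y) (0, axis i 1)) *\<^sub>R (axis i 1, 0) :: 'n phase)"
      by (intro Ck_on_sum[OF op] Ck_on_add[OF op] Ck_on_bilinear[OF bounded_bilinear_scaleR op] N D Ck_on_const) simp
    then show "Ck_on k ?T (\<lambda>y. coord_inv_deriv y w)"
      by (simp add: coord_inv_deriv_def sharp_def)
  qed
qed

end

lemma open_embedding:
  assumes "open U" "U \<subseteq> ball 0 R"
  shows "open (\<iota> ` U)"
proof (subst open_subopen, safe)
  fix z assume z: "z \<in> U"
  obtain c where c: "c \<in> A" "\<iota> z \<in> fst c" by (rule chart_cover)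
  let ?V = "fst c \<inter> snd c -` (coord c ` (U \<inter> coord_dom c))"
  have "open ?V"
    by (intro continuous_open_preimage cont_chart chart(1) open_coord_image open_Int assms open_coord_dom c) auto
  moreover have "\<iota> z \<in> ?V" using z c assms(2) by (auto simp: coord_def coord_dom_def)
  moreover have "?V \<subseteq> \<iota> ` U"
  proof
    fix p assume p: "p \<in> ?V"
    then obtain w where w: "w \<in> U" "w \<in> coord_dom c" "snd c p = coord c w" by auto
    then have "p = \<iota> w"
      using p c by (metis IntE chart_inv_chart comp_apply coord_def coord_domD(2))
    then show "p \<in> \<iota> ` U" using w by simp
  qed
  ultimately show "\<exists>T. open T \<and> \<iota> z \<in> T \<and> T \<subseteq> \<iota> ` U" by blast
qed

lemma compact_embedding: "compact K \<Longrightarrow> K \<subseteq> ball 0 R \<Longrightarrow> compact (\<iota> ` K)"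
  using cont_\<iota> compact_continuous_image continuous_on_subset by metis

lemma closed_embedding: "compact K \<Longrightarrow> K \<subseteq> ball 0 R \<Longrightarrow> closed (\<iota> ` K)"
  by (intro compact_imp_closed compact_embedding)

end

context symplectic_ball
begin

subsection \<open>Transplanting Hamiltonian functions\<close>

definition transplant :: "('n phase \<times> real \<Rightarrow> real) \<Rightarrow> 'm \<times> real \<Rightarrow> real" where
  "transplant f p = (if fst p \<in> \<iota> ` ball 0 R then f (\<kappa> (fst p), snd p) else 0)"

lemma transplant_\<iota> [simp]: "norm z < R \<Longrightarrow> transplant f (\<iota> z, t) = f (z, t)"
  by (simp add: transplant_def)

lemma transplant_outside:
  assumes "supported_upto \<rho> f" "t \<in> {0..1}" "p \<notin> \<iota> ` cball 0 \<rho>"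
  shows "transplant f (p, t) = 0"
proof (cases "p \<in> \<iota> ` ball 0 R")
  case True
  have "\<kappa> p \<notin> cball 0 \<rho>"
  proof
    assume "\<kappa> p \<in> cball 0 \<rho>"
    then have "\<iota> (\<kappa> p) \<in> \<iota> ` cball 0 \<rho>" by (rule imageI)
    then show False using assms(3) True by simp
  qed
  then show ?thesis using assms(1,2) True by (auto simp: transplant_def supported_upto_def)
qed (simp add: transplant_def)

lemma mem_coord_image:
  assumes "c \<in> A" "p \<in> fst c" "p \<in> \<iota> ` ball 0 R"
  shows "\<kappa> p \<in> coord_dom c" "coord c (\<kappa> p) = snd c p" "snd c p \<in> coord c ` coord_dom c"
proof -
  show 1: "\<kappa> p \<in> coord_dom c" using assms \<kappa>_in by (simp add: coord_dom_def)
  show 2: "coord c (\<kappa> p) = snd c p" using assms by (simp add: coord_def)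
  show "snd c p \<in> coord c ` coord_dom c" using 1 2 by (metis imageI)
qed

lemma transplant_chart:
  assumes c: "c \<in> A" and y: "y \<in> coord c ` coord_dom c"
  shows "transplant f (chart_inv c y, t) = f (coord_inv c y, t)"
proof -
  from y obtain z where z: "z \<in> coord_dom c" "y = coord c z" by blast
  then show ?thesis
    using coord_domD[OF c z(1)] coord_inv_coord[OF c z(1)] c by (simp add: coord_def)
qed

text \<open>The image of the support is compact, hence closed in the manifold. This gives the derivatives of a
  transplanted function at points that are not in the embedded ball.\<close>

lemma transplant_chart_outside:
  assumes c: "c \<in> A" and p: "p \<in> fst c" "p \<notin> \<iota> ` cball 0 \<rho>" and \<rho>: "\<rho> < R" "supported_upto \<rho> f"
  obtains U where "open U" "snd c p \<in> U" "U \<subseteq> chart_image c"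
    "\<And>y t. y \<in> U \<Longrightarrow> t \<in> {0..1} \<Longrightarrow> transplant f (chart_inv c y, t) = 0"
proof
  let ?U = "chart_image c \<inter> chart_inv c -` (- \<iota> ` cball 0 \<rho>)"
  have "closed (\<iota> ` cball 0 \<rho>)" using \<rho> by (intro closed_embedding) auto
  then show "open ?U"
    by (intro continuous_open_preimage[OF cont_chart_inv[OF c] chart(2)[OF c]]) auto
  show "snd c p \<in> ?U" using p c by (simp add: chart_in)
  show "transplant f (chart_inv c y, t) = 0" if "y \<in> ?U" "t \<in> {0..1}" for y t
    using transplant_outside[OF \<rho>(2) that(2)] that(1) by simp
qed auto

lemma compact_support_time:
  assumes "compact K" "\<And>x t. t \<in> {0..1} \<Longrightarrow> F (x, t) \<noteq> 0 \<Longrightarrow> x \<in> K"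
  shows "compact (closure {(x::'m, t::real). t \<in> {0..1} \<and> F (x, t) \<noteq> (0::real)})"
proof -
  define C where "C = {(x::'m, t::real). t \<in> {0..1} \<and> F (x, t) \<noteq> 0}"
  have K: "compact (K \<times> {0..1::real})" by (intro compact_Times assms(1)) auto
  have "closure C \<subseteq> K \<times> {0..1}"
    by (rule closure_minimal[OF _ compact_imp_closed[OF K]]) (use assms(2) in \<open>auto simp: C_def\<close>)
  then have "K \<times> {0..1} \<inter> closure C = closure C" by blast
  then show ?thesis using compact_Int_closed[OF K closed_closure, of C] by (simp add: C_def)
qed

lemma hamiltonian_transplant:
  assumes f: "phase_ham R f"
  shows "hamiltonian_function A (transplant f)"
  unfolding hamiltonian_function_def
proof (intro conjI ballI)
  obtain \<rho> where \<rho>: "\<rho> < R" "supported_upto \<rho> f" using f by (auto simp: phase_ham_def)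
  show "compact (closure {(x, t). t \<in> {0..1} \<and> transplant f (x, t) \<noteq> 0})"
  proof (rule compact_support_time)
    show "compact (\<iota> ` cball 0 \<rho>)" using \<rho>(1) by (intro compact_embedding) auto
    show "x \<in> \<iota> ` cball 0 \<rho>" if "t \<in> {0..1}" "transplant f (x, t) \<noteq> 0" for x t
      using transplant_outside[OF \<rho>(2) that(1)] that(2) by blast
  qed
  fix c assume c: "c \<in> A"
  show "smooth_on (chart_image c \<times> {0..1}) (\<lambda>(z, t). transplant f (chart_inv c z, t))"
  proof (rule smooth_on_local)
    fix q :: "'n phase \<times> real" assume q: "q \<in> chart_image c \<times> {0..1}"
    define p where "p = chart_inv c (fst q)"
    have p: "p \<in> fst c" "snd c p = fst q"
      using q c by (auto simp: p_def chart_inv_in)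
    show "\<exists>T. open T \<and> q \<in> T \<and>
        smooth_on (chart_image c \<times> {0..1} \<inter> T) (\<lambda>(z, t). transplant f (chart_inv c z, t))"
    proof (cases "p \<in> \<iota> ` cball 0 \<rho>")
      case True
      let ?T = "coord c ` coord_dom c" and ?S = "chart_image c \<times> {0..1::real} \<inter> (coord c ` coord_dom c) \<times> UNIV"
      have op: "open ?T" by (rule open_coord_image[OF c open_coord_dom[OF c] order_refl])
      have "p \<in> \<iota> ` ball 0 R" using True \<rho>(1) by auto
      then have "q \<in> ?T \<times> UNIV" using mem_coord_image(3)[OF c p(1)] p(2) by (simp add: mem_Times_iff)
      moreover have "smooth_on ?S (\<lambda>q. f (coord_inv c (fst q), snd q))"
      proof (rule smooth_on_compose[OF _ phase_hamD[OF f]])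
        have "smooth_on ?T (coord_inv c)"
          using Ck_coord_inv[OF c] smooth_on_open_iff[OF op] by blast
        then show "smooth_on ?S (\<lambda>q. (coord_inv c (fst q), snd q))"
          by (rule smooth_on_map_fst[where g="coord_inv c" and T="?T"]) auto
      qed auto
      then have "smooth_on ?S (\<lambda>(z, t). transplant f (chart_inv c z, t))"
        by (rule smooth_on_cong[THEN iffD1, rotated]) (auto simp: transplant_chart[OF c])
      ultimately show ?thesis using op open_Times[OF op open_UNIV] by blast
    next
      case False
      obtain U where U: "open U" "snd c p \<in> U" "U \<subseteq> chart_image c"
        "\<And>y t. y \<in> U \<Longrightarrow> t \<in> {0..1} \<Longrightarrow> transplant f (chart_inv c y, t) = 0"
        using transplant_chart_outside[OF c p(1) False \<rho>] by metis
      have "smooth_on (chart_image c \<times> {0..1} \<inter> U \<times> UNIV) (\<lambda>(z, t). transplant f (chart_inv c z, t))"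
        by (rule smooth_on_cong[THEN iffD1, OF _ smooth_on_const[where c=0]]) (use U(4) in auto)
      moreover have "open (U \<times> (UNIV::real set))" "q \<in> U \<times> UNIV"
        using U(1,2) p(2) by (auto simp: mem_Times_iff open_Times)
      ultimately show ?thesis by blast
    qed
  qed
qed

text \<open>\<open>Supp F\<close> is a union of closures over all times and may accumulate at the boundary of the ball of radius
  \<open>r\<close>. The room between \<open>r\<close> and \<open>R\<close> makes the extension by zero smooth.\<close>

lemma pull_back:
  assumes F: "hamiltonian_function A F" and supp: "Supp F \<subseteq> \<iota> ` ball 0 r" and r: "r < R"
  obtains f where "phase_ham R f" "supported_upto r f"
    "\<And>x t. t \<in> {0..1} \<Longrightarrow> F (x, t) = transplant f (x, t)"
proof -
  define f where "f = (\<lambda>q. if norm (fst q) < R then F (\<iota> (fst q), snd q) else 0)"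
  have zero: "F (x, t) = 0" if "x \<notin> \<iota> ` ball 0 r" "t \<in> {0..1}" for x t
  proof (rule ccontr)
    assume "F (x, t) \<noteq> 0"
    then have "x \<in> Supp F" using that(2) closure_subset unfolding Supp_def by fast
    then show False using supp that(1) by blast
  qed
  have z: "f (z, t) = 0" if "norm z \<ge> r" "t \<in> {0..1}" for z t
  proof (cases "norm z < R")
    case True
    have "\<iota> z \<notin> \<iota> ` ball 0 r"
    proof
      assume "\<iota> z \<in> \<iota> ` ball 0 r"
      then obtain w where "norm w < r" "\<iota> z = \<iota> w" by auto
      then have "z = w" using True r by (metis \<kappa>_\<iota> less_trans)
      then show False using \<open>norm w < r\<close> that(1) by simp
    qed
    then show ?thesis using zero that(2) True by (simp add: f_def)
  qed (simp add: f_def)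
  then have s: "supported_upto r f" by (auto simp: supported_upto_def)
  have eq: "F (x, t) = transplant f (x, t)" if "t \<in> {0..1}" for x t
  proof (cases "x \<in> \<iota> ` ball 0 R")
    case True
    then show ?thesis by (simp add: transplant_def f_def \<kappa>_in)
  next
    case False
    then have "x \<notin> \<iota> ` ball 0 r" using r by auto
    then show ?thesis using False zero that by (simp add: transplant_def)
  qed
  have "smooth_on (UNIV \<times> {0..1}) f"
  proof (rule smooth_on_local)
    fix q :: "'n phase \<times> real" assume q: "q \<in> UNIV \<times> {0..1}"
    show "\<exists>T. open T \<and> q \<in> T \<and> smooth_on (UNIV \<times> {0..1} \<inter> T) f"
    proof (cases "norm (fst q) < R")
      case True
      obtain c where c: "c \<in> A" "\<iota> (fst q) \<in> fst c" by (rule chart_cover)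
      let ?S = "UNIV \<times> {0..1} \<inter> coord_dom c \<times> (UNIV :: real set)"
      have "smooth_on (coord_dom c) (coord c)"
        using Ck_coord[OF c(1)] smooth_on_open_iff[OF open_coord_dom[OF c(1)]] by blast
      then have "smooth_on ?S (\<lambda>q. (coord c (fst q), snd q))"
        by (rule smooth_on_map_fst[where g="coord c" and T="coord_dom c"]) auto
      moreover have "smooth_on (chart_image c \<times> {0..1}) (\<lambda>(z, t). F (chart_inv c z, t))"
        using F c(1) by (simp add: hamiltonian_function_def)
      ultimately have "smooth_on ?S (\<lambda>q. case (coord c (fst q), snd q) of (z, t) \<Rightarrow> F (chart_inv c z, t))"
        by (rule smooth_on_compose) (use coord_image_chart[OF c(1)] in auto)
      then have "smooth_on ?S f"
        by (rule smooth_on_cong[THEN iffD1, rotated])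
           (auto simp: f_def coord_def coord_dom_def chart_inv_chart[OF c(1)])
      moreover have "open (coord_dom c \<times> (UNIV::real set))" "q \<in> coord_dom c \<times> UNIV"
        using True c open_Times[OF open_coord_dom[OF c(1)] open_UNIV] by (auto simp: coord_dom_def mem_Times_iff)
      ultimately show ?thesis by blast
    next
      case False
      let ?T = "{z::'n phase. norm z > r} \<times> (UNIV::real set)"
      have "smooth_on (UNIV \<times> {0..1} \<inter> ?T) f"
        by (rule smooth_on_cong[THEN iffD1, OF _ smooth_on_const[where c=0]]) (use z in auto)
      moreover have "open ?T" "q \<in> ?T"
        using False r open_Times[OF open_norm_gt open_UNIV] by (auto simp: mem_Times_iff)
      ultimately show ?thesis by blast
    qed
  qed
  then have "phase_ham R f" using s r by (auto simp: phase_ham_def)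
  then show thesis using that s eq by blast
qed

lemma Supp_transplant:
  assumes K: "compact K" "K \<subseteq> ball 0 R" and zero: "\<And>z t. z \<notin> K \<Longrightarrow> t \<in> {0..1} \<Longrightarrow> f (z, t) = 0"
  shows "Supp (transplant f) \<subseteq> \<iota> ` K"
proof -
  have "closure {x. transplant f (x, t) \<noteq> 0} \<subseteq> \<iota> ` K" if t: "t \<in> {0..1}" for t
  proof (rule closure_minimal[OF _ closed_embedding[OF K]], rule subsetI)
    fix x assume x: "x \<in> {x. transplant f (x, t) \<noteq> 0}"
    then have "x \<in> \<iota> ` ball 0 R" "f (\<kappa> x, t) \<noteq> 0" by (auto simp: transplant_def split: if_splits)
    then show "x \<in> \<iota> ` K" using zero[of "\<kappa> x" t] t by (metis \<iota>_\<kappa> imageI)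
  qed
  then show ?thesis unfolding Supp_def by blast
qed

subsection \<open>Trajectories\<close>

text \<open>Both sides have the same pairing with every vector: the form on the manifold restricts to \<open>omega0\<close> and the
  differential of the transplanted function to that of \<open>f\<close>. Nondegeneracy does the rest.\<close>

lemma ham_vector_field_inside:
  assumes f: "phase_ham R f" and c: "c \<in> A" and z: "z \<in> coord_dom c" and t: "t \<in> {0..1}"
  shows "ham_vector_field \<omega> (transplant f) t c (coord c z) = coord_deriv c z (phase_field f t z)"
proof -
  let ?y = "coord c z" and ?L = "coord_inv_deriv c (coord c z)"
  have y: "?y \<in> coord c ` coord_dom c" "?y \<in> chart_image c"
    using z coord_image_chart[OF c] by auto
  have inv: "coord_inv c ?y = z" by (rule coord_inv_coord[OF c z])
  have "((\<lambda>y. f (y, t)) has_derivative (\<lambda>v. slice_deriv f v (z, t))) (at (coord_inv c ?y))"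
    unfolding inv by (rule slice_has_derivative[OF phase_hamD[OF f] t])
  from has_derivative_compose[OF coord_inv_has_derivative[OF c y(1)] this]
  have "((\<lambda>y. f (coord_inv c y, t)) has_derivative (\<lambda>w. slice_deriv f (?L w) (z, t))) (at ?y)" .
  then have "((\<lambda>y. transplant f (chart_inv c y, t)) has_derivative (\<lambda>w. slice_deriv f (?L w) (z, t))) (at ?y)"
    by (rule has_derivative_transform_within_open[OF _ open_coord_image[OF c open_coord_dom[OF c] order_refl] y(1)])
       (simp add: transplant_chart[OF c])
  then have fd: "frechet_derivative (\<lambda>y. transplant f (chart_inv c y, t)) (at ?y) = (\<lambda>w. slice_deriv f (?L w) (z, t))"
    by (rule frechet_derivative_at[symmetric])
  have lin: "linear (\<lambda>v. slice_deriv f v (z, t))"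
    using slice_has_derivative[OF phase_hamD[OF f] t] has_derivative_linear by blast
  have X: "\<omega> c ?y (coord_deriv c z (phase_field f t z)) v = - slice_deriv f (?L v) (z, t)" for v
  proof -
    have "\<omega> c ?y (coord_deriv c z (phase_field f t z)) v =
        \<omega> c ?y (coord_deriv c z (phase_field f t z)) (coord_deriv c z (?L v))"
      by (simp add: coord_inv_deriv_right[OF c z])
    also have "\<dots> = omega0 (phase_field f t z) (?L v)" by (rule \<omega>_coord_deriv[OF c z])
    also have "\<dots> = - slice_deriv f (?L v) (z, t)" unfolding phase_field_def by (rule omega0_sharp[OF lin])
    finally show ?thesis .
  qed
  show ?thesis unfolding ham_vector_field_def fd
  proof (rule the_equality)
    fix X' assume X': "\<forall>v. \<omega> c ?y X' v = - slice_deriv f (?L v) (z, t)"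
    show "X' = coord_deriv c z (phase_field f t z)"
      by (rule \<omega>_nondegenerate[OF c y(2)]) (simp only: X X'[THEN spec])
  qed (simp add: X)
qed

lemma ham_vector_field_outside:
  assumes c: "c \<in> A" and p: "p \<in> fst c" "p \<notin> \<iota> ` cball 0 \<rho>" and \<rho>: "\<rho> < R" "supported_upto \<rho> f" and t: "t \<in> {0..1}"
  shows "ham_vector_field \<omega> (transplant f) t c (snd c p) = 0"
proof -
  obtain U where U: "open U" "snd c p \<in> U" "U \<subseteq> chart_image c"
    "\<And>y t. y \<in> U \<Longrightarrow> t \<in> {0..1} \<Longrightarrow> transplant f (chart_inv c y, t) = 0"
    using transplant_chart_outside[OF c p \<rho>] by metis
  have fd: "frechet_derivative (\<lambda>y. transplant f (chart_inv c y, t)) (at (snd c p)) = (\<lambda>v. 0)"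
    using frechet_derivative_cong_open(1)[OF U(1,2), of "\<lambda>y. transplant f (chart_inv c y, t)" "\<lambda>y. 0"] U(4) t by simp
  have y: "snd c p \<in> chart_image c" using U by auto
  have X: "\<omega> c (snd c p) 0 v = 0" for v
    using bilinear_lzero[OF \<omega>_bilinear[OF c y]] .
  show ?thesis unfolding ham_vector_field_def fd
  proof (rule the_equality)
    fix X' assume X': "\<forall>v. \<omega> c (snd c p) X' v = - 0"
    show "X' = 0" by (rule \<omega>_nondegenerate[OF c y]) (simp only: X X'[THEN spec] minus_zero)
  qed (simp add: X)
qed

lemma ham_trajectory_\<iota>:
  assumes f: "phase_ham R f" and \<delta>: "phase_solution f \<delta>" "norm (\<delta> 0) < R"
  shows "ham_trajectory A \<omega> (transplant f) (\<lambda>t. \<iota> (\<delta> t))"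
  unfolding ham_trajectory_def
proof (intro conjI ballI impI)
  have in_ball: "\<delta> t \<in> ball 0 R" if "t \<in> {0..1}" for t
    using phase_solution_in_ball[OF f \<delta> that] by simp
  have "continuous_on {0..1} \<delta>"
    by (rule continuous_on_vector_derivative[where f'="\<lambda>t. phase_field f t (\<delta> t)"])
       (use \<delta>(1) in \<open>simp add: solves_ode_on_def\<close>)
  then show "continuous_on {0..1} (\<lambda>t. \<iota> (\<delta> t))"
    by (rule continuous_on_compose2[OF cont_\<iota>]) (use in_ball in blast)
  fix t c assume t: "t \<in> {0..1::real}" and c: "c \<in> A" "\<iota> (\<delta> t) \<in> fst c"
  have z: "\<delta> t \<in> coord_dom c" using in_ball[OF t] c(2) by (simp add: coord_dom_def)
  have "(\<delta> has_vector_derivative phase_field f t (\<delta> t)) (at t within {0..1})"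
    using \<delta>(1) t by (simp add: solves_ode_on_def)
  from vector_derivative_diff_chain_within[OF this has_derivative_at_withinI[OF coord_has_derivative[OF c(1) z]]]
  show "((\<lambda>s. snd c (\<iota> (\<delta> s))) has_vector_derivative
      ham_vector_field \<omega> (transplant f) t c (snd c (\<iota> (\<delta> t)))) (at t within {0..1})"
    using ham_vector_field_inside[OF f c(1) z t] by (simp add: coord_def o_def)
qed

lemma ham_trajectory_stationary:
  assumes f: "phase_ham R f" and p: "p \<notin> \<iota> ` ball 0 R"
  shows "ham_trajectory A \<omega> (transplant f) (\<lambda>t. p)"
  unfolding ham_trajectory_def
proof (intro conjI ballI impI)
  obtain \<rho> where \<rho>: "\<rho> < R" "supported_upto \<rho> f" using f by (auto simp: phase_ham_def)
  have p': "p \<notin> \<iota> ` cball 0 \<rho>" using p \<rho>(1) by auto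
  fix t c assume "t \<in> {0..1::real}" "c \<in> A" "p \<in> fst c"
  then show "((\<lambda>s. snd c p) has_vector_derivative ham_vector_field \<omega> (transplant f) t c (snd c p)) (at t within {0..1})"
    using ham_vector_field_outside[OF _ _ p' \<rho>] by simp
qed simp

end

lemma continuous_on_near:
  fixes \<gamma> :: "real \<Rightarrow> 'm::topological_space"
  assumes "continuous_on I \<gamma>" "t \<in> I" "open S" "\<gamma> t \<in> S"
  obtains e where "e > 0" "\<And>s. s \<in> I \<Longrightarrow> dist s t < e \<Longrightarrow> \<gamma> s \<in> S"
proof -
  obtain B where B: "open B" "t \<in> B" "\<forall>s\<in>I. s \<in> B \<longrightarrow> \<gamma> s \<in> S"
    using assms unfolding continuous_on_topological by meson
  then obtain e where "e > 0" "\<And>s. dist s t < e \<Longrightarrow> s \<in> B"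
    unfolding open_dist by blast
  then show thesis using that B(3) by blast
qed

context symplectic_ball
begin

lemma trajectory_pull_back:
  assumes f: "phase_ham R f" and \<gamma>: "ham_trajectory A \<omega> (transplant f) \<gamma>"
    and s: "s \<in> {0..1}" "\<gamma> s \<in> \<iota> ` ball 0 R"
  shows "((\<lambda>s. \<kappa> (\<gamma> s)) has_vector_derivative phase_field f s (\<kappa> (\<gamma> s))) (at s within {0..1})"
proof -
  obtain c where c: "c \<in> A" "\<gamma> s \<in> fst c" by (rule chart_cover)
  note z = mem_coord_image[OF c s(2)]
  let ?z = "\<kappa> (\<gamma> s)"
  have "((\<lambda>s. snd c (\<gamma> s)) has_vector_derivative ham_vector_field \<omega> (transplant f) s c (snd c (\<gamma> s))) (at s within {0..1})"
    using \<gamma> s(1) c unfolding ham_trajectory_def by blast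
  then have "((\<lambda>s. snd c (\<gamma> s)) has_vector_derivative coord_deriv c ?z (phase_field f s ?z)) (at s within {0..1})"
    using ham_vector_field_inside[OF f c(1) z(1) s(1)] by (simp only: z(2))
  from vector_derivative_diff_chain_within[OF this
      has_derivative_at_withinI[OF coord_inv_has_derivative[OF c(1) z(3)]]]
  have D: "((\<lambda>s. coord_inv c (snd c (\<gamma> s))) has_vector_derivative phase_field f s ?z) (at s within {0..1})"
    using coord_inv_deriv_left[OF c(1) z(1)] z(2) by (simp add: o_def)
  have cont: "continuous_on {0..1} \<gamma>" using \<gamma> by (simp add: ham_trajectory_def)
  obtain e where e: "e > 0" "\<And>s'. s' \<in> {0..1} \<Longrightarrow> dist s' s < e \<Longrightarrow> \<gamma> s' \<in> fst c"
    using continuous_on_near[OF cont s(1) chart(1)[OF c(1)] c(2)] by metis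
  show ?thesis
    by (rule has_vector_derivative_transform_within[OF D e(1) s(1)])
       (simp add: coord_inv_def[OF c(1)] chart_inv_chart[OF c(1) e(2)])
qed

text \<open>A trajectory may leave the embedded ball, so there are two kinds of points. In the embedded ball the
  trajectories are pulled back to solutions in phase space, where the field is Lipschitz; elsewhere both
  are stationary in a chart.\<close>

lemma trajectories_agree_near:
  assumes f: "phase_ham R f"
    and \<gamma>: "ham_trajectory A \<omega> (transplant f) \<gamma>" and \<delta>: "ham_trajectory A \<omega> (transplant f) \<delta>"
    and t: "t \<in> {0..1}" and eq: "\<gamma> t = \<delta> t"
  shows "\<exists>e>0. \<forall>s\<in>{0..1}. dist s t < e \<longrightarrow> \<gamma> s = \<delta> s"
proof -
  obtain \<rho> where \<rho>: "\<rho> < R" "supported_upto \<rho> f" using f by (auto simp: phase_ham_def)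
  have cont: "continuous_on {0..1} \<gamma>" "continuous_on {0..1} \<delta>"
    using \<gamma> \<delta> by (simp_all add: ham_trajectory_def)
  have near: "\<exists>a b. t \<in> {a..b} \<and> {a..b} \<subseteq> {0..1} \<and> (\<forall>s\<in>{a..b}. \<gamma> s \<in> S \<and> \<delta> s \<in> S) \<and>
      (\<exists>e>0. \<forall>s\<in>{0..1}. dist s t < e \<longrightarrow> s \<in> {a..b})"
    if S: "open S" "\<gamma> t \<in> S" for S
  proof -
    obtain e where e: "e > 0" "\<And>s. s \<in> {0..1} \<Longrightarrow> dist s t < e \<Longrightarrow> \<gamma> s \<in> S"
      using continuous_on_near[OF cont(1) t S] by metis
    obtain e' where e': "e' > 0" "\<And>s. s \<in> {0..1} \<Longrightarrow> dist s t < e' \<Longrightarrow> \<delta> s \<in> S"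
      using continuous_on_near[OF cont(2) t S(1)] S(2) eq by metis
    define d where "d = min e e' / 2"
    have d: "d > 0" "d < e" "d < e'" using e(1) e'(1) by (auto simp: d_def)
    let ?a = "max 0 (t - d)" and ?b = "min 1 (t + d)"
    have "t \<in> {?a..?b}" "{?a..?b} \<subseteq> {0..1}" using t d by auto
    moreover have "\<gamma> s \<in> S \<and> \<delta> s \<in> S" if "s \<in> {?a..?b}" for s
      using that d by (intro conjI e(2) e'(2)) (auto simp: dist_real_def)
    moreover have "\<forall>s\<in>{0..1}. dist s t < d \<longrightarrow> s \<in> {?a..?b}"
      by (auto simp: dist_real_def)
    ultimately show ?thesis using d(1) by blast
  qed
  show ?thesis
  proof (cases "\<gamma> t \<in> \<iota> ` ball 0 R")
    case True
    obtain a b e where ab: "t \<in> {a..b}" "{a..b} \<subseteq> {0..1}" "\<And>s. s \<in> {a..b} \<Longrightarrow> \<gamma> s \<in> \<iota> ` ball 0 R \<and> \<delta> s \<in> \<iota> ` ball 0 R"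
      and e: "e > 0" "\<forall>s\<in>{0..1}. dist s t < e \<longrightarrow> s \<in> {a..b}"
      using near[OF open_embedding[OF open_ball order_refl] True] by blast
    obtain L where L: "\<And>t z w. t \<in> {0..1} \<Longrightarrow> norm (phase_field f t z - phase_field f t w) \<le> L * norm (z - w)"
      using phase_field_lipschitz[OF f] by metis
    then have lip: "\<And>t z w. t \<in> {a..b} \<Longrightarrow> norm (phase_field f t z - phase_field f t w) \<le> L * norm (z - w)"
      using ab(2) by blast
    have sol: "solves_ode_on (phase_field f) {a..b} (\<lambda>s. \<kappa> (\<gamma> s))" "solves_ode_on (phase_field f) {a..b} (\<lambda>s. \<kappa> (\<delta> s))"
      unfolding solves_ode_on_def
      using trajectory_pull_back[OF f \<gamma>] trajectory_pull_back[OF f \<delta>] ab(2,3)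
      by (meson has_vector_derivative_within_subset subsetD)+
    have "\<kappa> (\<gamma> s) = \<kappa> (\<delta> s)" if "s \<in> {a..b}" for s
      by (rule ode_unique[OF sol lip ab(1) _ that]) (simp_all add: eq)
    then have "\<gamma> s = \<delta> s" if "s \<in> {a..b}" for s
      using ab(3)[OF that] that by (metis \<iota>_\<kappa>)
    then show ?thesis using e by blast
  next
    case False
    obtain c where c: "c \<in> A" "\<gamma> t \<in> fst c" by (rule chart_cover)
    have S: "open (fst c - \<iota> ` cball 0 \<rho>)"
      using \<rho>(1) by (intro open_Diff chart(1)[OF c(1)] closed_embedding) auto
    have tS: "\<gamma> t \<in> fst c - \<iota> ` cball 0 \<rho>" using False c(2) \<rho>(1) by auto
    obtain a b e where ab: "t \<in> {a..b}" "{a..b} \<subseteq> {0..1}"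
      "\<And>s. s \<in> {a..b} \<Longrightarrow> \<gamma> s \<in> fst c - \<iota> ` cball 0 \<rho> \<and> \<delta> s \<in> fst c - \<iota> ` cball 0 \<rho>"
      and e: "e > 0" "\<forall>s\<in>{0..1}. dist s t < e \<longrightarrow> s \<in> {a..b}"
      using near[OF S tS] by blast
    have D: "((\<lambda>s. snd c (\<eta> s)) has_vector_derivative 0) (at s within {a..b})"
      if \<eta>: "ham_trajectory A \<omega> (transplant f) \<eta>" and s: "s \<in> {a..b}" "\<eta> s \<in> fst c - \<iota> ` cball 0 \<rho>" for \<eta> s
    proof -
      have s1: "s \<in> {0..1}" using s(1) ab(2) by blast
      have "((\<lambda>s. snd c (\<eta> s)) has_vector_derivative 0) (at s within {0..1})"
        using \<eta> s(2) s1 c(1) ham_vector_field_outside[OF c(1) _ _ \<rho> s1, of "\<eta> s"]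
        unfolding ham_trajectory_def by fastforce
      then show ?thesis using ab(2) by (rule has_vector_derivative_within_subset)
    qed
    have "snd c (\<gamma> s) = snd c (\<delta> s)" if s: "s \<in> {a..b}" for s
    proof -
      have "snd c (\<gamma> s) - snd c (\<delta> s) = 0"
      proof (rule gronwall_zero[where w="\<lambda>s. snd c (\<gamma> s) - snd c (\<delta> s)" and w'="\<lambda>s. 0" and L=0, OF _ _ ab(1) _ s])
        show "((\<lambda>s. snd c (\<gamma> s) - snd c (\<delta> s)) has_vector_derivative 0) (at u within {a..b})" if "u \<in> {a..b}" for u
          using has_vector_derivative_diff[OF D[OF \<gamma> that] D[OF \<delta> that]] ab(3)[OF that] by simp
      qed (use eq in auto)
      then show ?thesis by simp
    qed
    then have "\<gamma> s = \<delta> s" if "s \<in> {a..b}" for s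
      using ab(3)[OF that] that by (metis DiffD1 c(1) chart_inv_chart)
    then show ?thesis using e by blast
  qed
qed

text \<open>The set of times at which the trajectories agree is open and closed in \<open>{0..1}\<close>.\<close>

lemma trajectories_unique:
  assumes f: "phase_ham R f"
    and \<gamma>: "ham_trajectory A \<omega> (transplant f) \<gamma>" and \<delta>: "ham_trajectory A \<omega> (transplant f) \<delta>"
    and eq: "\<gamma> 0 = \<delta> 0" and t: "t \<in> {0..1}"
  shows "\<gamma> t = \<delta> t"
proof -
  define E where "E = {0..1} \<inter> (\<lambda>s. (\<gamma> s, \<delta> s)) -` {y. \<exists>x. y = (x, x)}"
  have E_eq: "E = {s \<in> {0..1}. \<gamma> s = \<delta> s}" by (auto simp: E_def)
  have "continuous_on {0..1} \<gamma>" "continuous_on {0..1} \<delta>"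
    using \<gamma> \<delta> by (simp_all add: ham_trajectory_def)
  then have "closed E"
    unfolding E_def
    by (intro continuous_closed_preimage continuous_on_Pair closed_atLeastAtMost closed_diagonal)
  then have "closedin (top_of_set {0..1}) E"
    by (auto simp: E_def closed_subset)
  moreover have "openin (top_of_set {0..1}) E"
    unfolding openin_euclidean_subtopology_iff E_eq
    using trajectories_agree_near[OF f \<gamma> \<delta>] by blast
  moreover have "0 \<in> E" using eq by (simp add: E_def)
  moreover have "connected {0..1::real}" by (rule connected_Icc)
  ultimately have "E = {0..1}" unfolding connected_clopen by blast
  then show ?thesis using t E_eq by blast
qed

text \<open>These elements of \<open>Ham A \<omega>\<close> are closed under composition and inversion, with explicit generating functions.\<close>

definition \<Phi> :: "('n phase \<times> real \<Rightarrow> real) \<Rightarrow> 'm \<Rightarrow> 'm" where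
  "\<Phi> f = ham_diffeo A \<omega> (transplant f)"

lemma \<Phi>_eqI:
  assumes f: "phase_ham R f" and \<gamma>: "ham_trajectory A \<omega> (transplant f) \<gamma>"
  shows "\<Phi> f (\<gamma> 0) = \<gamma> 1"
  unfolding \<Phi>_def ham_diffeo_def ham_isotopy_def
proof (rule the_equality)
  show "\<exists>\<gamma>'. ham_trajectory A \<omega> (transplant f) \<gamma>' \<and> \<gamma>' 0 = \<gamma> 0 \<and> \<gamma>' 1 = \<gamma> 1"
    using \<gamma> by blast
  show "y = \<gamma> 1" if "\<exists>\<gamma>'. ham_trajectory A \<omega> (transplant f) \<gamma>' \<and> \<gamma>' 0 = \<gamma> 0 \<and> \<gamma>' 1 = y" for y
    using that trajectories_unique[OF f _ \<gamma>, of _ 1] by auto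
qed

lemma \<Phi>_\<iota>:
  assumes f: "phase_ham R f" and z: "norm z < R"
  shows "\<Phi> f (\<iota> z) = \<iota> (phase_flow f z)"
proof -
  obtain \<delta> where \<delta>: "phase_solution f \<delta>" "\<delta> 0 = z" using phase_solution_exists[OF f] .
  have "\<Phi> f (\<iota> (\<delta> 0)) = \<iota> (\<delta> 1)"
    using \<Phi>_eqI[OF f ham_trajectory_\<iota>[OF f \<delta>(1)]] \<delta>(2) z by simp
  then show ?thesis using phase_flow_eqI[OF f \<delta>] \<delta>(2) by simp
qed

lemma \<Phi>_outside:
  assumes f: "phase_ham R f" and p: "p \<notin> \<iota> ` ball 0 R"
  shows "\<Phi> f p = p"
  using \<Phi>_eqI[OF f ham_trajectory_stationary[OF f p]] .

lemma \<Phi>_fixes_outside_support: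
  assumes f: "phase_ham R f" "supported_upto \<rho> f" and p: "p \<notin> \<iota> ` cball 0 \<rho>"
  shows "\<Phi> f p = p"
proof (cases "p \<in> \<iota> ` ball 0 R")
  case True
  then obtain z where z: "norm z < R" "p = \<iota> z" by auto
  then have "norm z > \<rho>" using p by (metis imageI linorder_not_less mem_cball_0)
  then show ?thesis using \<Phi>_\<iota>[OF f(1) z(1)] phase_flow_outside[OF f] z(2) by simp
qed (rule \<Phi>_outside[OF f(1)])

lemma \<Phi>_Ham: "phase_ham R f \<Longrightarrow> \<Phi> f \<in> Ham A \<omega>"
  unfolding \<Phi>_def Ham_def using hamiltonian_transplant by blast

lemma \<Phi>_concat:
  assumes f: "phase_ham R f" and g: "phase_ham R g"
  shows "\<Phi> (concat_ham f g) = \<Phi> g \<circ> \<Phi> f"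
proof
  fix p
  note fg = phase_ham_concat[OF f g]
  show "\<Phi> (concat_ham f g) p = (\<Phi> g \<circ> \<Phi> f) p"
  proof (cases "p \<in> \<iota> ` ball 0 R")
    case True
    then obtain z where z: "norm z < R" "p = \<iota> z" by auto
    then show ?thesis
      by (simp add: \<Phi>_\<iota>[OF fg] \<Phi>_\<iota>[OF f] \<Phi>_\<iota>[OF g] phase_flow_in_ball[OF f] phase_flow_concat[OF f g])
  qed (simp add: \<Phi>_outside[OF fg] \<Phi>_outside[OF f] \<Phi>_outside[OF g])
qed

lemma \<Phi>_reversed:
  assumes f: "phase_ham R f"
  shows "\<Phi> (reversed f) (\<Phi> f p) = p"
proof (cases "p \<in> \<iota> ` ball 0 R")
  case True
  then obtain z where z: "norm z < R" "p = \<iota> z" by auto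
  then show ?thesis
    by (simp add: \<Phi>_\<iota>[OF phase_ham_reversed[OF f]] \<Phi>_\<iota>[OF f] phase_flow_in_ball[OF f] phase_flow_reversed[OF f])
qed (simp add: \<Phi>_outside[OF phase_ham_reversed[OF f]] \<Phi>_outside[OF f])

lemma bij_\<Phi>: "phase_ham R f \<Longrightarrow> bij (\<Phi> f)" and inv_\<Phi>: "phase_ham R f \<Longrightarrow> inv (\<Phi> f) = \<Phi> (reversed f)"
proof -
  assume f: "phase_ham R f"
  have *: "\<Phi> (reversed f) \<circ> \<Phi> f = id" "\<Phi> f \<circ> \<Phi> (reversed f) = id"
    using \<Phi>_reversed[OF f] \<Phi>_reversed[OF phase_ham_reversed[OF f]] by (simp_all add: fun_eq_iff)
  then show "bij (\<Phi> f)" by (rule o_bij)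
  show "inv (\<Phi> f) = \<Phi> (reversed f)" by (rule inv_unique_comp[OF *(2,1)])
qed

lemma ham_diffeo_cong:
  assumes "\<And>x t. t \<in> {0..1} \<Longrightarrow> F (x, t) = G (x, t)"
  shows "ham_diffeo A \<omega> F = ham_diffeo A \<omega> G"
proof -
  have "ham_vector_field \<omega> F t c z = ham_vector_field \<omega> G t c z" if "t \<in> {0..1}" for t c z
    using assms[OF that] by (simp add: ham_vector_field_def)
  then have "ham_trajectory A \<omega> F = ham_trajectory A \<omega> G"
    by (auto simp: ham_trajectory_def fun_eq_iff)
  then show ?thesis by (simp add: ham_diffeo_def ham_isotopy_def fun_eq_iff)
qed

end

section \<open>Displacement and commutators\<close>

lemma commutator_of_displaced:
  fixes f g k :: "'a \<Rightarrow> 'a"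
  assumes bij: "bij f" "bij g" "bij k"
    and f: "\<And>x. x \<notin> S \<Longrightarrow> f x = x" and g: "\<And>x. x \<notin> S \<Longrightarrow> g x = x" and k: "k ` S \<inter> S = {}"
  shows "commutator f g =
    (f \<circ> k \<circ> inv f) \<circ> (inv k \<circ> ((g \<circ> k \<circ> inv g) \<circ> ((g \<circ> f) \<circ> inv k \<circ> inv (g \<circ> f))))"
proof
  fix x
  define f' g' k' where inv: "f' = inv f" "g' = inv g" "k' = inv k"
  have f': "f (f' x) = x" "f' (f x) = x" and g': "g (g' x) = x" "g' (g x) = x"
    and k': "k (k' x) = x" "k' (k x) = x" for x
    using bij by (simp_all add: inv bij_is_inj bij_is_surj surj_f_inv_f)
  have fS: "f x \<in> S \<longleftrightarrow> x \<in> S" and gS: "g x \<in> S \<longleftrightarrow> x \<in> S" for x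
    using f g f'(2) g'(2) by metis+
  \<comment> \<open>The conjugate of \<open>f\<close> by \<open>k\<close> lives on \<open>k ` S\<close>, hence commutes with \<open>g\<close>.\<close>
  have comm: "g (k (f (k' y))) = k (f (k' (g y)))" for y
  proof (cases "y \<in> S")
    case True
    then have "k' y \<notin> S" "k' (g y) \<notin> S" using k gS k'(1) by (metis IntI empty_iff imageI)+
    then show ?thesis by (simp add: f k')
  next
    case False
    then have "k (f (k' y)) \<notin> S"
      using k k'(1) f by (metis IntI empty_iff fS imageI)
    then show ?thesis using g False by simp
  qed
  have "inv (g \<circ> f) = f' \<circ> g'"
    using bij by (simp add: inv o_inv_distrib)
  moreover have "f (g y) = f (k (f' (k' (g (k (f (k' y)))))))" for y
    by (simp add: comm f' k')
  ultimately show "commutator f g x =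
    ((f \<circ> k \<circ> inv f) \<circ> (inv k \<circ> ((g \<circ> k \<circ> inv g) \<circ> ((g \<circ> f) \<circ> inv k \<circ> inv (g \<circ> f))))) x"
    by (simp add: commutator_def inv[symmetric] g')
qed

section \<open>Fragmentations of bounded length\<close>

text \<open>Witnesses for the infimum in \<open>fragmented_hofer_norm\<close>; they can be composed without a case distinction on
  infinite values.\<close>

definition has_fragmentation ::
  "('m::{t2_space, second_countable_topology}, 'n::finite) chart set \<Rightarrow> ('m, 'n) two_form \<Rightarrow>
   'm set \<Rightarrow> ('m \<Rightarrow> 'm) \<Rightarrow> real \<Rightarrow> bool" where
  "has_fragmentation A \<omega> U \<phi> L \<longleftrightarrow> (\<exists>ps.
     (\<forall>(h, F)\<in>set ps. h \<in> Ham A \<omega> \<and> hamiltonian_function A F \<and> Supp F \<subseteq> U) \<and>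
     \<phi> = foldr (\<circ>) (map (\<lambda>(h, F). h \<circ> ham_diffeo A \<omega> F \<circ> inv h) ps) id \<and>
     (\<Sum>(h, F)\<leftarrow>ps. hofer_length F) \<le> L)"

lemma fragmented_hofer_norm_le:
  assumes "has_fragmentation A \<omega> U \<phi> L"
  shows "fragmented_hofer_norm A \<omega> U \<phi> \<le> ereal L"
proof -
  obtain ps where ps: "\<forall>(h, F)\<in>set ps. h \<in> Ham A \<omega> \<and> hamiltonian_function A F \<and> Supp F \<subseteq> U"
    "\<phi> = foldr (\<circ>) (map (\<lambda>(h, F). h \<circ> ham_diffeo A \<omega> F \<circ> inv h) ps) id"
    "(\<Sum>(h, F)\<leftarrow>ps. hofer_length F) \<le> L"
    using assms unfolding has_fragmentation_def by (elim exE conjE)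
  have "fragmented_hofer_norm A \<omega> U \<phi> \<le> ereal (\<Sum>(h, F)\<leftarrow>ps. hofer_length F)"
    unfolding fragmented_hofer_norm_def by (rule Inf_lower) (use ps(1,2) in blast)
  then show ?thesis using ps(3) by (meson ereal_less_eq(3) order_trans)
qed

lemma has_fragmentation_id: "has_fragmentation A \<omega> U id 0"
  unfolding has_fragmentation_def by (rule exI[of _ "[]"]) simp

lemma has_fragmentation_single:
  assumes "h \<in> Ham A \<omega>" "hamiltonian_function A F" "Supp F \<subseteq> U" "hofer_length F \<le> L"
  shows "has_fragmentation A \<omega> U (h \<circ> ham_diffeo A \<omega> F \<circ> inv h) L"
  unfolding has_fragmentation_def by (rule exI[of _ "[(h, F)]"]) (simp add: assms)

lemma foldr_comp_append: "foldr (\<circ>) (xs @ ys) id = foldr (\<circ>) xs id \<circ> foldr (\<circ>) ys id"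
  by (induction xs) (simp_all add: comp_assoc)

lemma has_fragmentation_comp:
  assumes "has_fragmentation A \<omega> U \<phi> K" "has_fragmentation A \<omega> U \<psi> L"
  shows "has_fragmentation A \<omega> U (\<phi> \<circ> \<psi>) (K + L)"
proof -
  obtain ps where ps: "\<forall>(h, F)\<in>set ps. h \<in> Ham A \<omega> \<and> hamiltonian_function A F \<and> Supp F \<subseteq> U"
    "\<phi> = foldr (\<circ>) (map (\<lambda>(h, F). h \<circ> ham_diffeo A \<omega> F \<circ> inv h) ps) id"
    "(\<Sum>(h, F)\<leftarrow>ps. hofer_length F) \<le> K"
    using assms(1) unfolding has_fragmentation_def by (elim exE conjE)
  obtain qs where qs: "\<forall>(h, F)\<in>set qs. h \<in> Ham A \<omega> \<and> hamiltonian_function A F \<and> Supp F \<subseteq> U"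
    "\<psi> = foldr (\<circ>) (map (\<lambda>(h, F). h \<circ> ham_diffeo A \<omega> F \<circ> inv h) qs) id"
    "(\<Sum>(h, F)\<leftarrow>qs. hofer_length F) \<le> L"
    using assms(2) unfolding has_fragmentation_def by (elim exE conjE)
  show ?thesis
    unfolding has_fragmentation_def
  proof (rule exI[of _ "ps @ qs"], intro conjI)
    show "\<forall>(h, F)\<in>set (ps @ qs). h \<in> Ham A \<omega> \<and> hamiltonian_function A F \<and> Supp F \<subseteq> U"
      using ps(1) qs(1) by auto
    show "\<phi> \<circ> \<psi> = foldr (\<circ>) (map (\<lambda>(h, F). h \<circ> ham_diffeo A \<omega> F \<circ> inv h) (ps @ qs)) id"
      unfolding map_append foldr_comp_append ps(2) qs(2) ..
    show "(\<Sum>(h, F)\<leftarrow>ps @ qs. hofer_length F) \<le> K + L"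
      using ps(3) qs(3) by simp
  qed
qed

text \<open>If the oscillation is not integrable, its integral is zero by convention and the bound holds as well.\<close>

lemma hofer_length_le:
  fixes F :: "'m::topological_space \<times> real \<Rightarrow> real"
  assumes B: "\<And>x t. t \<in> {0..1} \<Longrightarrow> \<bar>F (x, t)\<bar> \<le> B"
  shows "hofer_length F \<le> 2 * B"
proof -
  have B0: "0 \<le> B" using B[of 0 undefined] abs_ge_zero order_trans by fastforce
  let ?g = "\<lambda>t. (SUP x. F (x, t)) - (INF x. F (x, t))"
  have g: "?g t \<le> 2 * B" if t: "t \<in> {0..1}" for t
  proof -
    have "(SUP x. F (x, t)) \<le> B" "- B \<le> (INF x. F (x, t))"
      using B[OF t] by (auto intro!: cSUP_least cINF_greatest simp: abs_le_iff minus_le_iff)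
    then show ?thesis by simp
  qed
  show ?thesis
  proof (cases "?g integrable_on {0..1}")
    case True
    then have "integral {0..1} ?g \<le> integral {0..1} (\<lambda>t::real. 2 * B)"
      by (rule integral_le) (use g in auto)
    then show ?thesis by (simp add: hofer_length_def)
  next
    case False
    then show ?thesis using B0 by (simp add: hofer_length_def not_integrable_integral)
  qed
qed

context symplectic_ball
begin

lemma hofer_length_transplant:
  assumes "\<And>z t. t \<in> {0..1} \<Longrightarrow> \<bar>f (z, t)\<bar> \<le> B" "0 \<le> B"
  shows "hofer_length (transplant f) \<le> 2 * B"
  by (rule hofer_length_le) (use assms in \<open>simp add: transplant_def\<close>)

text \<open>The intended use: \<open>f\<close> moves a ball by one small step while being supported near its boundary, and \<open>h j\<close> moves
  the ball by \<open>j\<close> steps, so that the composition displaces the ball although each factor is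
  conjugate to a diffeomorphism supported near the boundary of the original ball.\<close>

primrec conjugates :: "(nat \<Rightarrow> 'n phase \<times> real \<Rightarrow> real) \<Rightarrow> ('n phase \<times> real \<Rightarrow> real) \<Rightarrow> nat \<Rightarrow> 'm \<Rightarrow> 'm" where
  "conjugates h f 0 = id"
| "conjugates h f (Suc j) = (\<Phi> (h j) \<circ> \<Phi> f \<circ> inv (\<Phi> (h j))) \<circ> conjugates h f j"

text \<open>A conjugate of a conjugate is again an admissible factor because \<open>\<Phi> a \<circ> \<Phi> h\<close> is Hamiltonian.\<close>

lemma has_fragmentation_conjugate:
  assumes "phase_ham R a" "phase_ham R h" "phase_ham R f" "Supp (transplant f) \<subseteq> U" "hofer_length (transplant f) \<le> L"
  shows "has_fragmentation A \<omega> U (\<Phi> a \<circ> (\<Phi> h \<circ> \<Phi> f \<circ> inv (\<Phi> h)) \<circ> inv (\<Phi> a)) L"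
proof -
  have "inv (\<Phi> (concat_ham h a)) = inv (\<Phi> h) \<circ> inv (\<Phi> a)"
    using assms by (simp add: \<Phi>_concat o_inv_distrib bij_\<Phi>)
  then have "\<Phi> a \<circ> (\<Phi> h \<circ> \<Phi> f \<circ> inv (\<Phi> h)) \<circ> inv (\<Phi> a) =
      \<Phi> (concat_ham h a) \<circ> ham_diffeo A \<omega> (transplant f) \<circ> inv (\<Phi> (concat_ham h a))"
    using assms by (simp add: \<Phi>_concat comp_assoc \<Phi>_def[of f])
  then show ?thesis
    using assms by (simp add: has_fragmentation_single \<Phi>_Ham phase_ham_concat hamiltonian_transplant)
qed

lemma conj_comp:
  assumes "bij a"
  shows "a \<circ> (x \<circ> y) \<circ> inv a = (a \<circ> x \<circ> inv a) \<circ> (a \<circ> y \<circ> inv a)"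
  using assms by (simp add: fun_eq_iff bij_is_inj)

lemma bij_conjugates:
  assumes "\<And>i. phase_ham R (h i)" "phase_ham R f"
  shows "bij (conjugates h f j)"
proof (induction j)
  case 0
  show ?case unfolding conjugates.simps by (rule bij_id)
next
  case (Suc j)
  show ?case unfolding conjugates.simps
    by (intro bij_comp Suc bij_imp_bij_inv bij_\<Phi> assms)
qed

lemma conjugates_fragmentation:
  assumes a: "phase_ham R a" and h: "\<And>i. phase_ham R (h i)" and f: "phase_ham R f"
    and U: "Supp (transplant f) \<subseteq> U" "Supp (transplant (reversed f)) \<subseteq> U"
    and L: "hofer_length (transplant f) \<le> L" "hofer_length (transplant (reversed f)) \<le> L"
  shows "has_fragmentation A \<omega> U (\<Phi> a \<circ> conjugates h f j \<circ> inv (\<Phi> a)) (j * L)"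
    and "has_fragmentation A \<omega> U (\<Phi> a \<circ> inv (conjugates h f j) \<circ> inv (\<Phi> a)) (j * L)"
proof -
  note b = bij_\<Phi>[OF a]
  have conj_id: "\<Phi> a \<circ> id \<circ> inv (\<Phi> a) = id"
    using b by (simp add: fun_eq_iff bij_is_surj surj_f_inv_f)
  show "has_fragmentation A \<omega> U (\<Phi> a \<circ> conjugates h f j \<circ> inv (\<Phi> a)) (j * L)"
  proof (induction j)
    case 0
    show ?case by (simp only: conjugates.simps conj_id of_nat_0 mult_zero_left has_fragmentation_id)
  next
    case (Suc j)
    have len: "real (Suc j) * L = L + real j * L" by (simp add: algebra_simps)
    show ?case
      unfolding conjugates.simps len conj_comp[OF b, of "\<Phi> (h j) \<circ> \<Phi> f \<circ> inv (\<Phi> (h j))"]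
      by (rule has_fragmentation_comp[OF has_fragmentation_conjugate[OF a h[of j] f U(1) L(1)] Suc])
  qed
  show "has_fragmentation A \<omega> U (\<Phi> a \<circ> inv (conjugates h f j) \<circ> inv (\<Phi> a)) (j * L)"
  proof (induction j)
    case 0
    show ?case by (simp only: conjugates.simps inv_id conj_id of_nat_0 mult_zero_left has_fragmentation_id)
  next
    case (Suc j)
    have "inv (\<Phi> (h j) \<circ> \<Phi> f \<circ> inv (\<Phi> (h j))) = \<Phi> (h j) \<circ> \<Phi> (reversed f) \<circ> inv (\<Phi> (h j))"
      using bij_\<Phi>[OF h[of j]] bij_\<Phi>[OF f]
      by (simp add: o_inv_distrib bij_comp bij_imp_bij_inv inv_inv_eq comp_assoc inv_\<Phi>[OF f])
    then have "inv (conjugates h f (Suc j)) =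
        inv (conjugates h f j) \<circ> (\<Phi> (h j) \<circ> \<Phi> (reversed f) \<circ> inv (\<Phi> (h j)))"
      using bij_\<Phi>[OF h[of j]] bij_\<Phi>[OF f] bij_conjugates[of h f j, OF h f]
      by (simp only: conjugates.simps) (simp add: o_inv_distrib bij_comp bij_imp_bij_inv)
    note inv_Suc = this
    have len: "real (Suc j) * L = real j * L + L" by (simp add: algebra_simps)
    show ?case
      unfolding inv_Suc len conj_comp[OF b, of "inv (conjugates h f j)"]
      by (rule has_fragmentation_comp[OF Suc has_fragmentation_conjugate[OF a h[of j] phase_ham_reversed[OF f] U(2) L(2)]])
  qed
qed

text \<open>The inverse of the displacing map that occurs in \<open>commutator_of_displaced\<close> without being conjugated is
  treated as a conjugate by the time-one map of the zero function.\<close>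

lemma commutator_fragmentation:
  assumes R: "R > 0" and f: "phase_ham R f" "supported_upto r f" and g: "phase_ham R g" "supported_upto r g"
    and h: "\<And>i. phase_ham R (h i)" and p: "phase_ham R p"
    and U: "Supp (transplant p) \<subseteq> U" "Supp (transplant (reversed p)) \<subseteq> U"
    and L: "hofer_length (transplant p) \<le> L" "hofer_length (transplant (reversed p)) \<le> L"
    and displaced: "conjugates h p j ` (\<iota> ` cball 0 r) \<inter> \<iota> ` cball 0 r = {}"
  shows "has_fragmentation A \<omega> U (commutator (\<Phi> f) (\<Phi> g)) (4 * (j * L))"
proof -
  let ?k = "conjugates h p j"
  note frag = conjugates_fragmentation[where h=h and j=j, OF _ h p U L]
  have zero: "phase_ham R (\<lambda>_. 0)" "supported_upto (-1) (\<lambda>_. 0)"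
    using R by (auto simp: phase_ham_def supported_upto_def intro!: smooth_on_const exI[of _ 0])
  have "\<Phi> (\<lambda>_. 0) = id"
    using \<Phi>_fixes_outside_support[OF zero] by (simp add: fun_eq_iff)
  then have k': "has_fragmentation A \<omega> U (inv ?k) (j * L)"
    using frag(2)[OF zero(1)] by simp
  have gf: "has_fragmentation A \<omega> U ((\<Phi> g \<circ> \<Phi> f) \<circ> inv ?k \<circ> inv (\<Phi> g \<circ> \<Phi> f)) (j * L)"
    using frag(2)[OF phase_ham_concat[OF f(1) g(1)]] by (simp only: \<Phi>_concat[OF f(1) g(1)])
  have "commutator (\<Phi> f) (\<Phi> g) =
    (\<Phi> f \<circ> ?k \<circ> inv (\<Phi> f)) \<circ> (inv ?k \<circ> ((\<Phi> g \<circ> ?k \<circ> inv (\<Phi> g)) \<circ> ((\<Phi> g \<circ> \<Phi> f) \<circ> inv ?k \<circ> inv (\<Phi> g \<circ> \<Phi> f))))"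
    by (rule commutator_of_displaced[OF bij_\<Phi>[OF f(1)] bij_\<Phi>[OF g(1)] bij_conjugates[OF h p] _ _ displaced])
       (rule \<Phi>_fixes_outside_support[OF f] \<Phi>_fixes_outside_support[OF g], assumption)+
  then show ?thesis
    using has_fragmentation_comp[OF frag(1)[OF f(1)] has_fragmentation_comp[OF k'
        has_fragmentation_comp[OF frag(1)[OF g(1)] gf]]]
    by (simp add: mult.commute)
qed

end

section \<open>Cut-off functions for balls and spherical shells\<close>

lemma norm_shift: "norm ((axis i c, 0) :: 'n::finite phase) = \<bar>c\<bar>"
  by (simp add: norm_Pair norm_eq_sqrt_inner inner_axis_axis)

text \<open>To be used as the function \<open>q\<close> of \<open>push_ham\<close>: for positive \<open>d\<close> it is nonpositive where
  \<open>norm z \<ge> sqrt a\<close> and greater than one where \<open>z \<bullet> z < a - d\<close>.\<close>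

definition ball_cut :: "real \<Rightarrow> real \<Rightarrow> 'n::finite phase \<Rightarrow> real" where
  "ball_cut a d z = (a - z \<bullet> z) / d"

text \<open>To be used as the function \<open>q\<close> of \<open>push_ham\<close>: greater than one where \<open>z \<bullet> z\<close> differs from \<open>r\<^sup>2\<close> by less than \<open>b\<close>,
  nonpositive where it differs by at least \<open>2 * b\<close>. It is a polynomial in the coordinates, hence smooth at the origin too.\<close>

definition shell_cut :: "real \<Rightarrow> real \<Rightarrow> 'n::finite phase \<Rightarrow> real" where
  "shell_cut r b z = 2 - ((z \<bullet> z - r\<^sup>2) / b)\<^sup>2"

lemma smooth_ball_cut: "smooth_on S (ball_cut a d)"
  unfolding ball_cut_def[abs_def] divide_inverse by (intro smooth_intros)

lemma smooth_shell_cut: "smooth_on S (shell_cut r b)"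
  unfolding shell_cut_def[abs_def] divide_inverse power2_eq_square by (intro smooth_intros)

lemma ball_push:
  assumes "d > 0" "0 \<le> a" "a < R\<^sup>2" "R > 0"
  shows ball_push_supported: "supported_upto (sqrt a) (push_ham (ball_cut a d) c i)"
    and phase_ham_ball_push: "phase_ham R (push_ham (ball_cut a d) c i)"
proof -
  have "ball_cut a d z \<le> 0" if "norm z > sqrt a" for z :: "'a phase"
  proof -
    have "a \<le> (norm z)\<^sup>2" using power_mono[of "sqrt a" "norm z" 2] that assms(2) by simp
    then show ?thesis using assms(1) by (simp add: ball_cut_def power2_norm_eq_inner divide_nonpos_pos)
  qed
  moreover have "sqrt a < R" using assms by (simp add: real_less_lsqrt)
  ultimately show "supported_upto (sqrt a) (push_ham (ball_cut a d) c i)" "phase_ham R (push_ham (ball_cut a d) c i)"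
    using phase_ham_push[OF smooth_ball_cut] by blast+
qed

lemma phase_flow_ball_push:
  assumes "d > 0" "0 \<le> a" "a < R\<^sup>2" "R > 0" and B: "norm z + \<bar>c\<bar> < B" "B\<^sup>2 \<le> a - d"
  shows "phase_flow (push_ham (ball_cut a d) c i) z = z + (axis i c, 0)"
proof (rule phase_flow_push[OF phase_ham_ball_push[OF assms(1-4)] smooth_ball_cut])
  fix \<tau> :: real assume \<tau>: "\<tau> \<in> {0..1}"
  let ?w = "z + \<tau> *\<^sub>R (axis i c, 0)"
  have "norm ?w \<le> norm z + \<bar>\<tau>\<bar> * \<bar>c\<bar>"
    by (rule order_trans[OF norm_triangle_ineq]) (simp only: norm_scaleR norm_shift)
  also have "\<dots> \<le> norm z + \<bar>c\<bar>" using \<tau> by (simp add: mult_left_le_one_le)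
  finally have "norm ?w < B" using B(1) by simp
  then have "(norm ?w)\<^sup>2 < B\<^sup>2" by (intro power_strict_mono) auto
  then have "?w \<bullet> ?w < a - d" using B(2) unfolding power2_norm_eq_inner by simp
  then show "1 < ball_cut a d ?w"
    unfolding ball_cut_def using assms(1) by (simp only: less_divide_eq) simp
qed

definition shell :: "real \<Rightarrow> real \<Rightarrow> 'n::finite phase set" where
  "shell r b = {z. \<bar>z \<bullet> z - r\<^sup>2\<bar> \<le> 2 * b}"

context
  fixes r b :: real
  assumes r: "r > 0" and b: "b > 0" "4 * b \<le> r\<^sup>2"
begin

lemma shell_norm_le: "z \<in> shell r b \<Longrightarrow> norm z \<le> 2 * r"
proof -
  assume "z \<in> shell r b"
  then have "z \<bullet> z \<le> r\<^sup>2 + 2 * b" unfolding shell_def mem_Collect_eq by linarith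
  also have "\<dots> \<le> 4 * r\<^sup>2" using b by linarith
  also have "4 * r\<^sup>2 = (2 * r)\<^sup>2" by (simp add: power_mult_distrib)
  finally have "(norm z)\<^sup>2 \<le> (2 * r)\<^sup>2" unfolding power2_norm_eq_inner .
  then show ?thesis by (rule power2_le_imp_le) (use r in simp)
qed

lemma compact_shell: "compact (shell r b :: 'n::finite phase set)"
  unfolding compact_eq_bounded_closed
proof
  show "bounded (shell r b :: 'n phase set)" using shell_norm_le by (rule boundedI)
  show "closed (shell r b :: 'n phase set)"
    unfolding shell_def by (intro closed_Collect_le continuous_intros)
qed

lemma shell_push_zero: "z \<notin> shell r b \<Longrightarrow> push_ham (shell_cut r b) c i (z, t) = 0"
proof -
  assume "z \<notin> shell r b"
  then have "2 \<le> \<bar>(z \<bullet> z - r\<^sup>2) / b\<bar>" using b by (simp add: shell_def le_divide_eq)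
  then have "2\<^sup>2 \<le> ((z \<bullet> z - r\<^sup>2) / b)\<^sup>2"
    using abs_le_square_iff[of 2 "(z \<bullet> z - r\<^sup>2) / b"] by simp
  then show ?thesis by (simp add: push_ham_def shell_cut_def smooth_step_0)
qed

lemma phase_ham_shell_push:
  assumes "2 * r < R" shows "phase_ham R (push_ham (shell_cut r b) c i)"
proof -
  have "supported_upto (2 * r) (push_ham (shell_cut r b) c i)"
    unfolding supported_upto_def using shell_push_zero shell_norm_le by (meson not_less)
  then show ?thesis
    using assms smooth_push_ham[OF smooth_shell_cut] unfolding phase_ham_def by blast
qed

lemma shell_push_bound:
  assumes "c \<ge> 0" shows "\<bar>push_ham (shell_cut r b) c i (z, t)\<bar> \<le> c * (2 * r)"
proof (cases "z \<in> shell r b")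
  case True
  have "\<bar>snd z $ i\<bar> \<le> norm z"
    using component_le_norm_cart[of "snd z" i] norm_snd_le[where x="fst z" and y="snd z"] by (simp only: prod.collapse)
  then have "\<bar>snd z $ i\<bar> \<le> 2 * r" using shell_norm_le[OF True] by simp
  then have "c * \<bar>snd z $ i\<bar> \<le> c * (2 * r)" using assms by (rule mult_left_mono)
  moreover have "smooth_step (shell_cut r b z) * (c * \<bar>snd z $ i\<bar>) \<le> c * \<bar>snd z $ i\<bar>"
    using assms by (intro mult_left_le_one_le smooth_step_bounds) auto
  ultimately show ?thesis
    using assms by (simp add: push_ham_def abs_mult smooth_step_bounds)
next
  case False
  then show ?thesis using assms r by (simp add: shell_push_zero)
qed

context
  fixes c :: real and i :: "'n::finite" and R :: real
  assumes c: "0 < c" "c \<le> r" "3 * r * c < b" and R: "2 * r < R"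
begin

text \<open>A point of the sphere moved by at most \<open>c\<close> changes \<open>z \<bullet> z\<close> by at most \<open>2 * r * c + c\<^sup>2 \<le> 3 * r * c\<close>, so it stays
  where the cut-off is inactive.\<close>

lemma sphere_solution:
  assumes "norm z = r"
  shows "phase_solution (push_ham (shell_cut r b) c i) (\<lambda>\<tau>. z + \<tau> *\<^sub>R (axis i c, 0))"
proof (rule phase_solution_push[OF smooth_shell_cut])
  fix \<tau> :: real assume \<tau>: "\<tau> \<in> {0..1}"
  let ?u = "(axis i c, 0) :: 'n phase"
  let ?w = "z + \<tau> *\<^sub>R ?u"
  have "z \<bullet> z = r\<^sup>2" using assms by (simp add: dot_square_norm)
  then have "?w \<bullet> ?w - r\<^sup>2 = 2 * \<tau> * (z \<bullet> ?u) + \<tau> * \<tau> * (?u \<bullet> ?u)"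
    by (simp only: inner_add_left inner_add_right inner_scaleR_left inner_scaleR_right inner_commute[of ?u z])
       (simp add: algebra_simps)
  then have "\<bar>?w \<bullet> ?w - r\<^sup>2\<bar> \<le> \<bar>2 * \<tau> * (z \<bullet> ?u)\<bar> + \<bar>\<tau> * \<tau> * (?u \<bullet> ?u)\<bar>"
    using abs_triangle_ineq by metis
  also have "\<dots> \<le> 2 * (r * c) + c * c"
  proof (rule add_mono)
    have "\<bar>z \<bullet> ?u\<bar> \<le> r * c"
      using Cauchy_Schwarz_ineq2[of z ?u] assms c(1) by (simp only: norm_shift abs_of_pos)
    then have "\<bar>\<tau>\<bar> * \<bar>z \<bullet> ?u\<bar> \<le> 1 * (r * c)" using \<tau> by (intro mult_mono) auto
    then show "\<bar>2 * \<tau> * (z \<bullet> ?u)\<bar> \<le> 2 * (r * c)" unfolding abs_mult by simp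
    have "?u \<bullet> ?u = c * c"
      unfolding dot_square_norm norm_shift by (simp add: power2_eq_square)
    moreover have "\<tau> * \<tau> * (c * c) \<le> c * c" using \<tau> by (intro mult_left_le_one_le mult_le_one) auto
    ultimately show "\<bar>\<tau> * \<tau> * (?u \<bullet> ?u)\<bar> \<le> c * c" by (simp only: abs_mult abs_mult_self_eq)
  qed
  also have "\<dots> \<le> 3 * r * c" using mult_right_mono[OF c(2), of c] c(1) by (simp add: algebra_simps)
  also have "\<dots> < b" by (rule c(3))
  finally have "\<bar>(?w \<bullet> ?w - r\<^sup>2) / b\<bar> < 1" using b by (simp only: abs_divide abs_of_pos divide_less_eq) simp
  then have "((?w \<bullet> ?w - r\<^sup>2) / b)\<^sup>2 < 1" by (simp only: abs_square_less_1)
  then show "1 < shell_cut r b ?w" unfolding shell_cut_def by linarith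
qed

text \<open>On the sphere the flow is a translation, and a solution starting inside the moving sphere cannot
  cross it because solutions are unique.\<close>

lemma shell_flow_in_ball:
  assumes z: "norm z \<le> r"
  shows "norm (phase_flow (push_ham (shell_cut r b) c i) z - (axis i c, 0)) \<le> r"
proof -
  let ?p = "push_ham (shell_cut r b) c i" and ?u = "(axis i c, 0) :: 'n phase"
  have p: "phase_ham R ?p" by (rule phase_ham_shell_push[OF R])
  obtain \<delta> where \<delta>: "phase_solution ?p \<delta>" "\<delta> 0 = z" using phase_solution_exists[OF p] .
  have cont: "continuous_on {0..1} \<delta>"
    by (rule continuous_on_vector_derivative[where f'="\<lambda>t. phase_field ?p t (\<delta> t)"])
       (use \<delta>(1) in \<open>simp add: solves_ode_on_def\<close>)
  have "norm (\<delta> 1 - 1 *\<^sub>R ?u) \<le> r"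
  proof (rule ccontr)
    assume out: "\<not> norm (\<delta> 1 - 1 *\<^sub>R ?u) \<le> r"
    have "\<exists>s\<ge>0. s \<le> 1 \<and> norm (\<delta> s - s *\<^sub>R ?u) = r"
    proof (rule IVT')
      show "norm (\<delta> 0 - 0 *\<^sub>R ?u) \<le> r" using \<delta>(2) z by (simp del: scaleR_Pair)
      show "r \<le> norm (\<delta> 1 - 1 *\<^sub>R ?u)" using out by simp
      show "continuous_on {0..1} (\<lambda>s. norm (\<delta> s - s *\<^sub>R ?u))" by (intro continuous_intros cont)
    qed simp
    then obtain s where s: "s \<in> {0..1}" "norm (\<delta> s - s *\<^sub>R ?u) = r" by auto
    have "\<delta> t = (\<delta> s - s *\<^sub>R ?u) + t *\<^sub>R ?u" if "t \<in> {0..1}" for t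
      by (rule phase_solution_unique[OF p \<delta>(1) sphere_solution[OF s(2)] s(1) _ that]) (simp only: diff_add_cancel)
    from this[of 1] show False using out s(2) by (simp del: scaleR_Pair)
  qed
  then show ?thesis using phase_flow_eqI[OF p \<delta>] by simp
qed

end

end

section \<open>The commutator bound\<close>

lemma Q_eq_ball:
  assumes "r > 0" shows "Q r = (ball 0 r :: 'n::finite phase set)"
proof -
  have "z \<in> Q r \<longleftrightarrow> norm z < r" for z :: "'n phase"
  proof -
    have "(\<Sum>i\<in>UNIV. \<bar>fst z $ i\<bar>\<^sup>2) + (\<Sum>i\<in>UNIV. \<bar>snd z $ i\<bar>\<^sup>2) = (norm z)\<^sup>2"
      unfolding norm_prod_def norm_vec_def L2_set_def by (simp add: sum_nonneg)
    then have "z \<in> Q r \<longleftrightarrow> (norm z)\<^sup>2 < r\<^sup>2" unfolding Q_def case_prod_unfold mem_Collect_eq by simp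
    also have "\<dots> \<longleftrightarrow> norm z < r"
      using assms power_strict_mono[of "norm z" r 2] power2_less_imp_less[of "norm z" r] by fastforce
    finally show ?thesis .
  qed
  then show ?thesis by auto
qed

lemma boundary_nbhd_ball:
  assumes "r > 0" shows "boundary_nbhd l (ball 0 r :: 'n::finite phase set) = (\<Union>p\<in>sphere 0 r. ball p (1 / real l))"
  using assms by (auto simp: boundary_nbhd_def)

text \<open>The nearest point of the sphere is the radial projection.\<close>

lemma mem_boundary_nbhd_ball:
  fixes z :: "'n::finite phase"
  assumes r: "r > 0" and z: "z \<noteq> 0" "\<bar>norm z - r\<bar> < 1 / real l"
  shows "z \<in> boundary_nbhd l (ball 0 r)"
proof -
  let ?p = "(r / norm z) *\<^sub>R z"
  have "?p - z = ((r - norm z) / norm z) *\<^sub>R z"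
    using z(1) by (simp add: scaleR_diff_left diff_divide_distrib)
  then have "dist ?p z = \<bar>norm z - r\<bar>" using z(1) by (simp add: dist_norm)
  moreover have "?p \<in> sphere 0 r" using r z(1) by simp
  ultimately show ?thesis using z(2) unfolding boundary_nbhd_ball[OF r] by fastforce
qed

text \<open>This follows from \<open>(norm z)\<^sup>2 - r\<^sup>2 = (norm z - r) * (norm z + r)\<close>, whose last factor is at least \<open>r\<close>.\<close>

lemma shell_subset_boundary_nbhd:
  assumes r: "r > 0" and b: "b > 0" "4 * b \<le> r\<^sup>2" and l: "l \<ge> 1" "4 * b * real l \<le> r"
  shows "shell r b \<subseteq> boundary_nbhd l (ball 0 r :: 'n::finite phase set)"
proof
  fix z :: "'n phase" assume z: "z \<in> shell r b"
  have "\<bar>(norm z)\<^sup>2 - r\<^sup>2\<bar> \<le> 2 * b"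
    using z unfolding shell_def power2_norm_eq_inner by simp
  moreover have "(norm z)\<^sup>2 - r\<^sup>2 = (norm z - r) * (norm z + r)"
    by (simp add: power2_eq_square algebra_simps)
  ultimately have 1: "\<bar>norm z - r\<bar> * (norm z + r) \<le> 2 * b"
    using r by (simp add: abs_mult)
  have "\<bar>norm z - r\<bar> * r \<le> \<bar>norm z - r\<bar> * (norm z + r)" by (intro mult_left_mono) auto
  then have "\<bar>norm z - r\<bar> * r \<le> 2 * b" using 1 by linarith
  then have "\<bar>norm z - r\<bar> * r * real l \<le> 2 * b * real l" by (intro mult_right_mono) auto
  also have "\<dots> < 4 * b * real l" using b(1) l(1) by simp
  also have "\<dots> \<le> r" by (rule l(2))
  finally have "(\<bar>norm z - r\<bar> * real l) * r < 1 * r" by (simp add: mult_ac)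
  then have "\<bar>norm z - r\<bar> * real l < 1" using r by (simp only: mult_less_cancel_right_pos)
  then have "\<bar>norm z - r\<bar> < 1 / real l" using l(1) by (simp add: less_divide_eq)
  moreover have "z \<noteq> 0"
  proof
    assume "z = 0"
    then have "r\<^sup>2 \<le> 2 * b" using z by (simp add: shell_def)
    then show False using b by linarith
  qed
  ultimately show "z \<in> boundary_nbhd l (ball 0 r)" by (intro mem_boundary_nbhd_ball r)
qed

context symplectic_ball
begin

text \<open>The time-one map of \<open>h j\<close> identifies the ball in its current position with the ball at the origin, where
  \<open>p\<close> moves it by \<open>c\<close>.\<close>

lemma conjugates_drift:
  assumes h: "\<And>j. phase_ham R (h j)" and p: "phase_ham R p"
    and c: "c \<ge> 0" and big: "r + c < R"
    and push: "\<And>j z. j < N \<Longrightarrow> norm z \<le> r + c \<Longrightarrow> phase_flow (h j) z = z + (axis i (real j * c), 0)"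
    and step: "\<And>z. norm z \<le> r \<Longrightarrow> norm (phase_flow p z - (axis i c, 0)) \<le> r"
    and r: "r > 0" and j: "j \<le> N"
  shows "conjugates h p j ` (\<iota> ` cball 0 r) \<subseteq> \<iota> ` cball (axis i (real j * c), 0) r"
  using j
proof (induction j)
  case 0
  have "(axis i (real 0 * c), 0) = (0 :: 'n phase)" by (simp add: zero_prod_def axis_eq_0_iff)
  then show ?case by simp
next
  case (Suc j)
  let ?u = "\<lambda>j. (axis i (real j * c), 0) :: 'n phase" and ?v = "(axis i c, 0) :: 'n phase"
  have jN: "j < N" using Suc.prems by simp
  have shift: "norm ?v = c" "?v + ?u j = ?u (Suc j)"
    unfolding norm_shift using c by (simp_all add: axis_def vec_eq_iff algebra_simps)
  have move: "(\<Phi> (h j) \<circ> \<Phi> p \<circ> inv (\<Phi> (h j))) x \<in> \<iota> ` cball (?u (Suc j)) r" if x: "x \<in> \<iota> ` cball (?u j) r" for x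
  proof -
    obtain y where "x = \<iota> y" "y \<in> cball (?u j) r" using x by blast
    then have y: "x = \<iota> y" "norm (y - ?u j) \<le> r"
      unfolding mem_cball dist_norm norm_minus_commute[of "?u j"] .
    define z where "z = y - ?u j"
    have z: "norm z \<le> r" "y = z + ?u j" using y(2) by (simp_all add: z_def del: add_Pair)
    have zR: "norm z < R" using z(1) big c by linarith
    have "\<Phi> (h j) (\<iota> z) = \<iota> y"
      using \<Phi>_\<iota>[OF h zR, of j] push[OF jN, of z] z c by simp
    then have 1: "inv (\<Phi> (h j)) x = \<iota> z"
      using bij_\<Phi>[OF h[of j]] y(1) by (metis bij_is_inj inv_f_f)
    define w where "w = phase_flow p z"
    have w: "norm (w - ?v) \<le> r" unfolding w_def by (rule step[OF z(1)])
    have wn: "norm w \<le> r + c"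
      using norm_triangle_ineq[of "w - ?v" ?v] w shift(1) by (simp del: diff_Pair)
    have "norm w < R" using wn big by linarith
    then have "\<Phi> (h j) (\<Phi> p (\<iota> z)) = \<iota> (w + ?u j)"
      using \<Phi>_\<iota>[OF p zR] \<Phi>_\<iota>[OF h, of w j] push[OF jN wn] by (simp add: w_def)
    moreover have "w + ?u j \<in> cball (?u (Suc j)) r"
    proof -
      have "?u (Suc j) - (w + ?u j) = - (w - ?v)" using shift(2) by (metis add_diff_cancel_right minus_diff_eq)
      then show ?thesis using w by (simp only: mem_cball dist_norm norm_minus_cancel)
    qed
    ultimately show ?thesis using 1 by simp
  qed
  have "conjugates h p j ` (\<iota> ` cball 0 r) \<subseteq> \<iota> ` cball (?u j) r"
    by (rule Suc.IH) (use jN in simp)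
  then show ?case
    unfolding conjugates.simps image_comp[symmetric, of "\<Phi> (h j) \<circ> \<Phi> p \<circ> inv (\<Phi> (h j))"]
    using move by blast
qed

text \<open>The shell is chosen inside the neighborhood of the sphere of radius \<open>1 / l\<close>, and then \<open>N\<close> so large that one
  step of length \<open>c = 3 * r / N\<close> keeps the sphere inside the region where the cut-off function is linear.
  The product \<open>N * c\<close> is \<open>3 * r\<close>, so the total length does not depend on \<open>N\<close>.\<close>

lemma commutator_norm_bound:
  assumes r: "r > 0" and R: "R = 5 * r" and l: "l \<ge> 1"
    and f: "phase_ham R f" "supported_upto r f" and g: "phase_ham R g" "supported_upto r g"
  shows "fragmented_hofer_norm A \<omega> (\<iota> ` (boundary_nbhd l (ball 0 r) \<inter> ball 0 R)) (commutator (\<Phi> f) (\<Phi> g))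
    \<le> ereal (48 * r\<^sup>2)"
proof -
  define b where "b = min (r\<^sup>2 / 4) (r / (4 * real l))"
  have b: "b > 0" "4 * b \<le> r\<^sup>2" "4 * b * real l \<le> r"
  proof -
    show "b > 0" "4 * b \<le> r\<^sup>2" using r l by (auto simp: b_def)
    have "b * (4 * real l) \<le> r / (4 * real l) * (4 * real l)" by (intro mult_right_mono) (auto simp: b_def)
    then show "4 * b * real l \<le> r" using l by (simp add: mult_ac)
  qed
  obtain N :: nat where N: "real N > max 3 (9 * r\<^sup>2 / b)" using reals_Archimedean2 by blast
  define c where "c = 3 * r / real N"
  have N0: "real N > 0" using N by linarith
  have c: "0 < c" "c \<le> r" "3 * r * c < b" "real N * c = 3 * r"
  proof -
    show "0 < c" "real N * c = 3 * r" using r N0 by (auto simp: c_def)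
    show "c \<le> r" using r N N0 by (auto simp: c_def divide_le_eq mult.commute)
    have "9 * r\<^sup>2 / b < real N" using N by simp
    then have "9 * r\<^sup>2 < real N * b" using b(1) by (simp add: divide_less_eq)
    then show "3 * r * c < b" using N0 by (simp add: c_def divide_less_eq power2_eq_square mult_ac)
  qed
  obtain i :: 'n where True by blast
  define p where "p = push_ham (shell_cut r b) c i"
  \<comment> \<open>The conjugators have to translate the original ball, enlarged by one step, by up to \<open>3 * r\<close>. With these
    constants the linear function is unchanged up to radius \<open>sqrt 20 * r\<close> and vanishes beyond \<open>sqrt 24 * r\<close>,
    which is less than \<open>5 * r\<close>.\<close>
  define h where "h j = push_ham (ball_cut (24 * r\<^sup>2) (4 * r\<^sup>2)) (real j * c) i" for j
  have R2: "24 * r\<^sup>2 < R\<^sup>2" "R > 0" using r by (auto simp: R power_mult_distrib)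
  have d: "4 * r\<^sup>2 > 0" "0 \<le> 24 * r\<^sup>2" using r by auto
  have h: "phase_ham R (h j)" for j unfolding h_def by (rule phase_ham_ball_push[OF d R2])
  have rR: "2 * r < R" using r by (simp add: R)
  have p: "phase_ham R p" unfolding p_def by (rule phase_ham_shell_push[OF r b(1,2) rR])
  have push: "phase_flow (h j) z = z + (axis i (real j * c), 0)" if j: "j < N" and z: "norm z \<le> r + c" for j z
  proof -
    have "real j * c + c \<le> real N * c"
      using j mult_right_mono[of "real (Suc j)" "real N" c] c(1) by (auto simp: algebra_simps)
    moreover have "\<bar>real j * c\<bar> = real j * c" using c(1) by simp
    \<comment> \<open>The left-hand side is at most \<open>r + 3 * r\<close>; the factor \<open>17 / 4\<close> lies between \<open>4\<close> and \<open>sqrt 20\<close>.\<close>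
    ultimately have 1: "norm z + \<bar>real j * c\<bar> < 17 / 4 * r" using z c(4) r by linarith
    have 2: "(17 / 4 * r)\<^sup>2 \<le> 24 * r\<^sup>2 - 4 * r\<^sup>2" by (simp add: power2_eq_square)
    show ?thesis
      unfolding h_def by (rule phase_flow_ball_push[OF d R2 1 2])
  qed
  have step: "norm (phase_flow p z - (axis i c, 0)) \<le> r" if "norm z \<le> r" for z
    unfolding p_def by (rule shell_flow_in_ball[OF r b(1,2) c(1-3) rR that])
  have "0 \<le> c" "r + c < R" using c(1,2) rR by linarith+
  then have "conjugates h p N ` (\<iota> ` cball 0 r) \<subseteq> \<iota> ` cball (axis i (real N * c), 0) r"
    by (rule conjugates_drift[OF h p _ _ push step r order_refl])
  then have "conjugates h p N ` (\<iota> ` cball 0 r) \<subseteq> \<iota> ` cball (axis i (3 * r), 0) r"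
    unfolding c(4) .
  moreover have "\<iota> ` cball (axis i (3 * r), 0) r \<inter> \<iota> ` cball 0 r = {}"
  proof -
    have far: "norm (z :: 'n phase) \<ge> 2 * r \<and> norm z \<le> 4 * r" if "z \<in> cball (axis i (3 * r), 0) r" for z
    proof -
      have "norm (z - (axis i (3 * r), 0)) \<le> r" using that by (simp add: dist_norm norm_minus_commute)
      moreover have "norm ((axis i (3 * r), 0) :: 'n phase) = 3 * r" unfolding norm_shift using r by simp
      ultimately show ?thesis
        using norm_triangle_ineq2[of "(axis i (3 * r), 0)" z] norm_triangle_ineq2[of z "(axis i (3 * r), 0)"]
          norm_minus_commute[of z "(axis i (3 * r), 0)"] by linarith
    qed
    have "z \<noteq> w" if "norm z \<ge> 2 * r" "norm w \<le> r" for z w :: "'n phase" using that r by auto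
    moreover have "\<iota> z \<noteq> \<iota> w" if "z \<in> cball (axis i (3 * r), 0) r" "w \<in> cball 0 r" for z w
    proof
      assume "\<iota> z = \<iota> w"
      moreover have "norm z < R" "norm w < R" using far[OF that(1)] that(2) r by (auto simp: R)
      ultimately have "z = w" by (metis \<kappa>_\<iota>)
      then show False using far[OF that(1)] that(2) r by simp
    qed
    ultimately show ?thesis by blast
  qed
  ultimately have displaced: "conjugates h p N ` (\<iota> ` cball 0 r) \<inter> \<iota> ` cball 0 r = {}" by blast
  let ?U = "\<iota> ` (boundary_nbhd l (ball 0 r) \<inter> ball 0 R)"
  have sub: "shell r b \<subseteq> ball 0 R"
    using shell_norm_le[OF r b(1,2)] rR by fastforce
  have U: "\<iota> ` shell r b \<subseteq> ?U"
    using sub shell_subset_boundary_nbhd[OF r b(1,2) l b(3)] by blast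
  have zero: "p (z, t) = 0" if "z \<notin> shell r b" for z t
    unfolding p_def by (rule shell_push_zero[OF r b(1,2) that])
  have S: "Supp (transplant p) \<subseteq> ?U" "Supp (transplant (reversed p)) \<subseteq> ?U"
    by (rule order_trans[OF Supp_transplant[OF compact_shell[OF r b(1,2)] sub] U];
        simp add: zero reversed_def)+
  have B: "\<bar>p (z, t)\<bar> \<le> c * (2 * r)" for z t
    unfolding p_def by (rule shell_push_bound[OF r b(1,2) less_imp_le[OF c(1)]])
  have L: "hofer_length (transplant p) \<le> 2 * (c * (2 * r))" "hofer_length (transplant (reversed p)) \<le> 2 * (c * (2 * r))"
    by (rule hofer_length_transplant; use c(1) r B in \<open>simp add: reversed_def\<close>)+
  have "has_fragmentation A \<omega> ?U (commutator (\<Phi> f) (\<Phi> g)) (4 * (real N * (2 * (c * (2 * r)))))"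
    by (rule commutator_fragmentation[OF R2(2) f g h p S L displaced])
  moreover have "4 * (real N * (2 * (c * (2 * r)))) = 48 * r\<^sup>2"
  proof -
    have "4 * (real N * (2 * (c * (2 * r)))) = 16 * (real N * c) * r" by simp
    then show ?thesis unfolding c(4) by (simp add: power2_eq_square)
  qed
  ultimately show ?thesis using fragmented_hofer_norm_le by metis
qed

text \<open>A Hamiltonian diffeomorphism moving the centre \<open>\<iota> 0\<close> does not commute with one that moves the
  centre but not its image under the first.\<close>

lemma nontrivial_commutator:
  assumes r: "r > 0" "r < R"
  obtains f g where "phase_ham R f" "phase_ham R g" "supported_upto r f" "supported_upto r g"
    "commutator (\<Phi> f) (\<Phi> g) \<in> Ham A \<omega>" "commutator (\<Phi> f) (\<Phi> g) \<noteq> id"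
proof -
  obtain i :: 'n where True by blast
  \<comment> \<open>The cut-off is inactive up to radius \<open>\<rho> / sqrt 2\<close>, hence on the way of the centre, and zero beyond radius
    \<open>sqrt (3 / 4) * \<rho>\<close>.\<close>
  define bump where "bump \<rho> = push_ham (ball_cut (3 / 4 * \<rho>\<^sup>2) (\<rho>\<^sup>2 / 4)) (\<rho> / 2) i" for \<rho>
  have bump: "phase_ham R (bump \<rho>)" "supported_upto \<rho> (bump \<rho>)"
    "\<Phi> (bump \<rho>) (\<iota> 0) = \<iota> (axis i (\<rho> / 2), 0)" if \<rho>: "0 < \<rho>" "\<rho> \<le> r" for \<rho>
  proof -
    have d: "\<rho>\<^sup>2 / 4 > 0" "0 \<le> 3 / 4 * \<rho>\<^sup>2" using \<rho> by auto
    have "\<rho>\<^sup>2 < R\<^sup>2" using \<rho> r by (intro power_strict_mono) auto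
    then have R: "3 / 4 * \<rho>\<^sup>2 < R\<^sup>2" "R > 0" using \<rho> r zero_le_power2[of \<rho>] by linarith+
    show f: "phase_ham R (bump \<rho>)" unfolding bump_def by (rule phase_ham_ball_push[OF d R])
    have "sqrt (3 / 4 * \<rho>\<^sup>2) \<le> sqrt (\<rho>\<^sup>2)" by (rule real_sqrt_le_mono) simp
    then have "sqrt (3 / 4 * \<rho>\<^sup>2) \<le> \<rho>" using \<rho> by simp
    then show "supported_upto \<rho> (bump \<rho>)"
      using ball_push_supported[OF d R, of "\<rho> / 2" i] unfolding bump_def supported_upto_def by fastforce
    have "phase_flow (bump \<rho>) 0 = 0 + (axis i (\<rho> / 2), 0)"
      unfolding bump_def
      by (rule phase_flow_ball_push[OF d R, where B="2 / 3 * \<rho>"])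
         (use \<rho> in \<open>auto simp: power_mult_distrib power2_eq_square\<close>)
    then show "\<Phi> (bump \<rho>) (\<iota> 0) = \<iota> (axis i (\<rho> / 2), 0)"
      using \<Phi>_\<iota>[OF f, of 0] R(2) by simp
  qed
  \<comment> \<open>The map \<open>f\<close> moves the centre by \<open>r / 2\<close>, which is outside the ball of radius \<open>r / 4\<close> that supports \<open>g\<close>.\<close>
  define f g where "f = bump r" and "g = bump (r / 4)"
  have f: "phase_ham R f" "supported_upto r f" "\<Phi> f (\<iota> 0) = \<iota> (axis i (r / 2), 0)"
    using bump[of r] r by (simp_all add: f_def)
  have g: "phase_ham R g" "supported_upto (r / 4) g" "\<Phi> g (\<iota> 0) = \<iota> (axis i (r / 8), 0)"
    using bump[of "r / 4"] r by (simp_all add: g_def)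
  have g_fix: "\<Phi> g (\<iota> (axis i (r / 2), 0)) = \<iota> (axis i (r / 2), 0)"
  proof -
    have n: "norm ((axis i (r / 2), 0) :: 'n phase) = r / 2" unfolding norm_shift using r by simp
    show ?thesis
      using \<Phi>_\<iota>[OF g(1), of "(axis i (r / 2), 0)"] phase_flow_outside[OF g(1,2), of "(axis i (r / 2), 0)"] n r
      by simp
  qed
  note bf = bij_\<Phi>[OF f(1)] and bg = bij_\<Phi>[OF g(1)]
  have "commutator (\<Phi> f) (\<Phi> g) \<noteq> id"
  proof
    assume id: "commutator (\<Phi> f) (\<Phi> g) = id"
    have "\<Phi> f (\<Phi> g (\<iota> 0)) = commutator (\<Phi> f) (\<Phi> g) (\<Phi> g (\<Phi> f (\<iota> 0)))"
      using bf bg by (simp add: commutator_def bij_is_inj)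
    also have "\<dots> = \<Phi> f (\<iota> 0)"
      unfolding id using g_fix f(3) by simp
    finally have "\<Phi> f (\<Phi> g (\<iota> 0)) = \<Phi> f (\<iota> 0)" .
    then have "\<Phi> g (\<iota> 0) = \<iota> 0" using bij_is_inj[OF bf] by (rule injD[rotated])
    then have eq: "\<iota> (axis i (r / 8), 0) = \<iota> 0" using g(3) by simp
    have n: "norm ((axis i (r / 8), 0) :: 'n phase) = r / 8" unfolding norm_shift using r by simp
    have "norm ((axis i (r / 8), 0) :: 'n phase) < R" "norm (0 :: 'n phase) < R"
      unfolding n using r by simp_all
    then have "(axis i (r / 8), 0) = (0 :: 'n phase)"
      using eq by (metis \<kappa>_\<iota>)
    then show False using n r by simp
  qed
  moreover have "commutator (\<Phi> f) (\<Phi> g) \<in> Ham A \<omega>"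
  proof -
    note rf = phase_ham_reversed[OF f(1)] and rg = phase_ham_reversed[OF g(1)]
    have "commutator (\<Phi> f) (\<Phi> g) = \<Phi> (concat_ham (concat_ham (concat_ham (reversed g) (reversed f)) g) f)"
      by (simp add: commutator_def \<Phi>_concat phase_ham_concat f(1) g(1) rf rg inv_\<Phi> comp_assoc)
    then show ?thesis
      by (simp add: \<Phi>_Ham phase_ham_concat f(1) g(1) rf rg)
  qed
  moreover have "supported_upto r g" using g(2) r by (auto simp: supported_upto_def)
  ultimately show thesis using that f g by blast
qed

end

theorem theorem1p10:
  fixes A :: "('m::{t2_space, second_countable_topology}, 'n::finite) chart set"
    and \<omega> :: "('m, 'n) two_form"
    and r :: real
    and \<iota> :: "'n phase \<Rightarrow> 'm"
  assumes "symplectic_manifold A \<omega>"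
    and "r > 0"
    and "symplectic_embedding A \<omega> (Q (5 * r)) \<iota>"
  shows "(\<exists>C>0. \<forall>F G. \<forall>l\<ge>1.
            hamiltonian_function A F \<longrightarrow> hamiltonian_function A G \<longrightarrow>
            Supp F \<subseteq> \<iota> ` Q r \<longrightarrow> Supp G \<subseteq> \<iota> ` Q r \<longrightarrow>
            fragmented_hofer_norm A \<omega> (W \<iota> r l)
              (commutator (ham_diffeo A \<omega> F) (ham_diffeo A \<omega> G)) < ereal C)
         \<and> UBFH A \<omega> (W \<iota> r)"
proof
  have r: "r > 0" and r5: "r < 5 * r" "5 * r > 0" using assms(2) by auto
  interpret symplectic_ball A \<omega> "5 * r" \<iota>
    using assms(1,3) by unfold_locales (simp_all add: Q_eq_ball[OF r5(2)])
  have W: "W \<iota> r l = \<iota> ` (boundary_nbhd l (ball 0 r) \<inter> ball 0 (5 * r))" for l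
    by (simp add: W_def Q_eq_ball[OF r] Q_eq_ball[OF r5(2)])
  have "48 * r\<^sup>2 < 49 * r\<^sup>2" using r by simp
  then have bound: "fragmented_hofer_norm A \<omega> (W \<iota> r l) (commutator (\<Phi> f) (\<Phi> g)) < ereal (49 * r\<^sup>2)"
    if "phase_ham (5 * r) f" "supported_upto r f" "phase_ham (5 * r) g" "supported_upto r g" "l \<ge> 1" for f g l
    using commutator_norm_bound[OF r refl that(5,1-4)] unfolding W
    by (meson ereal_less(2) le_less_trans less_ereal.simps(1))
  have C: "49 * r\<^sup>2 > 0" using r by simp
  show "\<exists>C>0. \<forall>F G. \<forall>l\<ge>1. hamiltonian_function A F \<longrightarrow> hamiltonian_function A G \<longrightarrow>
      Supp F \<subseteq> \<iota> ` Q r \<longrightarrow> Supp G \<subseteq> \<iota> ` Q r \<longrightarrow>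
      fragmented_hofer_norm A \<omega> (W \<iota> r l) (commutator (ham_diffeo A \<omega> F) (ham_diffeo A \<omega> G)) < ereal C"
  proof (rule exI[of _ "49 * r\<^sup>2"], intro conjI C allI impI)
    fix F G :: "'m \<times> real \<Rightarrow> real" and l :: nat
    assume l: "l \<ge> 1" and F: "hamiltonian_function A F" "Supp F \<subseteq> \<iota> ` Q r"
      and G: "hamiltonian_function A G" "Supp G \<subseteq> \<iota> ` Q r"
    obtain f where f: "phase_ham (5 * r) f" "supported_upto r f"
      "\<And>x t. t \<in> {0..1} \<Longrightarrow> F (x, t) = transplant f (x, t)"
      using pull_back[OF F[unfolded Q_eq_ball[OF r]] r5(1)] by metis
    obtain g where g: "phase_ham (5 * r) g" "supported_upto r g"
      "\<And>x t. t \<in> {0..1} \<Longrightarrow> G (x, t) = transplant g (x, t)"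
      using pull_back[OF G[unfolded Q_eq_ball[OF r]] r5(1)] by metis
    have "ham_diffeo A \<omega> F = \<Phi> f" "ham_diffeo A \<omega> G = \<Phi> g"
      unfolding \<Phi>_def by (rule ham_diffeo_cong, erule f(3), rule ham_diffeo_cong, erule g(3))
    then show "fragmented_hofer_norm A \<omega> (W \<iota> r l) (commutator (ham_diffeo A \<omega> F) (ham_diffeo A \<omega> G)) < ereal (49 * r\<^sup>2)"
      using bound[OF f(1,2) g(1,2) l] by simp
  qed
  show "UBFH A \<omega> (W \<iota> r)"
    unfolding UBFH_def
  proof (intro conjI allI impI)
    fix l :: nat assume l: "l \<ge> 1"
    have "open (boundary_nbhd l (ball 0 r :: 'n phase set))"
      unfolding boundary_nbhd_ball[OF r] by auto
    then show "open (W \<iota> r l)" unfolding W by (intro open_embedding) auto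
    obtain i :: 'n where True by blast
    have "(axis i r, 0) \<in> boundary_nbhd l (ball 0 r :: 'n phase set) \<inter> ball 0 (5 * r)"
      using r l norm_shift[of i r] mem_boundary_nbhd_ball[OF r, of "(axis i r, 0)" l] by fastforce
    then show "W \<iota> r l \<noteq> {}" unfolding W by blast
  next
    obtain f g where fg: "phase_ham (5 * r) f" "phase_ham (5 * r) g" "supported_upto r f" "supported_upto r g"
      "commutator (\<Phi> f) (\<Phi> g) \<in> Ham A \<omega>" "commutator (\<Phi> f) (\<Phi> g) \<noteq> id"
      using nontrivial_commutator[OF r r5(1)] by metis
    then show "\<exists>\<phi>\<in>Ham A \<omega>. \<phi> \<noteq> id \<and> (\<exists>C>0. \<forall>l\<ge>1. fragmented_hofer_norm A \<omega> (W \<iota> r l) \<phi> < ereal C)"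
      using bound C by blast
  qed
qed

end
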